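(* Let $q$ be a prime power, $\chi$ a multiplicative character of $\mathbb{F}_{q^2}^*$ and $\lambda$ a nontrivial additive character of $\mathbb{F}_{q^2}$. Then, as formal power series in $u$, \[ 1+\sum_{n=1}^\infty\frac{u^n}{|U(n,q)|}\sum_{g\in U(n,q)}\chi(\det g)\,\lambda(\operatorname{tr} g) = \prod_{i\ge1}\left(1+(-1)^{i+1}\frac{u\,G_1(\chi,\lambda)}{q^i}+\frac{u^2G_2(\chi,\lambda)}{q^{2i}}\right). \]
   Context: $U(n,q)\subset GL(n,q^2)$ is the finite unitary group, i.e. the group of $n\times n$ matrices $g$ over $\mathbb{F}_{q^2}$ preserving a nondegenerate Hermitian form (e.g. $\bar g^{T}g=I$, where $\bar g$ applies $a\mapsto a^q$ entrywise). Set $\chi(0)=0$. Define $G_1(\chi,\lambda)=\sum_{\alpha\in\mathbb{F}_{q^2},\,\alpha^{q+1}=1}\chi(-\alpha)\lambda(-\alpha)$ and $G_2(\chi,\lambda)=\sum_{\alpha\in\mathbb{F}_{q^2},\,\alpha^{q+1}=1}\chi(\alpha)\sum_{\beta\in\mathbb{F}_{q^2}:\ \beta^{q-1}=\alpha^q\text{ or }\beta=0}\lambda(-\beta)$. *)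

theory Defs
  imports "Jordan_Normal_Form.Determinant" "HOL-Computational_Algebra.Formal_Power_Series"
begin

definition mat_trace :: "'a::comm_ring_1 mat \<Rightarrow> 'a" where
  "mat_trace g = (\<Sum>i<dim_row g. g $$ (i, i))"

text \<open>Finite unitary group U(n,q) inside GL(n,q^2), where the field 'a has q^2 elements
  and conjugation is a \<mapsto> a^q: matrices g with conj(g)^T g = I.\<close>
definition unitary_group :: "nat \<Rightarrow> nat \<Rightarrow> ('a::field) mat set" where
  "unitary_group q n = {g \<in> carrier_mat n n.
      transpose_mat (map_mat (\<lambda>a. a ^ q) g) * g = 1\<^sub>m n}"

definition mult_char :: "('a::field \<Rightarrow> complex) \<Rightarrow> bool" where
  "mult_char \<chi> \<longleftrightarrow> \<chi> 0 = 0 \<and> \<chi> 1 = 1 \<and>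
     (\<forall>x y. x \<noteq> 0 \<longrightarrow> y \<noteq> 0 \<longrightarrow> \<chi> (x * y) = \<chi> x * \<chi> y)"

definition add_char :: "('a::field \<Rightarrow> complex) \<Rightarrow> bool" where
  "add_char \<psi> \<longleftrightarrow> \<psi> 0 = 1 \<and> (\<forall>x y. \<psi> (x + y) = \<psi> x * \<psi> y)"

definition G1 :: "nat \<Rightarrow> ('a::field \<Rightarrow> complex) \<Rightarrow> ('a \<Rightarrow> complex) \<Rightarrow> complex" where
  "G1 q \<chi> \<psi> = (\<Sum>\<alpha>\<in>{\<alpha>::'a. \<alpha> ^ (q + 1) = 1}. \<chi> (- \<alpha>) * \<psi> (- \<alpha>))"

definition G2 :: "nat \<Rightarrow> ('a::field \<Rightarrow> complex) \<Rightarrow> ('a \<Rightarrow> complex) \<Rightarrow> complex" where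
  "G2 q \<chi> \<psi> = (\<Sum>\<alpha>\<in>{\<alpha>::'a. \<alpha> ^ (q + 1) = 1}. \<chi> \<alpha> *
      (\<Sum>\<beta>\<in>{\<beta>::'a. \<beta> ^ (q - 1) = \<alpha> ^ q \<or> \<beta> = 0}. \<psi> (- \<beta>)))"

definition unitary_gf :: "nat \<Rightarrow> ('a::field \<Rightarrow> complex) \<Rightarrow> ('a \<Rightarrow> complex) \<Rightarrow> complex fps" where
  "unitary_gf q \<chi> \<psi> = Abs_fps (\<lambda>n. if n = 0 then 1 else
      (1 / of_nat (card (unitary_group q n :: 'a mat set))) *
      (\<Sum>g\<in>unitary_group q n. \<chi> (det g) * \<psi> (mat_trace g)))"

definition unitary_factor :: "nat \<Rightarrow> complex \<Rightarrow> complex \<Rightarrow> nat \<Rightarrow> complex fps" where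
  "unitary_factor q g1 g2 i = 1 + fps_const ((-1) ^ (i + 1) * g1 / of_nat q ^ i) * fps_X
      + fps_const (g2 / of_nat q ^ (2 * i)) * fps_X ^ 2"

end

theory Submission
  imports Defs "HOL-Number_Theory.Residues"
begin

text \<open>
  With \<open>t = - 1 / q\<close> the product satisfies \<open>F(u) = L(-t u) F(t u)\<close>, where
  \<open>L(u) = 1 + G\<^sub>1 u + G\<^sub>2 u\<^sup>2\<close>, so the theorem amounts to a three-term recurrence for the normalized sums
  \<open>S\<^sub>n / |U(n,q)|\<close>, where \<open>S\<^sub>n\<close> is the sum of \<open>\<chi> (det g) \<psi> (tr g)\<close> over \<open>U(n,q)\<close>.

  Sorting \<open>g \<in> U(n,q)\<close> by its first column \<open>(a, r)\<close> gives \<open>g = h (1 \<oplus> g')\<close> for an explicit unitary \<open>h\<close> of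
  determinant 1 with that column, and the trace of \<open>g\<close> is
  \<open>a + tr g' + z \<langle>r, g' r\<rangle>\<close>. If \<open>r\<close> is not isotropic, it may be replaced by a multiple of the first basis vector,
  and Fourier inversion in \<open>a\<close> evaluates the contribution. If \<open>r\<close> is isotropic, one sorts the \<open>g'\<close> by
  \<open>k = \<langle>r, g' r\<rangle>\<close>: for \<open>k \<noteq> 0\<close> the matrices form a Bruhat cell on which a Gaussian sum leaves only \<open>S\<^sub>n\<close> two
  dimensions lower. There is a unique \<open>\<alpha>\<close> of norm 1 such that \<open>\<psi>\<close> is trivial on all \<open>x + \<alpha> x\<^sup>q\<close>; only the
  \<open>k\<close> with \<open>- k / k\<^sup>q = \<alpha>\<close> contribute, and \<open>G\<^sub>2 = q \<chi> \<alpha>\<close>.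
\<close>

text \<open>The explicit \<open>h\<close> exists only if \<open>r\<close> is not isotropic or
  \<open>a = 1\<close>. For isotropic \<open>r\<close> and other \<open>a\<close> of norm 1,
  multiplying the first row by \<open>a\<close> reduces the corner entry to 1; this costs only a
  factor known in advance and is how \<open>G1\<close> enters. Conversely, Fourier inversion needs a
  sum over all \<open>a\<close>, so the norm-1 terms missing from the non-isotropic part are added
  and subtracted again. For isotropic \<open>r\<close>, the matrices with \<open>k = 0\<close> do
  not form a single cell. They are never summed: the comparison with the untwisted sum carries the
  factor \<open>1 - \<psi> (s * k)\<close>, which is 0 at \<open>k = 0\<close>. Since the isotropic
  terms reach two dimensions further down, the splitting first yields a relation among four
  consecutive sums. It collapses to the three-term recurrence only by induction, the recurrence two
  dimensions lower being used to remove the surplus terms.\<close>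

text \<open>If \<open>m * n\<close> elements are spread over at most \<open>n\<close> fibers of size
  at most \<open>m\<close>, every inequality is tight. This turns root bounds for polynomials into
  exact fiber sizes of the trace and the norm, and hence into their surjectivity.\<close>

lemma fibers_full:
  fixes f :: "'b \<Rightarrow> 'c"
  assumes "finite A" "finite B" "f ` A \<subseteq> B" "m > 0"
    and le: "\<And>b. b \<in> B \<Longrightarrow> card {x \<in> A. f x = b} \<le> m"
    and B: "card B \<le> n" and A: "card A = m * n"
  shows "card B = n" "b \<in> B \<Longrightarrow> card {x \<in> A. f x = b} = m"
proof -
  have sum: "m * n = (\<Sum>b\<in>B. card {x \<in> A. f x = b})"
    using sum.group[OF assms(1-3), of "\<lambda>_. 1 :: nat"] A by simp
  also have "\<dots> \<le> (\<Sum>b\<in>B. m)" by (intro sum_mono le)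
  finally have "n \<le> card B" using \<open>m > 0\<close> by (simp add: mult.commute)
  then show eq: "card B = n" using B by simp
  show "card {x \<in> A. f x = b} = m" if b: "b \<in> B"
  proof (rule ccontr)
    assume "\<not> ?thesis"
    then have "card {x \<in> A. f x = b} < m" using le[OF b] by simp
    then have "(\<Sum>b\<in>B. card {x \<in> A. f x = b}) < (\<Sum>b\<in>B. m)"
      by (intro sum_strict_mono_ex1) (use assms le b in auto)
    then show False unfolding sum[symmetric] using eq by (simp add: mult.commute[of m n])
  qed
qed

text \<open>Translation by \<open>h\<close> permutes \<open>H\<close> and multiplies the sum by
  \<open>\<phi> h\<close>, which differs from 1.\<close>

lemma sum_char_subgroup:
  fixes \<phi> :: "'b::ab_group_add \<Rightarrow> complex"
  assumes "\<And>x. x \<in> H \<Longrightarrow> x + h \<in> H" "\<And>x. x \<in> H \<Longrightarrow> x - h \<in> H"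
    and "\<And>x. x \<in> H \<Longrightarrow> \<phi> (x + h) = \<phi> x * \<phi> h" and "\<phi> h \<noteq> 1"
  shows "(\<Sum>x\<in>H. \<phi> x) = 0"
proof -
  have "(\<Sum>x\<in>H. \<phi> x) = (\<Sum>x\<in>H. \<phi> (x + h))"
    by (rule sum.reindex_bij_witness[of _ "\<lambda>x. x + h" "\<lambda>x. x - h"]) (use assms in auto)
  also have "\<dots> = (\<Sum>x\<in>H. \<phi> x) * \<phi> h"
    using assms by (simp add: sum_distrib_right)
  finally show ?thesis using \<open>\<phi> h \<noteq> 1\<close> by (metis mult_cancel_left mult.right_neutral)
qed

section \<open>Entries and traces of matrices\<close>

lemma finite_carrier_mat [simp]: "finite (carrier_mat n m :: 'a::finite mat set)"
proof -
  have "carrier_mat n m \<subseteq> (\<lambda>f. mat n m f) ` (PiE ({..<n} \<times> {..<m}) (\<lambda>_. UNIV :: 'a set))"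
  proof
    fix A :: "'a mat" assume A: "A \<in> carrier_mat n m"
    have "A = mat n m (restrict (\<lambda>ij. A $$ ij) ({..<n} \<times> {..<m}))"
      by (rule eq_matI) (use A in auto)
    then show "A \<in> (\<lambda>f. mat n m f) ` (PiE ({..<n} \<times> {..<m}) (\<lambda>_. UNIV))"
      by (intro image_eqI[of A "mat n m" "restrict (\<lambda>ij. A $$ ij) ({..<n} \<times> {..<m})"]) auto
  qed
  then show ?thesis by (rule finite_subset) (intro finite_imageI finite_PiE, auto)
qed

lemma index_mult_mat_sum:
  assumes "A \<in> carrier_mat n m" "B \<in> carrier_mat m p" "i < n" "j < p"
  shows "(A * B) $$ (i, j) = (\<Sum>l<m. A $$ (i, l) * B $$ (l, j))"
  using assms by (auto simp: scalar_prod_def lessThan_atLeast0 intro: sum.cong)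

lemma mat_trace_mult_comm:
  fixes A :: "'a::comm_ring_1 mat"
  assumes A: "A \<in> carrier_mat n m" and B: "B \<in> carrier_mat m n"
  shows "mat_trace (A * B) = mat_trace (B * A)"
proof -
  have "mat_trace (A * B) = (\<Sum>i<n. \<Sum>l<m. A $$ (i, l) * B $$ (l, i))"
    using assms by (auto simp: mat_trace_def index_mult_mat_sum[OF A B] simp del: index_mult_mat(1) intro!: sum.cong)
  also have "\<dots> = (\<Sum>l<m. \<Sum>i<n. B $$ (l, i) * A $$ (i, l))"
    by (subst sum.swap) (simp add: mult.commute)
  also have "\<dots> = mat_trace (B * A)"
    using assms by (auto simp: mat_trace_def index_mult_mat_sum[OF B A] simp del: index_mult_mat(1) intro!: sum.cong)
  finally show ?thesis .
qed

lemma mat_trace_add: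
  "A \<in> carrier_mat n n \<Longrightarrow> B \<in> carrier_mat n n \<Longrightarrow> mat_trace (A + B) = mat_trace A + mat_trace B"
  by (simp add: mat_trace_def sum.distrib)

lemma mat_trace_smult: "A \<in> carrier_mat n n \<Longrightarrow> mat_trace (c \<cdot>\<^sub>m A) = c * mat_trace A"
  by (simp add: mat_trace_def sum_distrib_left)

lemma mat_trace_four_block:
  assumes "A \<in> carrier_mat n n" "D \<in> carrier_mat m m"
  shows "mat_trace (four_block_mat A B C D) = mat_trace A + mat_trace D"
proof -
  have "(\<Sum>i<n + m. f i) = (\<Sum>i<n. f i) + (\<Sum>i<m. f (n + i))" for f :: "nat \<Rightarrow> 'a"
    by (induction m) (auto simp: add.assoc)
  then show ?thesis using assms by (simp add: mat_trace_def)
qed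

lemma mult_assoc_mat4:
  assumes "A \<in> carrier_mat n m" "B \<in> carrier_mat m p" "C \<in> carrier_mat p k" "D \<in> carrier_mat k l"
  shows "A * B * (C * D) = A * (B * C) * D"
  using assms by (simp add: assoc_mult_mat[of _ n m _ p _ l] assoc_mult_mat[of _ m p _ k _ l]
    assoc_mult_mat[of _ n m _ k _ l])

lemma sum_lessThan_Suc_Suc:
  "(\<Sum>l<Suc (Suc m). f l) = f 0 + (f (Suc 0) + (\<Sum>l<m. f (Suc (Suc l))))"
  for f :: "nat \<Rightarrow> 'a::comm_monoid_add"
  by (simp add: sum.lessThan_Suc_shift del: sum.lessThan_Suc)

lemma less_Suc_Suc_cases:
  assumes "i < Suc (Suc m)"
  obtains "i = 0" | "i = Suc 0" | l where "l < m" "i = Suc (Suc l)"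
proof (cases i)
  case (Suc k)
  then show ?thesis using assms that by (cases k) simp_all
qed (rule that)

section \<open>The infinite product and the three-term recurrence\<close>

text \<open>The distance \<open>y\<close> to the limiting fixed point
  \<open>\<beta> / (1 - r)\<close> obeys the same contraction with an inhomogeneous term tending to
  0.\<close>

lemma affine_recursion_limit:
  fixes x b :: "nat \<Rightarrow> complex"
  assumes rec: "\<And>n. x (Suc n) = r * x n + b n" and b: "b \<longlonglongrightarrow> \<beta>" and r: "norm r < 1"
  shows "x \<longlonglongrightarrow> \<beta> / (1 - r)"
proof -
  define y where "y n = x n - \<beta> / (1 - r)" for n
  define e where "e n = b n - \<beta>" for n
  have "1 - r \<noteq> 0" using r by auto
  then have y: "y (Suc n) = r * y n + e n" for n
    by (simp add: y_def e_def rec field_simps)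
  have e: "e \<longlonglongrightarrow> 0" unfolding e_def using tendsto_diff[OF b tendsto_const[of \<beta>]] by simp
  have "y \<longlonglongrightarrow> 0"
  proof (rule LIMSEQ_I)
    fix \<epsilon> :: real assume \<epsilon>: "\<epsilon> > 0"
    let ?s = "norm r"
    \<comment> \<open>This solves \<open>?s * (\<epsilon> / 2) + \<delta> = \<epsilon> / 2\<close>,
      so the constant part of the bound below reproduces itself.\<close>
    define \<delta> where "\<delta> = \<epsilon> * (1 - ?s) / 2"
    have \<delta>: "\<delta> > 0" using \<epsilon> r by (simp add: \<delta>_def)
    obtain N where N: "\<And>n. n \<ge> N \<Longrightarrow> norm (e n) < \<delta>" using LIMSEQ_D[OF e \<delta>] by auto
    have bound: "norm (y (N + k)) \<le> ?s ^ k * norm (y N) + \<epsilon> / 2" for k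
    proof (induction k)
      case (Suc k)
      have "norm (y (N + Suc k)) \<le> ?s * norm (y (N + k)) + norm (e (N + k))"
        using norm_triangle_ineq[of "r * y (N + k)" "e (N + k)"] by (simp add: y norm_mult)
      also have "\<dots> \<le> ?s * (?s ^ k * norm (y N) + \<epsilon> / 2) + \<delta>"
        using N[of "N + k"] by (intro add_mono mult_left_mono Suc) auto
      also have "\<dots> = ?s ^ Suc k * norm (y N) + \<epsilon> / 2" by (simp add: \<delta>_def field_simps)
      finally show ?case .
    qed (use \<epsilon> in simp)
    have "(\<lambda>k. ?s ^ k * norm (y N)) \<longlonglongrightarrow> 0 * norm (y N)"
      by (intro tendsto_mult tendsto_const LIMSEQ_power_zero) (use r in simp)
    then have "(\<lambda>k. ?s ^ k * norm (y N)) \<longlonglongrightarrow> 0" by (simp only: mult_zero_left)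
    then obtain K where "\<forall>k\<ge>K. norm (?s ^ k * norm (y N) - 0) < \<epsilon> / 2"
      using LIMSEQ_D half_gt_zero[OF \<epsilon>] by blast
    then have K: "?s ^ k * norm (y N) < \<epsilon> / 2" if "k \<ge> K" for k
      using that by (simp only: diff_zero real_norm_def) (metis abs_ge_self order.strict_trans1)
    have "norm (y n - 0) < \<epsilon>" if "n \<ge> N + K" for n
    proof -
      define k where "k = n - N"
      have k: "n = N + k" "k \<ge> K" using that by (simp_all add: k_def)
      show ?thesis using bound[of k] K[OF k(2)] k(1) by simp
    qed
    then show "\<exists>no. \<forall>n\<ge>no. norm (y n - 0) < \<epsilon>" by blast
  qed
  then have "(\<lambda>n. y n + \<beta> / (1 - r)) \<longlonglongrightarrow> 0 + \<beta> / (1 - r)" by (intro tendsto_add tendsto_const)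
  then show ?thesis by (simp add: y_def)
qed

text \<open>With t = -1/q the factor of index i is 1 - g1 t^i u + g2 t^(2i) u^2. The alternating
  sign is absorbed in t, so replacing u by t u just raises the index.\<close>

lemma unitary_factor_dilate:
  assumes "q > 0"
  shows "unitary_factor q g1 g2 i oo (fps_const (- 1 / of_nat q) * fps_X) = unitary_factor q g1 g2 (Suc i)"
  using assms unfolding unitary_factor_def
  by (simp add: fps_compose_linear fps_eq_iff)
    (auto simp: le_Suc_eq power2_eq_square field_simps)

lemma unitary_product_Suc:
  assumes "q > 0"
  shows "(\<Prod>i\<in>{1..Suc M}. unitary_factor q g1 g2 i) =
    unitary_factor q g1 g2 1 * ((\<Prod>i\<in>{1..M}. unitary_factor q g1 g2 i) oo (fps_const (- 1 / of_nat q) * fps_X))"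
proof -
  have "(\<Prod>i\<in>{1..Suc M}. unitary_factor q g1 g2 i) =
      unitary_factor q g1 g2 1 * (\<Prod>i\<in>{1..M}. unitary_factor q g1 g2 (Suc i))"
    by (subst prod.atLeast_Suc_atMost) (simp_all add: prod.shift_bounds_cl_Suc_ivl del: prod.cl_ivl_Suc)
  also have "(\<Prod>i\<in>{1..M}. unitary_factor q g1 g2 (Suc i)) =
      (\<Prod>i\<in>{1..M}. unitary_factor q g1 g2 i oo (fps_const (- 1 / of_nat q) * fps_X))"
    by (simp only: unitary_factor_dilate[OF assms])
  also have "\<dots> = (\<Prod>i\<in>{1..M}. unitary_factor q g1 g2 i) oo (fps_const (- 1 / of_nat q) * fps_X)"
    by (rule fps_compose_prod_distrib[symmetric]) simp
  finally show ?thesis .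
qed

text \<open>Splitting off the first factor shows that the coefficient \<open>a M n\<close> follows,
  in \<open>M\<close>, an affine recursion with ratio \<open>t ^ n\<close>, whose inhomogeneous term
  contains only lower coefficients. Strong induction on \<open>n\<close> gives convergence, and the
  limit satisfies the fixed point equation, which is the assumed recurrence.\<close>

lemma unitary_product_limit:
  fixes f :: "nat \<Rightarrow> complex" and g1 g2 :: complex
  assumes q: "q \<ge> 2" and f0: "f 0 = 1" and f1: "f 1 * (- of_nat q - 1) = - g1"
    and f2: "\<And>n. f (Suc (Suc n)) * ((- of_nat q) ^ Suc (Suc n) - 1) = g2 * f n - g1 * f (Suc n)"
  shows "(\<lambda>M. fps_nth (\<Prod>i\<in>{1..M}. unitary_factor q g1 g2 i) n) \<longlonglongrightarrow> f n"
proof -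
  define t :: complex where "t = - 1 / of_nat q"
  define a where "a M n = fps_nth (\<Prod>i\<in>{1..M}. unitary_factor q g1 g2 i) n" for M n
  have q0: "of_nat q \<noteq> (0 :: complex)" and qp: "q > 0" using q by auto
  have nt: "norm t < 1" using q by (simp add: t_def norm_divide)
  have nt': "norm (t ^ n) < 1" if "n > 0" for n
    using nt that by (simp add: norm_power power_less_one_iff)
  have tq: "t * (- of_nat q) = 1" using q0 by (simp add: t_def)
  \<comment> \<open>Multiplying the assumed relation by \<open>t ^ n\<close>, the inverse of
    \<open>(- of_nat q) ^ n\<close>, turns it into the fixed point equation.\<close>
  have lim: "t ^ n * c / (1 - t ^ n) = d" if "d * ((- of_nat q) ^ n - 1) = c" "n > 0" for n c d
  proof -
    have "t ^ n * (- of_nat q) ^ n = 1" unfolding power_mult_distrib[symmetric] tq by simp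
    then have "t ^ n * c = d * (1 - t ^ n)" unfolding that(1)[symmetric] by (simp add: algebra_simps)
    moreover have "1 - t ^ n \<noteq> 0" using nt'[OF that(2)] by auto
    ultimately show ?thesis by simp
  qed
  have rec: "a (Suc M) n = t ^ n * a M n + (if n \<ge> 1 then (- g1 * t) * (t ^ (n - 1) * a M (n - 1)) else 0) +
      (if n \<ge> 2 then g2 * t ^ 2 * (t ^ (n - 2) * a M (n - 2)) else 0)" for M n
  proof -
    let ?F = "(\<Prod>i\<in>{1..M}. unitary_factor q g1 g2 i) oo (fps_const (- 1 / of_nat q) * fps_X)"
    have F: "fps_nth ?F k = t ^ k * a M k" for k by (simp add: fps_compose_linear a_def t_def)
    have u: "unitary_factor q g1 g2 1 = 1 + fps_const (- g1 * t) * fps_X + fps_const (g2 * t ^ 2) * fps_X ^ 2"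
      using q0 by (simp add: unitary_factor_def t_def power2_eq_square)
    have "a (Suc M) n = fps_nth (unitary_factor q g1 g2 1 * ?F) n"
      unfolding a_def unitary_product_Suc[OF qp] ..
    also have "unitary_factor q g1 g2 1 * ?F =
        ?F + fps_const (- g1 * t) * (fps_X * ?F) + fps_const (g2 * t ^ 2) * (fps_X ^ 2 * ?F)"
      unfolding u by (simp only: distrib_right mult_1_left mult.assoc)
    finally show ?thesis
      by (simp only: fps_add_nth fps_mult_left_const_nth fps_X_mult_nth fps_X_power_mult_nth F)
        (auto simp: numeral_2_eq_2)
  qed
  have "(\<lambda>M. a M n) \<longlonglongrightarrow> f n"
  proof (induction n rule: less_induct)
    case (less n)
    consider "n = 0" | "n = 1" | k where "n = Suc (Suc k)"
      by (metis One_nat_def not0_implies_Suc)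
    then show ?case
    proof cases
      case 1
      have "a M 0 = 1" for M
        by (induction M) (simp add: a_def, simp add: rec)
      then show ?thesis using 1 f0 by simp
    next
      case 2
      have "(\<lambda>M. a M 1) \<longlonglongrightarrow> (- g1 * t * f 0) / (1 - t)"
      proof (rule affine_recursion_limit[OF _ _ nt])
        show "a (Suc M) 1 = t * a M 1 + (- g1 * t) * a M 0" for M by (simp add: rec)
        show "(\<lambda>M. - g1 * t * a M 0) \<longlonglongrightarrow> - g1 * t * f 0"
          using less[of 0] 2 by (intro tendsto_mult tendsto_const) simp
      qed
      also have "(- g1 * t * f 0) / (1 - t) = f 1"
        using lim[of "f 1" 1 "- g1"] f1 f0 by (simp add: mult.commute)
      finally show ?thesis using 2 by simp
    next
      case (3 k)
      have "(\<lambda>M. a M n) \<longlonglongrightarrow> ((- g1 * t) * (t ^ Suc k * f (Suc k)) + g2 * t ^ 2 * (t ^ k * f k)) / (1 - t ^ n)"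
      proof (rule affine_recursion_limit[OF _ _ nt'])
        show "a (Suc M) n = t ^ n * a M n +
            ((- g1 * t) * (t ^ Suc k * a M (Suc k)) + g2 * t ^ 2 * (t ^ k * a M k))" for M
          using 3 by (simp add: rec[of M "Suc (Suc k)"] add.assoc)
        show "(\<lambda>M. (- g1 * t) * (t ^ Suc k * a M (Suc k)) + g2 * t ^ 2 * (t ^ k * a M k))
          \<longlonglongrightarrow> (- g1 * t) * (t ^ Suc k * f (Suc k)) + g2 * t ^ 2 * (t ^ k * f k)"
          using less[of k] less[of "Suc k"] 3 by (intro tendsto_add tendsto_mult tendsto_const) simp_all
        show "n > 0" using 3 by simp
      qed
      also have "(- g1 * t) * (t ^ Suc k * f (Suc k)) + g2 * t ^ 2 * (t ^ k * f k) =
          t ^ n * (g2 * f k - g1 * f (Suc k))"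
        using 3 by (simp add: algebra_simps power2_eq_square)
      also have "\<dots> / (1 - t ^ n) = f n" using lim[of "f n" n] f2[of k] 3 by simp
      finally show ?thesis .
    qed
  qed
  then show ?thesis by (simp add: a_def)
qed

text \<open>For the induction step of \<open>usum_recurrence\<close>: \<open>a\<close>,
  \<open>b\<close>, \<open>c\<close>, \<open>d\<close> are the sums in dimensions \<open>m\<close>
  to \<open>m + 3\<close>, \<open>u\<close> is (-q)^m and \<open>x\<close> is
  \<open>\<chi> \<alpha>\<close>. The assumption is the recurrence for \<open>c\<close>; on the left
  stand the expanded corner sums of the column splitting. Substituting for \<open>c\<close> leaves a
  polynomial identity.\<close>

lemma recurrence_identity:
  fixes q u G x a b c d :: complex
  assumes "c = - q * u * G * b + q ^ 2 * u ^ 2 * (1 + q * u) * x * a"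
  defines "t \<equiv> q ^ 2 * u"
  shows "(q * t ^ 2 + t) * q ^ 2 * x * (c + (q ^ 3 * u ^ 2 + q * u * (q - 1) - 1) * (c - q ^ 3 * u ^ 3 * x * a)) +
     G * (d + (q ^ 5 * u ^ 2 - q ^ 2 * u * (q - 1) - 1) * (d + q ^ 6 * u ^ 3 * x * b) - (q * t ^ 2 + t) * d) =
     - q * t * G * d + q ^ 2 * t ^ 2 * (1 + q * t) * x * c"
  unfolding assms by (simp add: eval_nat_numeral algebra_simps)

subsection \<open>The quadratic extension and its characters\<close>

locale unitary_gauss =
  fixes q :: nat and \<chi> \<psi> :: "'a::{finite, field} \<Rightarrow> complex"
  assumes q_prime_power: "\<exists>p k. prime p \<and> k > 0 \<and> q = p ^ k"
    and card_field: "card (UNIV :: 'a set) = q ^ 2"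
    and mult_char: "mult_char \<chi>"
    and add_char: "add_char \<psi>" and nontrivial: "\<exists>x. \<psi> x \<noteq> 1"
begin

definition cj :: "'a \<Rightarrow> 'a" where "cj x = x ^ q"

lemma q_ge_2: "q \<ge> 2"
proof -
  obtain p k where "prime p" "k > 0" "q = p ^ k" using q_prime_power by blast
  then have "p ^ 1 \<le> p ^ k" by (intro power_increasing) (auto simp: prime_gt_0_nat Suc_leI)
  then show ?thesis using prime_ge_2_nat[OF \<open>prime p\<close>] \<open>q = p ^ k\<close> by simp
qed

lemma q_pos: "q > 0" using q_ge_2 by simp

lemma cj_add [simp]: "cj (x + y) = cj x + cj y"
proof -
  obtain p k where pk: "prime p" "k > 0" "q = p ^ k" using q_prime_power by blast
  have "prime CHAR('a)"
    by (rule prime_CHAR_semidom) (rule finite_imp_CHAR_pos, simp)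
  moreover have "CHAR('a) dvd p ^ (k * 2)"
    using CHAR_dvd_CARD[where 'a = 'a] card_field pk by (simp add: power_mult)
  ultimately have "CHAR('a) = p"
    using pk(1) by (meson prime_dvd_power primes_dvd_imp_eq)
  then show ?thesis unfolding cj_def
    using freshmans_dream'[OF \<open>prime CHAR('a)\<close>, of q k x y] pk by simp
qed

lemma cj_mult [simp]: "cj (x * y) = cj x * cj y"
  by (simp add: cj_def power_mult_distrib)

lemma cj_0 [simp]: "cj 0 = 0" using q_pos by (simp add: cj_def)
lemma cj_1 [simp]: "cj 1 = 1" by (simp add: cj_def)

lemma cj_minus [simp]: "cj (- x) = - cj x"
  by (metis add.right_inverse cj_0 cj_add minus_unique)

lemma cj_diff [simp]: "cj (x - y) = cj x - cj y"
  by (metis cj_add cj_minus uminus_add_conv_diff add.commute)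

lemma cj_sum [simp]: "cj (sum f A) = (\<Sum>x\<in>A. cj (f x))"
  by (induction A rule: infinite_finite_induct) auto

lemma cj_cj [simp]: "cj (cj x) = x"
proof -
  have "x ^ (q ^ 2) = x"
  proof (cases "x = 0")
    case False
    \<comment> \<open>Multiplication by \<open>x\<close> permutes the nonzero elements, so their
      product can be cancelled. The additional factor \<open>x\<close> raises the exponent from the
      order of the multiplicative group to that of the field.\<close>
    have "x * (\<Prod>y\<in>UNIV-{0}. x * y) = x * x ^ (card (UNIV :: 'a set) - 1) * \<Prod>(UNIV-{0})"
      by (simp add: prod.distrib mult_ac)
    also have "x * x ^ (card (UNIV :: 'a set) - 1) = x ^ Suc (card (UNIV :: 'a set) - 1)"
      by (subst power_Suc) auto
    also have "Suc (card (UNIV :: 'a set) - 1) = card (UNIV :: 'a set)"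
      using finite_UNIV_card_ge_0[where ?'a = 'a] by simp
    also have "(\<Prod>y\<in>UNIV-{0}. x * y) = (\<Prod>y\<in>UNIV-{0}. y)"
      by (rule prod.reindex_bij_witness[of _ "\<lambda>y. y / x" "\<lambda>y. x * y"]) (use False in auto)
    finally show ?thesis by (simp add: card_field)
  qed (use q_pos in simp)
  then show ?thesis by (simp add: cj_def power_mult[symmetric] power2_eq_square)
qed

lemma cj_eq_0_iff [simp]: "cj x = 0 \<longleftrightarrow> x = 0"
  by (metis cj_0 cj_cj)

lemma cj_divide [simp]: "cj (x / y) = cj x / cj y"
  by (simp add: cj_def power_divide)

lemma cj_eq_1_iff [simp]: "cj x = 1 \<longleftrightarrow> x = 1"
  by (metis cj_1 cj_cj)

text \<open>The elements are roots of X^q - c X; that q is at least 2 keeps the two monomials apart.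
  The next two bounds are obtained in the same way.\<close>

lemma card_twisted_fixed_le:
  "card {x. cj x = c * x} \<le> q" for c :: 'a
proof -
  define p :: "'a poly" where "p = Polynomial.monom 1 q - Polynomial.monom c 1"
  have "Polynomial.coeff p q = 1" using q_ge_2 by (simp add: p_def)
  then have "p \<noteq> 0" by auto
  have "Polynomial.degree p \<le> q" unfolding p_def using q_ge_2
    by (intro degree_diff_le) (auto simp: Polynomial.degree_monom_eq intro: order.trans[OF Polynomial.degree_monom_le])
  moreover have "{x. cj x = c * x} = {x. poly p x = 0}"
    by (auto simp: p_def cj_def poly_monom)
  ultimately show ?thesis using card_poly_roots_bound[OF \<open>p \<noteq> 0\<close>] by simp
qed

lemma card_twisted_trace_fiber_le:
  assumes "c \<noteq> 0" shows "card {x. x + c * cj x = b} \<le> q"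
proof -
  define p :: "'a poly" where "p = Polynomial.monom c q + Polynomial.monom 1 1 - [:b:]"
  have "Polynomial.coeff p q = c" using q_ge_2 by (simp add: p_def coeff_pCons split: nat.split)
  then have "p \<noteq> 0" using assms by auto
  have "Polynomial.degree p \<le> q" unfolding p_def using q_ge_2
    by (intro degree_diff_le degree_add_le) (auto simp: Polynomial.degree_monom_eq intro: order.trans[OF Polynomial.degree_monom_le])
  moreover have "{x. x + c * cj x = b} = {x. poly p x = 0}"
    by (auto simp: p_def cj_def poly_monom algebra_simps)
  ultimately show ?thesis using card_poly_roots_bound[OF \<open>p \<noteq> 0\<close>] by simp
qed

lemma card_norm_fiber_le: "card {x. x * cj x = b} \<le> q + 1"
proof -
  define p :: "'a poly" where "p = Polynomial.monom 1 (q + 1) - [:b:]"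
  have "Polynomial.coeff p (q + 1) = 1" using q_ge_2 by (simp add: p_def coeff_pCons split: nat.split)
  then have "p \<noteq> 0" by auto
  have "Polynomial.degree p \<le> q + 1" unfolding p_def
    by (intro degree_diff_le) (auto simp: Polynomial.degree_monom_eq)
  moreover have "{x. x * cj x = b} = {x. poly p x = 0}"
    by (auto simp: p_def cj_def poly_monom)
  ultimately show ?thesis using card_poly_roots_bound[OF \<open>p \<noteq> 0\<close>] by simp
qed

text \<open>The map sending x to x + a x^q has values in the set of the first claim, because
  \<open>a\<close> has norm 1. That set and all fibers have at most q elements while the field has
  q^2, so \<open>fibers_full\<close> applies.\<close>

lemma twisted_trace_fibers:
  assumes a: "a * cj a = 1"
  shows card_twisted_fixed: "card {x. cj x = cj a * x} = q"
    and card_twisted_trace_fiber: "cj b = cj a * b \<Longrightarrow> card {x. x + a * cj x = b} = q"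
proof -
  have a0: "a \<noteq> 0" using a by auto
  have im: "(\<lambda>x. x + a * cj x) ` UNIV \<subseteq> {x. cj x = cj a * x}"
    using a by (auto simp: algebra_simps)
  have le: "card {x \<in> UNIV. x + a * cj x = b} \<le> q" for b
    using card_twisted_trace_fiber_le[OF a0] by simp
  note * = fibers_full[OF finite finite im q_pos le card_twisted_fixed_le, unfolded card_field power2_eq_square, OF refl]
  show "card {x. cj x = cj a * x} = q" by (rule *)
  show "card {x. x + a * cj x = b} = q" if "cj b = cj a * b" using *(2)[of b] that by simp
qed

lemma card_fixed: "card {x. cj x = x} = q"
  using card_twisted_fixed[of 1] by simp

lemma card_trace_fiber: "cj b = b \<Longrightarrow> card {x. x + cj x = b} = q"
  using card_twisted_trace_fiber[of 1 b] by simp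

text \<open>The norm maps the (q + 1)(q - 1) nonzero elements to the q - 1 nonzero fixed elements of
  \<open>cj\<close>, with fibers of size at most q + 1.\<close>

lemma card_norm_fiber:
  assumes "cj b = b" shows "card {x. x * cj x = b} = (if b = 0 then 1 else q + 1)"
proof (cases "b = 0")
  case False
  have im: "(\<lambda>x. x * cj x) ` (UNIV - {0}) \<subseteq> {x. cj x = x} - {0}" by auto
  have le: "card {x \<in> UNIV - {0}. x * cj x = b} \<le> q + 1" if "b \<in> {x. cj x = x} - {0}" for b
  proof -
    have "{x \<in> UNIV - {0}. x * cj x = b} = {x. x * cj x = b}" using that by auto
    then show ?thesis using card_norm_fiber_le by simp
  qed
  have "card ({x. cj x = x} - {0}) = q - 1" using card_fixed by (subst card_Diff_singleton) auto
  moreover have "card (UNIV - {0::'a}) = (q + 1) * (q - 1)"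
    using card_field q_pos
    by (subst card_Diff_singleton) (auto simp: algebra_simps power2_eq_square)
  ultimately have "card {x \<in> UNIV - {0}. x * cj x = b} = q + 1"
    using fibers_full(2)[OF _ _ im _ le, of "q-1" b] assms False by auto
  moreover have "{x \<in> UNIV - {0}. x * cj x = b} = {x. x * cj x = b}" using False by auto
  ultimately show ?thesis using False by simp
qed auto

lemma ex_norm: assumes "cj b = b" obtains x where "x * cj x = b"
proof -
  have "{x. x * cj x = b} \<noteq> {}" using card_norm_fiber[OF assms] by (auto split: if_splits simp del: Collect_empty_eq)
  then show ?thesis using that by blast
qed

lemma ex_trace: assumes "cj b = b" obtains x where "x + cj x = b"
proof -
  have "{x. x + cj x = b} \<noteq> {}" using card_trace_fiber[OF assms] q_pos by (auto simp del: Collect_empty_eq)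
  then show ?thesis using that by blast
qed

section \<open>Character sums over the field and over lines\<close>

lemma psi_0 [simp]: "\<psi> 0 = 1" and psi_add: "\<psi> (x + y) = \<psi> x * \<psi> y"
  using add_char by (auto simp: add_char_def)

lemma psi_minus: "\<psi> x * \<psi> (- x) = 1"
  using psi_add[of x "-x"] by simp

lemma chi_1 [simp]: "\<chi> 1 = 1" and chi_0 [simp]: "\<chi> 0 = 0"
  using mult_char by (auto simp: mult_char_def)

lemma chi_mult: "\<chi> (x * y) = \<chi> x * \<chi> y"
  using mult_char by (cases "x = 0 \<or> y = 0") (auto simp: mult_char_def)

lemma sum_psi: "(\<Sum>x\<in>UNIV. \<psi> (b * x)) = (if b = 0 then of_nat q ^ 2 else 0)"
proof (cases "b = 0")
  case True
  then show ?thesis using card_field by simp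
next
  case False
  obtain h where "\<psi> h \<noteq> 1" using nontrivial by blast
  then have "(\<Sum>x\<in>UNIV. \<psi> (b * x)) = 0"
    using sum_char_subgroup[of UNIV "h / b" "\<lambda>x. \<psi> (b * x)"] False
    by (simp add: distrib_left psi_add)
  then show ?thesis using False by simp
qed

text \<open>The summand is itself an additive character of \<open>x\<close>, so its sum is 0 unless
  that character is trivial.\<close>

lemma sum_psi_twisted: "(\<Sum>x\<in>UNIV. \<psi> (x + a * cj x)) \<in> {0, of_nat q ^ 2}"
  "(\<Sum>x\<in>UNIV. \<psi> (x + a * cj x)) = of_nat q ^ 2 \<longleftrightarrow> (\<forall>x. \<psi> (x + a * cj x) = 1)"
proof -
  have q0: "of_nat q ^ 2 \<noteq> (0 :: complex)" using q_pos by simp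
  have "(\<Sum>x\<in>UNIV. \<psi> (x + a * cj x)) = 0" if "\<psi> (h + a * cj h) \<noteq> 1" for h
    by (rule sum_char_subgroup[of UNIV h]) (use that in \<open>auto simp: psi_add[symmetric] algebra_simps\<close>)
  moreover have "(\<Sum>x\<in>UNIV. \<psi> (x + a * cj x)) = of_nat q ^ 2" if "\<forall>x. \<psi> (x + a * cj x) = 1"
    using that card_field by simp
  ultimately consider "(\<Sum>x\<in>UNIV. \<psi> (x + a * cj x)) = 0" "\<not> (\<forall>x. \<psi> (x + a * cj x) = 1)"
    | "(\<Sum>x\<in>UNIV. \<psi> (x + a * cj x)) = of_nat q ^ 2" "\<forall>x. \<psi> (x + a * cj x) = 1"
    by blast
  then show "(\<Sum>x\<in>UNIV. \<psi> (x + a * cj x)) \<in> {0, of_nat q ^ 2}"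
    "(\<Sum>x\<in>UNIV. \<psi> (x + a * cj x)) = of_nat q ^ 2 \<longleftrightarrow> (\<forall>x. \<psi> (x + a * cj x) = 1)"
    by (cases; use q0 in simp)+
qed

text \<open>Summing over all \<open>a\<close> of norm 1 first, the map \<open>a \<mapsto> a x\<^sup>q / x\<close> permutes the norm-1 elements, so the double sum
  is \<open>q\<^sup>2\<close>; each inner sum is 0 or \<open>q\<^sup>2\<close>, so exactly one of them survives.\<close>

lemma ex_twist: "\<exists>!a. a * cj a = 1 \<and> (\<forall>x. \<psi> (x + a * cj x) = 1)"
proof -
  let ?U = "{a. a * cj a = 1}"
  have "(\<Sum>a\<in>?U. \<Sum>x\<in>UNIV. \<psi> (x + a * cj x)) = (\<Sum>x\<in>UNIV. \<Sum>a\<in>?U. \<psi> (x + a * cj x))"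
    by (rule sum.swap)
  also have "\<dots> = (\<Sum>x\<in>UNIV. \<Sum>b\<in>?U. \<psi> ((1 + b) * x))"
  proof (rule sum.cong[OF refl])
    fix x
    show "(\<Sum>a\<in>?U. \<psi> (x + a * cj x)) = (\<Sum>b\<in>?U. \<psi> ((1 + b) * x))"
    proof (cases "x = 0")
      case False
      then show ?thesis
        by (intro sum.reindex_bij_witness[of _ "\<lambda>b. b * x / cj x" "\<lambda>a. a * cj x / x"])
          (auto simp: algebra_simps)
    qed simp
  qed
  also have "\<dots> = (\<Sum>b\<in>?U. \<Sum>x\<in>UNIV. \<psi> ((1 + b) * x))" by (rule sum.swap)
  also have "\<dots> = (\<Sum>b\<in>?U. if b = -1 then of_nat q ^ 2 else 0)"
    by (intro sum.cong refl) (simp add: sum_psi add_eq_0_iff)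
  also have "\<dots> = of_nat q ^ 2" by (subst sum.delta) auto
  finally have tot: "(\<Sum>a\<in>?U. \<Sum>x\<in>UNIV. \<psi> (x + a * cj x)) = of_nat q ^ 2" .
  let ?T = "{a\<in>?U. \<forall>x. \<psi> (x + a * cj x) = 1}"
  have "(\<Sum>a\<in>?U. \<Sum>x\<in>UNIV. \<psi> (x + a * cj x)) =
      (\<Sum>a\<in>?U. if \<forall>x. \<psi> (x + a * cj x) = 1 then of_nat q ^ 2 else 0)"
    using sum_psi_twisted by (intro sum.cong refl) (auto simp: card_field)
  also have "\<dots> = (\<Sum>a\<in>?T. of_nat q ^ 2)"
    by (rule sum.inter_filter[symmetric]) simp
  also have "\<dots> = of_nat (card ?T) * of_nat q ^ 2" by simp
  finally have "card ?T = 1" using tot q_pos by simp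
  then obtain a where "?T = {a}" by (auto simp: card_1_singleton_iff)
  then show ?thesis by (intro ex1I[of _ a]) auto
qed

text \<open>If \<open>\<psi>\<close> is the composition of
  \<open>x \<mapsto> c * x + cj (c * x)\<close> with a nontrivial additive character of the field of
  q elements, this is -c^(q-1).\<close>

definition \<alpha> :: 'a where "\<alpha> = (THE a. a * cj a = 1 \<and> (\<forall>x. \<psi> (x + a * cj x) = 1))"

lemma alpha_norm: "\<alpha> * cj \<alpha> = 1" and psi_alpha: "\<psi> (x + \<alpha> * cj x) = 1"
  using theI'[OF ex_twist, folded \<alpha>_def] by blast+

lemma alpha_unique: "a * cj a = 1 \<Longrightarrow> (\<And>x. \<psi> (x + a * cj x) = 1) \<Longrightarrow> a = \<alpha>"
  unfolding \<alpha>_def by (rule the1_equality[OF ex_twist, symmetric]) simp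

lemma alpha_nonzero [simp]: "\<alpha> \<noteq> 0" using alpha_norm by auto

text \<open>The line is the image of x + a x^q, each value being taken q times. Hence q times this
  sum is the twisted sum over the whole field, which is nonzero only for
  \<open>\<alpha>\<close>.\<close>

lemma sum_psi_line:
  assumes a: "a * cj a = 1"
  shows "(\<Sum>x\<in>{x. cj x = cj a * x}. \<psi> x) = (if a = \<alpha> then of_nat q else 0)"
proof -
  let ?K = "{x. cj x = cj a * x}"
  have "(\<Sum>x\<in>UNIV. \<psi> (x + a * cj x)) = (\<Sum>b\<in>?K. \<Sum>x\<in>{x\<in>UNIV. x + a * cj x = b}. \<psi> (x + a * cj x))"
    by (rule sum.group[symmetric]) (use a in \<open>auto simp: algebra_simps\<close>)
  also have "\<dots> = (\<Sum>b\<in>?K. of_nat q * \<psi> b)"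
    by (intro sum.cong refl) (simp add: card_twisted_trace_fiber[OF a])
  finally have "of_nat q * (\<Sum>b\<in>?K. \<psi> b) = (\<Sum>x\<in>UNIV. \<psi> (x + a * cj x))"
    by (simp add: sum_distrib_left)
  also have "\<dots> = (if a = \<alpha> then of_nat q ^ 2 else 0)"
  proof (cases "a = \<alpha>")
    case True
    then show ?thesis using sum_psi_twisted(2)[of \<alpha>] psi_alpha by simp
  next
    case False
    then have "\<not> (\<forall>x. \<psi> (x + a * cj x) = 1)" using alpha_unique[OF a] by blast
    then have "(\<Sum>x\<in>UNIV. \<psi> (x + a * cj x)) = 0" using sum_psi_twisted[of a] by blast
    then show ?thesis using False by (simp only: if_False)
  qed
  finally show ?thesis using q_pos by (auto simp: power2_eq_square split: if_splits)
qed

lemma sum_psi_line_neg: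
  "a * cj a = 1 \<Longrightarrow> (\<Sum>x\<in>{x. cj x = cj a * x}. \<psi> (- x)) = (if a = \<alpha> then of_nat q else 0)"
  by (subst sum_psi_line[symmetric], simp, rule sum.reindex_bij_witness[of _ uminus uminus]) auto

lemma G1_eq: "G1 q \<chi> \<psi> = (\<Sum>a\<in>{a. a * cj a = 1}. \<chi> a * \<psi> a)"
  unfolding G1_def
  by (rule sum.reindex_bij_witness[of _ uminus uminus])
    (use cj_minus in \<open>auto simp: cj_def[symmetric]\<close>)

text \<open>The two alternatives for \<open>\<beta>\<close> in \<open>G2\<close> together describe
  the line \<open>cj b = cj a * b\<close>, zero included. Its character sum vanishes for every
  \<open>a\<close> except \<open>\<alpha>\<close>.\<close>

lemma G2_eq: "G2 q \<chi> \<psi> = of_nat q * \<chi> \<alpha>"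
proof -
  have line: "{b::'a. b ^ (q - 1) = a ^ q \<or> b = 0} = {b. cj b = cj a * b}" for a
  proof -
    have "b ^ q = b * b ^ (q - 1)" for b :: 'a
      using q_pos by (metis power_minus_mult mult.commute)
    then show ?thesis by (auto simp: cj_def)
  qed
  have "G2 q \<chi> \<psi> = (\<Sum>a\<in>{a. a * cj a = 1}. \<chi> a * (\<Sum>x\<in>{x. cj x = cj a * x}. \<psi> (- x)))"
    unfolding G2_def line by (auto simp: cj_def)
  also have "\<dots> = (\<Sum>a\<in>{a. a * cj a = 1}. if a = \<alpha> then \<chi> a * of_nat q else 0)"
    by (intro sum.cong refl) (auto simp: sum_psi_line_neg)
  also have "\<dots> = of_nat q * \<chi> \<alpha>" using alpha_norm by (subst sum.delta) auto
  finally show ?thesis .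
qed

text \<open>The term \<open>cj a * b\<close> is only semilinear in \<open>a\<close>. Since
  \<open>\<psi>\<close> is trivial on \<open>y + \<alpha> * cj y\<close> with
  \<open>y = a * cj b * \<alpha>\<close>, it may be traded for \<open>- \<alpha> * cj b * a\<close>.
  Then orthogonality applies to the linear coefficient \<open>1 - \<alpha> * cj b\<close>.\<close>

lemma sum_psi_twist:
  "(\<Sum>a\<in>UNIV. \<psi> (a + (cj a - 1) * b)) = (if b = \<alpha> then \<psi> (- b) * of_nat q ^ 2 else 0)"
proof -
  have "\<psi> (a + (cj a - 1) * b) = \<psi> (- b) * \<psi> ((1 - \<alpha> * cj b) * a)" for a
  proof -
    have "\<alpha> * cj (a * cj b * \<alpha>) = (\<alpha> * cj \<alpha>) * (cj a * b)" by (simp add: mult_ac)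
    then have "\<alpha> * cj (a * cj b * \<alpha>) = cj a * b" by (simp only: alpha_norm mult_1_left)
    then have "\<psi> (\<alpha> * cj b * a + cj a * b) = 1" using psi_alpha[of "a * cj b * \<alpha>"]
      by (simp only: mult.commute mult.left_commute)
    moreover have "a + (cj a - 1) * b = - b + (1 - \<alpha> * cj b) * a + (\<alpha> * cj b * a + cj a * b)"
      by (simp add: algebra_simps)
    ultimately show ?thesis by (simp only: psi_add mult_1_right)
  qed
  then have "(\<Sum>a\<in>UNIV. \<psi> (a + (cj a - 1) * b)) =
      \<psi> (- b) * (if 1 - \<alpha> * cj b = 0 then of_nat q ^ 2 else 0)"
    by (simp add: sum_psi sum_distrib_left[symmetric])
  moreover have "1 - \<alpha> * cj b = 0 \<longleftrightarrow> b = \<alpha>"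
  proof -
    have "1 - \<alpha> * cj b = \<alpha> * cj (\<alpha> - b)" by (simp only: alpha_norm[symmetric] cj_diff right_diff_distrib)
    then have "1 - \<alpha> * cj b = 0 \<longleftrightarrow> \<alpha> - b = 0" by (simp only: mult_eq_0_iff alpha_nonzero cj_eq_0_iff simp_thms)
    then show ?thesis by auto
  qed
  ultimately show ?thesis by simp
qed

text \<open>Multiplication by \<open>k\<close> carries the elements of trace zero to the line
  belonging to \<open>- k / cj k\<close>.\<close>

lemma sum_psi_trace_zero:
  assumes k: "k \<noteq> 0"
  shows "(\<Sum>z\<in>{z. z + cj z = 0}. \<psi> (k * z)) = (if - k / cj k = \<alpha> then of_nat q else 0)"
proof -
  let ?a = "- k / cj k"
  have a: "?a * cj ?a = 1" using k by simp
  have "(\<Sum>z\<in>{z. z + cj z = 0}. \<psi> (k * z)) = (\<Sum>x\<in>{x. cj x = cj ?a * x}. \<psi> x)"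
    by (rule sum.reindex_bij_witness[of _ "\<lambda>x. x / k" "\<lambda>z. k * z"])
      (use k in \<open>auto simp: field_simps add_eq_0_iff\<close>)
  then show ?thesis using sum_psi_line[OF a] by simp
qed

text \<open>Adding 0 makes the index set a group \<open>?K\<close> of order q, at the price of a
  zero summand; it remains to see that \<open>x \<mapsto> \<psi> (s * x)\<close> is nontrivial on
  it. For nonzero \<open>k\<close> in \<open>?K\<close>, \<open>\<psi> (k * z)\<close> is 1 for all
  \<open>z\<close> of trace zero, since \<open>k * z\<close> has the form
  \<open>x + \<alpha> * cj x\<close>. As \<open>s\<close> has nonzero trace, triviality on
  \<open>s * ?K\<close> would extend this to all \<open>z\<close> and make \<open>\<psi>\<close>
  trivial.\<close>

lemma sum_psi_dual_line:
  assumes s: "s + cj s = -1"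
  shows "(\<Sum>k\<in>{k. k \<noteq> 0 \<and> - k / cj k = \<alpha>}. 1 - \<psi> (s * k)) = of_nat q"
proof -
  let ?K = "{k. cj k = cj (- \<alpha>) * k}"
  have K: "{k. k \<noteq> 0 \<and> - k / cj k = \<alpha>} = ?K - {0}"
  proof -
    have "- k / cj k = \<alpha> \<longleftrightarrow> cj k = cj (- \<alpha>) * k" if "k \<noteq> 0" for k
    proof -
      have "- k / cj k = \<alpha> \<longleftrightarrow> - k = \<alpha> * cj k" using that by (simp add: field_simps)
      also have "\<dots> \<longleftrightarrow> cj \<alpha> * (- k) = cj \<alpha> * (\<alpha> * cj k)"
        by (simp only: mult_cancel_left cj_eq_0_iff alpha_nonzero simp_thms)
      also have "cj \<alpha> * (\<alpha> * cj k) = cj k"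
        by (metis alpha_norm mult.assoc mult.commute mult_1_left)
      also have "cj \<alpha> * (- k) = cj k \<longleftrightarrow> cj k = cj (- \<alpha>) * k" by auto
      finally show ?thesis .
    qed
    then show ?thesis by auto
  qed
  have card: "card ?K = q" using card_twisted_fixed[of "- \<alpha>"] alpha_norm by simp
  have "\<exists>h\<in>?K. \<psi> (s * h) \<noteq> 1"
  proof (rule ccontr)
    assume "\<not> (\<exists>h\<in>?K. \<psi> (s * h) \<noteq> 1)"
    then have triv: "\<psi> (s * h) = 1" if "h \<in> ?K" for h using that by blast
    have "card (?K - {0}) \<noteq> 0" using card q_ge_2 by (subst card_Diff_singleton) auto
    then obtain k where k: "k \<in> ?K" "k \<noteq> 0"
      by (metis (no_types, lifting) Diff_iff card_eq_0_iff ex_in_conv insertI1)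
    then have k': "- k / cj k = \<alpha>" using K by blast
    have triv0: "\<psi> (k * z) = 1" if z: "z + cj z = 0" for z
    proof -
      have "cj (k * z) = cj \<alpha> * (k * z)" using k z by (simp add: add_eq_0_iff)
      then have "card {x. x + \<alpha> * cj x = k * z} = q" by (rule card_twisted_trace_fiber[OF alpha_norm])
      then have "{x. x + \<alpha> * cj x = k * z} \<noteq> {}" using q_pos by (auto simp del: Collect_empty_eq)
      then obtain x where "x + \<alpha> * cj x = k * z" by blast
      then show ?thesis using psi_alpha by metis
    qed
    have "\<psi> (k * x) = 1" for x
    proof -
      \<comment> \<open>Chosen so that \<open>x - a * s\<close> has trace zero, \<open>s\<close>
        having trace -1.\<close>
      define a where "a = - (x + cj x)"
      have "cj a = a" by (simp add: a_def)
      then have "a * k \<in> ?K" using k by simp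
      then have "\<psi> (s * (a * k)) = 1" by (rule triv)
      moreover have "(x - a * s) + cj (x - a * s) = - a - a * (s + cj s)"
        using \<open>cj a = a\<close> by (simp add: a_def algebra_simps)
      then have "\<psi> (k * (x - a * s)) = 1" using s by (intro triv0) simp
      moreover have "k * x = s * (a * k) + k * (x - a * s)" by (simp add: algebra_simps)
      ultimately show ?thesis by (simp only: psi_add mult_1_right)
    qed
    moreover obtain y where "\<psi> y \<noteq> 1" using nontrivial by blast
    ultimately show False using k(2) by (metis nonzero_mult_div_cancel_left times_divide_eq_right)
  qed
  then obtain h where h: "h \<in> ?K" "\<psi> (s * h) \<noteq> 1" by blast
  have "(\<Sum>k\<in>?K. \<psi> (s * k)) = 0"
    by (rule sum_char_subgroup[of _ h]) (use h in \<open>auto simp: algebra_simps psi_add\<close>)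
  then have "(\<Sum>k\<in>?K. 1 - \<psi> (s * k)) = of_nat q" using card by (simp add: sum_subtractf)
  moreover have "(\<Sum>k\<in>?K. 1 - \<psi> (s * k)) = (\<Sum>k\<in>?K - {0}. 1 - \<psi> (s * k))"
    by (rule sum.mono_neutral_right) auto
  ultimately show ?thesis unfolding K by simp
qed

subsection \<open>Unitary matrices and Hermitian spheres\<close>

definition adj :: "'a mat \<Rightarrow> 'a mat" where "adj A = transpose_mat (map_mat cj A)"

lemma adj_carrier [simp]: "adj A \<in> carrier_mat n m \<longleftrightarrow> A \<in> carrier_mat m n"
  by (auto simp: adj_def)

lemma dim_adj [simp]: "dim_row (adj A) = dim_col A" "dim_col (adj A) = dim_row A"
  by (simp_all add: adj_def)

lemma index_adj [simp]: "i < dim_col A \<Longrightarrow> j < dim_row A \<Longrightarrow> adj A $$ (i, j) = cj (A $$ (j, i))"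
  by (simp add: adj_def)

lemma adj_adj [simp]: "adj (adj A) = A" by (rule eq_matI) auto

lemma adj_one [simp]: "adj (1\<^sub>m n) = 1\<^sub>m n" by (rule eq_matI) auto

lemma adj_mult:
  assumes A: "A \<in> carrier_mat n m" and B: "B \<in> carrier_mat m p"
  shows "adj (A * B) = adj B * adj A"
proof (rule eq_matI)
  fix i j assume ij: "i < dim_row (adj B * adj A)" "j < dim_col (adj B * adj A)"
  have "(adj B * adj A) $$ (i, j) = (\<Sum>l<m. adj B $$ (i, l) * adj A $$ (l, j))"
    by (rule index_mult_mat_sum[of _ p m _ n]) (use A B ij in auto)
  moreover have "(A * B) $$ (j, i) = (\<Sum>l<m. A $$ (j, l) * B $$ (l, i))"
    by (rule index_mult_mat_sum[of _ n m _ p]) (use A B ij in auto)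
  ultimately show "adj (A * B) $$ (i, j) = (adj B * adj A) $$ (i, j)"
    using A B ij by (simp add: mult.commute del: index_mult_mat(1))
qed (use A B in auto)

lemma adj_smult: "adj (c \<cdot>\<^sub>m A) = cj c \<cdot>\<^sub>m adj A" by (rule eq_matI) auto

lemma adj_add: "A \<in> carrier_mat n m \<Longrightarrow> B \<in> carrier_mat n m \<Longrightarrow> adj (A + B) = adj A + adj B"
  by (rule eq_matI) auto

lemma adj_uminus: "adj (- A) = - adj A" by (rule eq_matI) auto

lemma adj_four_block:
  assumes "A \<in> carrier_mat nr1 nc1" "B \<in> carrier_mat nr1 nc2"
    "C \<in> carrier_mat nr2 nc1" "D \<in> carrier_mat nr2 nc2"
  shows "adj (four_block_mat A B C D) = four_block_mat (adj A) (adj C) (adj B) (adj D)"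
  by (rule eq_matI) (use assms in auto)

abbreviation U :: "nat \<Rightarrow> 'a mat set" where "U n \<equiv> unitary_group q n"

lemma U_iff: "g \<in> U n \<longleftrightarrow> g \<in> carrier_mat n n \<and> adj g * g = 1\<^sub>m n"
  by (simp add: unitary_group_def adj_def cj_def[abs_def])

lemma U_carrier: "g \<in> U n \<Longrightarrow> g \<in> carrier_mat n n" by (simp add: U_iff)

lemma U_adj_mult: "g \<in> U n \<Longrightarrow> adj g * g = 1\<^sub>m n" by (simp add: U_iff)

lemma U_mult_adj: "g \<in> U n \<Longrightarrow> g * adj g = 1\<^sub>m n"
  using mat_mult_left_right_inverse[of "adj g" n g] by (simp add: U_iff)

lemma finite_U [simp]: "finite (U n)"
  by (rule finite_subset[of _ "carrier_mat n n"]) (auto dest: U_carrier)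

lemma one_in_U [simp]: "1\<^sub>m n \<in> U n" by (simp add: U_iff)

lemma U_adj: "g \<in> U n \<Longrightarrow> adj g \<in> U n" using U_mult_adj[of g n] by (simp add: U_iff)

lemma U_mult:
  assumes g: "g \<in> U n" and h: "h \<in> U n" shows "g * h \<in> U n"
proof -
  note c = U_carrier[OF g] U_carrier[OF h]
  have "adj (g * h) * (g * h) = adj h * adj g * (g * h)" using c by (simp add: adj_mult[of _ n n _ n])
  also have "\<dots> = adj h * (adj g * g) * h" using c by (intro mult_assoc_mat4) auto
  also have "\<dots> = 1\<^sub>m n" using g h c by (simp add: U_adj_mult right_mult_one_mat[of _ n n])
  finally show ?thesis using c by (simp add: U_iff)
qed

lemma U_cancel:
  assumes "g \<in> U n" "A \<in> carrier_mat n m"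
  shows "adj g * (g * A) = A" "g * (adj g * A) = A"
proof -
  have "adj g * (g * A) = adj g * g * A" "g * (adj g * A) = g * adj g * A"
    using assms by (auto dest: U_carrier intro!: assoc_mult_mat[symmetric])
  then show "adj g * (g * A) = A" "g * (adj g * A) = A"
    using assms by (auto simp: U_adj_mult U_mult_adj)
qed

lemma U_smult: "g \<in> U n \<Longrightarrow> c * cj c = 1 \<Longrightarrow> c \<cdot>\<^sub>m g \<in> U n"
proof -
  assume g: "g \<in> U n" and c: "c * cj c = 1"
  have "adj (c \<cdot>\<^sub>m g) * (c \<cdot>\<^sub>m g) = (cj c \<cdot>\<^sub>m adj g) * (c \<cdot>\<^sub>m g)" by (simp add: adj_smult)
  also have "\<dots> = (cj c * c) \<cdot>\<^sub>m (adj g * g)" using U_carrier[OF g]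
    by (simp add: mult_smult_assoc_mat[of _ n n _ n] mult_smult_distrib[of _ n n _ n])
      (rule eq_matI, auto)
  also have "\<dots> = 1\<^sub>m n" using g c by (simp add: U_adj_mult mult.commute) (rule eq_matI, auto)
  finally show ?thesis using U_carrier[OF g] by (simp add: U_iff)
qed

section \<open>Column vectors, the Hermitian product and its spheres\<close>

text \<open>Vectors are matrices with one column, so products, adjoints and associativity need no
  separate theory. The form is conjugate-linear in the first argument.\<close>

definition ip :: "'a mat \<Rightarrow> 'a mat \<Rightarrow> 'a" where "ip r s = (adj r * s) $$ (0, 0)"

lemma ip_sum:
  "r \<in> carrier_mat n 1 \<Longrightarrow> s \<in> carrier_mat n 1 \<Longrightarrow> ip r s = (\<Sum>i<n. cj (r $$ (i, 0)) * s $$ (i, 0))"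
  unfolding ip_def by (subst index_mult_mat_sum[of _ 1 n _ 1]) (auto intro!: sum.cong)

lemma adj_mult_col:
  assumes "r \<in> carrier_mat n 1" "s \<in> carrier_mat n 1"
  shows "adj r * s = ip r s \<cdot>\<^sub>m 1\<^sub>m 1"
  by (rule eq_matI) (use assms in \<open>auto simp: ip_def\<close>)

lemma cj_ip: "r \<in> carrier_mat n 1 \<Longrightarrow> s \<in> carrier_mat n 1 \<Longrightarrow> cj (ip r s) = ip s r"
  by (simp add: ip_sum mult.commute)

lemma ip_add_right:
  "r \<in> carrier_mat n 1 \<Longrightarrow> s \<in> carrier_mat n 1 \<Longrightarrow> t \<in> carrier_mat n 1 \<Longrightarrow> ip r (s + t) = ip r s + ip r t"
  by (simp add: ip_sum[of _ n] distrib_left sum.distrib)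

lemma ip_add_left:
  "r \<in> carrier_mat n 1 \<Longrightarrow> s \<in> carrier_mat n 1 \<Longrightarrow> t \<in> carrier_mat n 1 \<Longrightarrow> ip (s + t) r = ip s r + ip t r"
  by (simp add: ip_sum[of _ n] distrib_right sum.distrib)

lemma ip_smult_right:
  "r \<in> carrier_mat n 1 \<Longrightarrow> s \<in> carrier_mat n 1 \<Longrightarrow> ip r (c \<cdot>\<^sub>m s) = c * ip r s"
  by (simp add: ip_sum[of _ n] sum_distrib_left mult.left_commute)

lemma ip_smult_left:
  "r \<in> carrier_mat n 1 \<Longrightarrow> s \<in> carrier_mat n 1 \<Longrightarrow> ip (c \<cdot>\<^sub>m r) s = cj c * ip r s"
  by (simp add: ip_sum[of _ n] sum_distrib_left mult.assoc)

lemma ip_adj: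
  assumes "g \<in> carrier_mat n m" "r \<in> carrier_mat m 1" "s \<in> carrier_mat n 1"
  shows "ip (g * r) s = ip r (adj g * s)"
  using assms by (simp add: ip_def adj_mult[of _ n m _ 1] assoc_mult_mat[of _ 1 m _ n _ 1])

lemma ip_U:
  assumes "g \<in> U n" "r \<in> carrier_mat n 1" "s \<in> carrier_mat n 1"
  shows "ip (g * r) (g * s) = ip r s"
  using assms U_carrier[OF assms(1)] by (simp add: ip_adj[of _ n n] U_cancel)

definition vcons :: "'a \<Rightarrow> 'a mat \<Rightarrow> 'a mat" where
  "vcons a r = mat (Suc (dim_row r)) 1 (\<lambda>(i, _). if i = 0 then a else r $$ (i - 1, 0))"

definition vtl :: "'a mat \<Rightarrow> 'a mat" where
  "vtl v = mat (dim_row v - 1) 1 (\<lambda>(i, _). v $$ (Suc i, 0))"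

lemma vcons_carrier [simp]: "r \<in> carrier_mat n 1 \<Longrightarrow> vcons a r \<in> carrier_mat (Suc n) 1"
  by (auto simp: vcons_def)

lemma vtl_carrier [simp]: "v \<in> carrier_mat (Suc n) 1 \<Longrightarrow> vtl v \<in> carrier_mat n 1"
  by (auto simp: vtl_def)

lemmas [simp] = vcons_carrier[unfolded One_nat_def] vtl_carrier[unfolded One_nat_def]

lemma index_vcons [simp]: "vcons a r $$ (0, 0) = a"
  "i < dim_row r \<Longrightarrow> vcons a r $$ (Suc i, 0) = r $$ (i, 0)"
  by (auto simp: vcons_def)

lemma vtl_vcons [simp]: "r \<in> carrier_mat n 1 \<Longrightarrow> vtl (vcons a r) = r"
  by (rule eq_matI) (auto simp: vcons_def vtl_def)

lemma vcons_vtl [simp]: "v \<in> carrier_mat (Suc n) 1 \<Longrightarrow> vcons (v $$ (0, 0)) (vtl v) = v"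
  by (rule eq_matI) (auto simp: vcons_def vtl_def)

lemma ip_vcons [simp]:
  "r \<in> carrier_mat n 1 \<Longrightarrow> s \<in> carrier_mat n 1 \<Longrightarrow> ip (vcons a r) (vcons b s) = cj a * b + ip r s"
  by (simp add: ip_sum[of _ "Suc n"] ip_sum[of _ n] sum.lessThan_Suc_shift del: sum.lessThan_Suc)

lemma vcons_eq_iff:
  "r \<in> carrier_mat n 1 \<Longrightarrow> s \<in> carrier_mat n 1 \<Longrightarrow> vcons a r = vcons b s \<longleftrightarrow> a = b \<and> r = s"
  by (metis index_vcons(1) vtl_vcons)

text \<open>The dimension is \<open>n + 1\<close>; the argument counts the entries below the
  first.\<close>

definition e0 :: "nat \<Rightarrow> 'a mat" where "e0 n = vcons 1 (0\<^sub>m n 1)"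

lemma e0_carrier [simp]: "e0 n \<in> carrier_mat (Suc n) 1" by (simp add: e0_def)

lemmas [simp] = e0_carrier[unfolded One_nat_def]

lemma index_mult_e0:
  assumes "A \<in> carrier_mat m (Suc n)" "i < m"
  shows "(A * e0 n) $$ (i, 0) = A $$ (i, 0)"
  by (subst index_mult_mat_sum[of _ m "Suc n" _ 1])
    (use assms in \<open>auto simp: e0_def sum.lessThan_Suc_shift simp del: sum.lessThan_Suc\<close>)

lemma ip_e0: "v \<in> carrier_mat (Suc n) 1 \<Longrightarrow> ip (e0 n) v = v $$ (0, 0)"
  by (simp add: ip_sum[of _ "Suc n"] e0_def sum.lessThan_Suc_shift del: sum.lessThan_Suc)

definition sphere :: "nat \<Rightarrow> 'a \<Rightarrow> 'a mat set" where
  "sphere n k = {r \<in> carrier_mat n 1. ip r r = k}"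

lemma finite_sphere [simp]: "finite (sphere n k)"
  by (rule finite_subset[of _ "carrier_mat n 1"]) (auto simp: sphere_def)

lemma sphere_Suc: "bij_betw (\<lambda>(a, r). vcons a r) (SIGMA a:UNIV. sphere n (k - a * cj a)) (sphere (Suc n) k)"
proof (rule bij_betw_byWitness[where f' = "\<lambda>v. (v $$ (0, 0), vtl v)"])
  show "(\<lambda>v. (v $$ (0, 0), vtl v)) ` sphere (Suc n) k \<subseteq> (SIGMA a:UNIV. sphere n (k - a * cj a))"
  proof safe
    fix v assume "v \<in> sphere (Suc n) k"
    then have v: "v \<in> carrier_mat (Suc n) 1" "ip v v = k" by (auto simp: sphere_def)
    then have "ip (vcons (v $$ (0, 0)) (vtl v)) (vcons (v $$ (0, 0)) (vtl v)) = k"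
      by (simp only: vcons_vtl)
    then show "vtl v \<in> sphere n (k - v $$ (0, 0) * cj (v $$ (0, 0)))"
      using v by (subst (asm) ip_vcons[of _ n]) (auto simp: sphere_def algebra_simps)
  qed auto
  show "\<forall>v\<in>sphere (Suc n) k. (\<lambda>(a, r). vcons a r) (v $$ (0, 0), vtl v) = v"
    by (auto simp: sphere_def intro: vcons_vtl[unfolded One_nat_def])
qed (auto simp: sphere_def mult.commute vtl_vcons[unfolded One_nat_def] ip_vcons[of _ n, unfolded One_nat_def])

text \<open>Induction by splitting off the first entry \<open>a\<close>. The dimension below depends
  on \<open>a\<close> only through whether \<open>a * cj a = k\<close>, which holds for 1 or q + 1
  values; this produces the next factor -q. The extra factor q avoids division.\<close>

lemma card_sphere:
  assumes "cj k = k"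
  shows "(of_nat q * of_nat (card (sphere n k)) :: complex) =
    of_nat q ^ (2 * n) + (- of_nat q) ^ n * ((if k = 0 then of_nat q else 0) - 1)"
  using assms
proof (induction n arbitrary: k)
  case 0
  have "sphere 0 k = (if k = 0 then {0\<^sub>m 0 1} else {})"
    by (auto simp: sphere_def ip_sum[of _ 0])
  then show ?case by simp
next
  case (Suc n)
  have "card (sphere (Suc n) k) = (\<Sum>a\<in>UNIV. card (sphere n (k - a * cj a)))"
    by (simp add: bij_betw_same_card[OF sphere_Suc, symmetric])
  then have "(of_nat q * of_nat (card (sphere (Suc n) k)) :: complex) =
      (\<Sum>a\<in>UNIV. of_nat q * of_nat (card (sphere n (k - a * cj a))))"
    by (simp add: sum_distrib_left)
  also have "\<dots> = (\<Sum>a\<in>UNIV. (of_nat q ^ (2 * n) - (- of_nat q) ^ n) +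
      (if a * cj a = k then (- of_nat q) ^ n * of_nat q else 0))"
  proof (rule sum.cong[OF refl])
    fix a :: 'a
    have "cj (k - a * cj a) = k - a * cj a" using Suc.prems by simp
    then show "(of_nat q * of_nat (card (sphere n (k - a * cj a))) :: complex) =
        (of_nat q ^ (2 * n) - (- of_nat q) ^ n) +
      (if a * cj a = k then (- of_nat q) ^ n * of_nat q else 0)"
      by (subst Suc.IH) (auto simp: algebra_simps)
  qed
  also have "\<dots> = of_nat q ^ 2 * (of_nat q ^ (2 * n) - (- of_nat q) ^ n) +
      (\<Sum>a\<in>{a. a * cj a = k}. (- of_nat q) ^ n * of_nat q)"
    by (simp add: sum.distrib card_field sum.If_cases)
  also have "\<dots> = of_nat q ^ (2 * Suc n) + (- of_nat q) ^ Suc n * ((if k = 0 then of_nat q else 0) - 1)"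
    using card_norm_fiber[OF Suc.prems] by (simp add: algebra_simps power2_eq_square)
  finally show ?case .
qed

subsection \<open>Unitary matrices with prescribed first column\<close>

definition emb :: "'a mat \<Rightarrow> 'a mat" where
  "emb g = four_block_mat (1\<^sub>m 1) (0\<^sub>m 1 (dim_col g)) (0\<^sub>m (dim_row g) 1) g"

lemma emb_carrier [simp]: "g \<in> carrier_mat n m \<Longrightarrow> emb g \<in> carrier_mat (Suc n) (Suc m)"
  using four_block_carrier_mat[of "1\<^sub>m 1" 1 1 g n m] by (simp add: emb_def)

lemma dim_emb [simp]: "dim_row (emb g) = Suc (dim_row g)" "dim_col (emb g) = Suc (dim_col g)"
  by (simp_all add: emb_def)

lemma dim_vcons [simp]: "dim_row (vcons a r) = Suc (dim_row r)" "dim_col (vcons a r) = 1"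
  by (simp_all add: vcons_def)

lemma dim_e0 [simp]: "dim_row (e0 n) = Suc n" "dim_col (e0 n) = 1"
  by (simp_all add: e0_def)

lemma index_emb:
  assumes "g \<in> carrier_mat n m" "i < Suc n" "j < Suc m"
  shows "emb g $$ (i, j) = (if i = 0 then if j = 0 then 1 else 0 else if j = 0 then 0 else g $$ (i - 1, j - 1))"
  using assms by (auto simp: emb_def)

lemma emb_one [simp]: "emb (1\<^sub>m n) = 1\<^sub>m (Suc n)"
  by (rule eq_matI) (auto simp: index_emb[of _ n n])

lemma emb_mult:
  assumes A: "A \<in> carrier_mat n n" and B: "B \<in> carrier_mat n n"
  shows "emb A * emb B = emb (A * B)"
  using A B unfolding emb_def
  by (subst mult_four_block_mat[of _ 1 1 _ n _ n]) (auto intro!: cong_four_block_mat)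

lemma adj_emb: "adj (emb A) = emb (adj A)"
  by (rule eq_matI) (auto simp: emb_def)

lemma emb_eq_iff:
  assumes A: "A \<in> carrier_mat n m" and B: "B \<in> carrier_mat n m"
  shows "emb A = emb B \<longleftrightarrow> A = B"
proof
  assume eq: "emb A = emb B"
  show "A = B"
  proof (rule eq_matI)
    fix i j assume "i < dim_row B" "j < dim_col B"
    then show "A $$ (i, j) = B $$ (i, j)"
      using A B arg_cong[OF eq, of "\<lambda>X. X $$ (Suc i, Suc j)"] by (simp add: index_emb[of _ n m])
  qed (use A B in auto)
qed simp

lemma emb_in_U_iff: "g \<in> carrier_mat n n \<Longrightarrow> emb g \<in> U (Suc n) \<longleftrightarrow> g \<in> U n"
  using emb_eq_iff[of "adj g * g" n n "1\<^sub>m n"]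
  by (auto simp: U_iff adj_emb emb_mult[of _ n])

lemma det_emb: "g \<in> carrier_mat n n \<Longrightarrow> det (emb g) = det g"
  unfolding emb_def by (subst det_four_block_mat_upper_right_zero[of _ 1 _ n]) auto

lemma emb_mult_vcons:
  assumes g: "g \<in> carrier_mat n n" and r: "r \<in> carrier_mat n 1"
  shows "emb g * vcons a r = vcons a (g * r)"
proof (rule eq_matI)
  fix i j assume "i < dim_row (vcons a (g * r))" "j < dim_col (vcons a (g * r))"
  then have i: "i < Suc n" and j: "j = 0" using g by (auto simp: vcons_def)
  have "(emb g * vcons a r) $$ (i, 0) = (\<Sum>l<Suc n. emb g $$ (i, l) * vcons a r $$ (l, 0))"
    by (rule index_mult_mat_sum) (use assms i in \<open>auto intro!: vcons_carrier[unfolded One_nat_def]\<close>)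
  also have "\<dots> = vcons a (g * r) $$ (i, 0)"
    using i g r by (cases i) (auto simp: index_emb[of _ n n] sum.lessThan_Suc_shift
        index_mult_mat_sum[of _ n n _ 1] simp del: sum.lessThan_Suc index_mult_mat(1))
  finally show "(emb g * vcons a r) $$ (i, j) = vcons a (g * r) $$ (i, j)" using j by simp
qed (use assms in \<open>auto simp: vcons_def emb_def\<close>)

text \<open>With \<open>e0 n\<close> as first column, the top row of \<open>adj k * k\<close> is the
  top row of \<open>k\<close>, so unitarity forces the first row as well.\<close>

lemma U_fixing_e0:
  assumes k: "k \<in> U (Suc n)" and fixed: "k * e0 n = e0 n"
  obtains g where "g \<in> U n" "k = emb g"
proof -
  note c = U_carrier[OF k]
  define g where "g = mat n n (\<lambda>(i, j). k $$ (Suc i, Suc j))"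
  have g: "g \<in> carrier_mat n n" by (simp add: g_def)
  have col: "k $$ (i, 0) = (if i = 0 then 1 else 0)" if "i < Suc n" for i
    using index_mult_e0[OF c that] fixed that by (cases i) (auto simp: e0_def)
  have row: "k $$ (0, j) = (if j = 0 then 1 else 0)" if j: "j < Suc n" for j
  proof -
    have "(adj k * k) $$ (0, j) = (\<Sum>l<Suc n. adj k $$ (0, l) * k $$ (l, j))"
      by (rule index_mult_mat_sum) (use c j in auto)
    also have "\<dots> = k $$ (0, j)"
      using c col by (simp add: sum.lessThan_Suc_shift del: sum.lessThan_Suc)
    finally show ?thesis using j by (simp add: U_adj_mult[OF k])
  qed
  have "k = emb g"
  proof (rule eq_matI)
    fix i j assume "i < dim_row (emb g)" "j < dim_col (emb g)"
    then have "i < Suc n" "j < Suc n" using emb_carrier[OF g] by auto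
    then show "k $$ (i, j) = emb g $$ (i, j)"
      using g col row by (cases i; cases j) (auto simp: index_emb[of _ n n] g_def)
  qed (use c emb_carrier[OF g] in auto)
  then show ?thesis using that[of g] k emb_in_U_iff[OF g] by simp
qed

text \<open>The matrices with the same first column as \<open>h\<close> form the coset of
  \<open>h\<close> modulo the stabilizer of \<open>e0 n\<close>, and this stabilizer is the embedded
  smaller group.\<close>

lemma bij_betw_column_fiber:
  assumes h: "h \<in> U (Suc n)"
  shows "bij_betw (\<lambda>g. h * emb g) (U n) {g \<in> U (Suc n). g * e0 n = h * e0 n}"
  unfolding bij_betw_def
proof
  note hc = U_carrier[OF h]
  have can: "adj h * (h * emb g) = emb g" if "g \<in> U n" for g
    by (rule U_cancel(1)[OF h emb_carrier[OF U_carrier[OF that]]])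
  show "inj_on (\<lambda>g. h * emb g) (U n)"
    by (rule inj_onI) (metis can emb_eq_iff U_carrier)
  show "(\<lambda>g. h * emb g) ` U n = {g \<in> U (Suc n). g * e0 n = h * e0 n}"
  proof (intro equalityI subsetI)
    fix x assume "x \<in> (\<lambda>g. h * emb g) ` U n"
    then obtain g where g: "g \<in> U n" and x: "x = h * emb g" by blast
    note gc = U_carrier[OF g]
    have "emb g * e0 n = e0 n" using gc by (simp add: e0_def emb_mult_vcons)
    then have "x * e0 n = h * e0 n" using hc gc x
      by (simp add: assoc_mult_mat[of _ "Suc n" "Suc n" _ "Suc n" _ 1])
    moreover have "x \<in> U (Suc n)" unfolding x by (rule U_mult[OF h]) (simp add: emb_in_U_iff gc g)
    ultimately show "x \<in> {g \<in> U (Suc n). g * e0 n = h * e0 n}" by simp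
  next
    fix x assume "x \<in> {g \<in> U (Suc n). g * e0 n = h * e0 n}"
    then have x: "x \<in> U (Suc n)" "x * e0 n = h * e0 n" by auto
    note xc = U_carrier[OF x(1)]
    have "adj h * x * e0 n = adj h * (x * e0 n)" using hc xc
      by (simp add: assoc_mult_mat[of _ "Suc n" "Suc n" _ "Suc n" _ 1])
    also have "\<dots> = e0 n" unfolding x(2) by (rule U_cancel[OF h e0_carrier])
    finally obtain g where g: "g \<in> U n" "adj h * x = emb g"
      using U_fixing_e0 U_mult[OF U_adj[OF h] x(1)] by metis
    then have "x = h * emb g" using U_cancel(2)[OF h xc] by simp
    then show "x \<in> (\<lambda>g. h * emb g) ` U n" using g by blast
  qed
qed

text \<open>A unitary matrix with first column \<open>(a, r)\<close>, provided \<open>z\<close> satisfies the two equations of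
  \<open>rot_unitary\<close>; these are solvable unless \<open>r\<close> is isotropic and \<open>a \<noteq> 1\<close>.\<close>

definition rot :: "'a \<Rightarrow> 'a mat \<Rightarrow> 'a \<Rightarrow> 'a mat" where
  "rot a r z = four_block_mat (a \<cdot>\<^sub>m 1\<^sub>m 1) (- adj r) r (1\<^sub>m (dim_row r) + z \<cdot>\<^sub>m (r * adj r))"

lemma rank_one_mult:
  assumes r: "r \<in> carrier_mat n 1"
  shows "(r * adj r) * r = ip r r \<cdot>\<^sub>m r" "adj r * (r * adj r) = ip r r \<cdot>\<^sub>m adj r"
    "(r * adj r) * (r * adj r) = ip r r \<cdot>\<^sub>m (r * adj r)"
proof -
  have a: "adj r \<in> carrier_mat 1 n" using r by simp
  show 1: "(r * adj r) * r = ip r r \<cdot>\<^sub>m r"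
    using assoc_mult_mat[OF r a r] adj_mult_col[OF r r] r
    by (simp add: mult_smult_distrib[OF r, of _ 1])
  show "adj r * (r * adj r) = ip r r \<cdot>\<^sub>m adj r"
    using assoc_mult_mat[OF a r a] adj_mult_col[OF r r] a
    by (simp add: mult_smult_assoc_mat[of _ 1 1 _ n])
  show "(r * adj r) * (r * adj r) = ip r r \<cdot>\<^sub>m (r * adj r)"
    using assoc_mult_mat[of "r * adj r" n n r 1 "adj r" n] 1 r
    by (simp add: mult_smult_assoc_mat[of _ n 1 _ n])
qed

lemma rot_carrier: "r \<in> carrier_mat n 1 \<Longrightarrow> rot a r z \<in> carrier_mat (Suc n) (Suc n)"
  using four_block_carrier_mat[of "a \<cdot>\<^sub>m 1\<^sub>m 1" 1 1 "1\<^sub>m (dim_row r) + z \<cdot>\<^sub>m (r * adj r)" n n "- adj r" r]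
  by (simp add: rot_def)

lemma rot_e0:
  assumes r: "r \<in> carrier_mat n 1"
  shows "rot a r z * e0 n = vcons a r"
proof (rule eq_matI)
  fix i j assume ij: "i < dim_row (vcons a r)" "j < dim_col (vcons a r)"
  then have i: "i < Suc n" and j: "j = 0" using r by (auto simp: vcons_def)
  have "(rot a r z * e0 n) $$ (i, 0) = rot a r z $$ (i, 0)"
    by (rule index_mult_e0[OF rot_carrier[OF r] i])
  also have "\<dots> = vcons a r $$ (i, 0)"
    using r i by (cases i) (auto simp: rot_def)
  finally show "(rot a r z * e0 n) $$ (i, j) = vcons a r $$ (i, j)" using j by simp
qed (use r rot_carrier[OF r, of a z] in auto)

text \<open>In the block product with the adjoint, \<open>norm\<close> gives the corner,
  \<open>z1\<close> cancels both off-diagonal blocks, and \<open>z2\<close> annihilates the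
  coefficient of \<open>r * adj r\<close> in the lower right block.\<close>

lemma rot_unitary:
  assumes r: "r \<in> carrier_mat n 1" and norm: "a * cj a + ip r r = 1"
    and z1: "1 + z * ip r r = cj a" and z2: "z + cj z + z * cj z * ip r r = - 1"
  shows "rot a r z \<in> U (Suc n)"
proof -
  let ?P = "r * adj r"
  have P: "?P \<in> carrier_mat n n" and ac: "adj r \<in> carrier_mat 1 n" using r by auto
  have rp: "cj (ip r r) = ip r r" by (rule cj_ip[OF r r])
  have adjP: "adj ?P = ?P" using adj_mult[OF r ac] by simp
  have rot: "rot a r z = four_block_mat (a \<cdot>\<^sub>m 1\<^sub>m 1) (- adj r) r (1\<^sub>m n + z \<cdot>\<^sub>m ?P)"
    using r by (simp add: rot_def)
  have "adj (1\<^sub>m n + z \<cdot>\<^sub>m ?P) = 1\<^sub>m n + cj z \<cdot>\<^sub>m ?P"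
    using P adjP by (simp add: adj_add[of _ n n] adj_smult)
  then have adj: "adj (rot a r z) = four_block_mat (cj a \<cdot>\<^sub>m 1\<^sub>m 1) (adj r) (- r) (1\<^sub>m n + cj z \<cdot>\<^sub>m ?P)"
    unfolding rot_def using r P by (subst adj_four_block[of _ 1 1 _ n _ n]) (auto simp: adj_smult adj_uminus)
  have 11: "(cj a \<cdot>\<^sub>m 1\<^sub>m 1) * (a \<cdot>\<^sub>m 1\<^sub>m 1) + adj r * r = 1\<^sub>m 1"
    unfolding adj_mult_col[OF r r] using norm by (intro eq_matI) (auto simp: mult.commute)
  have 12: "(cj a \<cdot>\<^sub>m 1\<^sub>m 1) * (- adj r) + adj r * (1\<^sub>m n + z \<cdot>\<^sub>m ?P) = 0\<^sub>m 1 n"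
  proof -
    have "adj r * (1\<^sub>m n + z \<cdot>\<^sub>m ?P) = adj r + z \<cdot>\<^sub>m (ip r r \<cdot>\<^sub>m adj r)"
      using mult_add_distrib_mat[OF ac, of "1\<^sub>m n" n "z \<cdot>\<^sub>m ?P"] P ac
      by (simp add: mult_smult_distrib[OF ac P] rank_one_mult[OF r])
    moreover have "(cj a \<cdot>\<^sub>m 1\<^sub>m 1) * (- adj r) = - cj a \<cdot>\<^sub>m adj r"
      using ac by (simp add: mult_smult_assoc_mat[of _ 1 1 _ n]) (rule eq_matI, auto)
    ultimately show ?thesis
      unfolding z1[symmetric] using r by (intro eq_matI) (auto simp: algebra_simps)
  qed
  have 21: "(- r) * (a \<cdot>\<^sub>m 1\<^sub>m 1) + (1\<^sub>m n + cj z \<cdot>\<^sub>m ?P) * r = 0\<^sub>m n 1"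
  proof -
    have "(1\<^sub>m n + cj z \<cdot>\<^sub>m ?P) * r = r + cj z \<cdot>\<^sub>m (ip r r \<cdot>\<^sub>m r)"
      using add_mult_distrib_mat[of "1\<^sub>m n" n n "cj z \<cdot>\<^sub>m ?P" r 1] P r
      by (simp add: mult_smult_assoc_mat[OF P r] rank_one_mult[OF r])
    moreover have "(- r) * (a \<cdot>\<^sub>m 1\<^sub>m 1) = - a \<cdot>\<^sub>m r"
      using r by (simp add: mult_smult_distrib[of _ n 1 _ 1]) (rule eq_matI, auto)
    moreover have "a = 1 + cj z * ip r r" using arg_cong[OF z1, of cj] rp by simp
    ultimately show ?thesis
      using r by (intro eq_matI) (auto simp: algebra_simps)
  qed
  have 22: "(- r) * (- adj r) + (1\<^sub>m n + cj z \<cdot>\<^sub>m ?P) * (1\<^sub>m n + z \<cdot>\<^sub>m ?P) = 1\<^sub>m n"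
  proof -
    have "(- r) * (- adj r) = ?P" using r by simp
    moreover have "(1\<^sub>m n + cj z \<cdot>\<^sub>m ?P) * (1\<^sub>m n + z \<cdot>\<^sub>m ?P) =
        (1\<^sub>m n + z \<cdot>\<^sub>m ?P) + (cj z \<cdot>\<^sub>m ?P + cj z \<cdot>\<^sub>m (z \<cdot>\<^sub>m (ip r r \<cdot>\<^sub>m ?P)))"
      using P
      by (simp add: add_mult_distrib_mat[of _ n n _ _ n] mult_add_distrib_mat[of _ n n _ n]
          mult_smult_assoc_mat[of _ n n _ n] mult_smult_distrib[of _ n n _ n] rank_one_mult[OF r]
          left_mult_one_mat[OF P] right_mult_one_mat[OF P])
        (rule eq_matI, auto simp: algebra_simps simp del: index_mult_mat(1))
    moreover have "?P + ((1\<^sub>m n + z \<cdot>\<^sub>m ?P) + (cj z \<cdot>\<^sub>m ?P + cj z \<cdot>\<^sub>m (z \<cdot>\<^sub>m (ip r r \<cdot>\<^sub>m ?P)))) = 1\<^sub>m n"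
    proof (rule eq_matI)
      fix i j assume "i < dim_row (1\<^sub>m n :: 'a mat)" "j < dim_col (1\<^sub>m n :: 'a mat)"
      then have ij: "i < n" "j < n" by auto
      let ?x = "?P $$ (i, j)"
      have "(?P + ((1\<^sub>m n + z \<cdot>\<^sub>m ?P) + (cj z \<cdot>\<^sub>m ?P + cj z \<cdot>\<^sub>m (z \<cdot>\<^sub>m (ip r r \<cdot>\<^sub>m ?P))))) $$ (i, j) =
          ?x + (1\<^sub>m n $$ (i, j) + z * ?x + (cj z * ?x + cj z * (z * (ip r r * ?x))))"
        using ij r by (simp del: index_mult_mat(1) index_one_mat(1))
      also have "\<dots> = 1\<^sub>m n $$ (i, j) + (1 + (z + cj z + z * cj z * ip r r)) * ?x"
        by (simp add: algebra_simps del: index_mult_mat(1) index_one_mat(1))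
      also have "\<dots> = 1\<^sub>m n $$ (i, j)" unfolding z2 by simp
      finally show "(?P + ((1\<^sub>m n + z \<cdot>\<^sub>m ?P) + (cj z \<cdot>\<^sub>m ?P + cj z \<cdot>\<^sub>m (z \<cdot>\<^sub>m (ip r r \<cdot>\<^sub>m ?P))))) $$ (i, j) =
        (1\<^sub>m n :: 'a mat) $$ (i, j)" .
    qed (use P in auto)
    ultimately show ?thesis by simp
  qed
  have "adj (rot a r z) * rot a r z = four_block_mat (1\<^sub>m 1) (0\<^sub>m 1 n) (0\<^sub>m n 1) (1\<^sub>m n)"
    unfolding adj unfolding rot using r
    by (intro trans[OF mult_four_block_mat[of _ 1 1 _ n _ n _ _ 1 _ n]])
      (simp_all only: 11 12 21 22, auto)
  then show ?thesis using rot_carrier[OF r] by (simp add: U_iff)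
qed

text \<open>The matrix is a product \<open>?L * (?M * ?R)\<close> of unipotent block triangular
  matrices. The coefficient \<open>1 + z * a\<close> in \<open>?R\<close> is the one for which the
  lower left block becomes \<open>r\<close>; the corner is then \<open>a\<close> by
  \<open>norm\<close> and \<open>z1\<close>.\<close>

lemma det_rot:
  assumes r: "r \<in> carrier_mat n 1" and norm: "a * cj a + ip r r = 1"
    and z1: "1 + z * ip r r = cj a"
  shows "det (rot a r z) = 1"
proof -
  let ?L = "four_block_mat (1\<^sub>m 1) (0\<^sub>m 1 n) ((- z) \<cdot>\<^sub>m r) (1\<^sub>m n)"
  let ?M = "four_block_mat (1\<^sub>m 1) (- adj r) (0\<^sub>m n 1) (1\<^sub>m n)"
  let ?R = "four_block_mat (1\<^sub>m 1) (0\<^sub>m 1 n) ((1 + z * a) \<cdot>\<^sub>m r) (1\<^sub>m n)"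
  have ac: "adj r \<in> carrier_mat 1 n" using r by simp
  have P: "r * adj r \<in> carrier_mat n n" using r by simp
  have a: "1 - (1 + z * a) * ip r r = a"
  proof -
    have "1 - (1 + z * a) * ip r r = (1 - ip r r) - a * (z * ip r r)" by (simp add: algebra_simps)
    also have "1 - ip r r = a * cj a" using norm by (simp add: algebra_simps)
    also have "z * ip r r = cj a - 1" using z1 by (simp add: algebra_simps)
    finally show ?thesis by (simp add: algebra_simps)
  qed
  have 1: "1\<^sub>m 1 + - (adj r * ((1 + z * a) \<cdot>\<^sub>m r)) = a \<cdot>\<^sub>m 1\<^sub>m 1"
  proof -
    have "adj r * ((1 + z * a) \<cdot>\<^sub>m r) = ((1 + z * a) * ip r r) \<cdot>\<^sub>m 1\<^sub>m 1"
      unfolding mult_smult_distrib[OF ac r] adj_mult_col[OF r r] by (rule eq_matI) auto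
    then show ?thesis using a by (simp, intro eq_matI) simp_all
  qed
  have MR: "?M * ?R = four_block_mat (a \<cdot>\<^sub>m 1\<^sub>m 1) (- adj r) ((1 + z * a) \<cdot>\<^sub>m r) (1\<^sub>m n)"
    using r by (subst mult_four_block_mat[of _ 1 1 _ n _ n])
      (auto simp: 1 simp del: One_nat_def intro!: cong_four_block_mat)
  have 2: "((- z) \<cdot>\<^sub>m r) * (a \<cdot>\<^sub>m 1\<^sub>m 1) + 1\<^sub>m n * ((1 + z * a) \<cdot>\<^sub>m r) = r"
  proof -
    have "((- z) \<cdot>\<^sub>m r) * (a \<cdot>\<^sub>m 1\<^sub>m 1) = (- (z * a)) \<cdot>\<^sub>m r"
      using r by (simp add: mult_smult_distrib[of _ n 1 _ 1] mult_smult_assoc_mat[of _ n 1 _ 1])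
        (rule eq_matI, auto)
    then show ?thesis using r by (intro eq_matI) (auto simp: algebra_simps)
  qed
  have 3: "((- z) \<cdot>\<^sub>m r) * (- adj r) + 1\<^sub>m n * 1\<^sub>m n = 1\<^sub>m n + z \<cdot>\<^sub>m (r * adj r)"
  proof -
    have "((- z) \<cdot>\<^sub>m r) * (- adj r) = z \<cdot>\<^sub>m (r * adj r)"
      using r mult_smult_assoc_mat[OF r ac, of "- z"]
      by (subst uminus_mult_right_mat) (auto intro!: eq_matI simp del: index_mult_mat(1))
    then show ?thesis using P by (simp add: comm_add_mat[of _ n n])
  qed
  have 4: "1\<^sub>m 1 * (a \<cdot>\<^sub>m 1\<^sub>m 1) + 0\<^sub>m 1 n * ((1 + z * a) \<cdot>\<^sub>m r) = a \<cdot>\<^sub>m 1\<^sub>m 1"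
    "1\<^sub>m 1 * (- adj r) + 0\<^sub>m 1 n * 1\<^sub>m n = - adj r"
    using r by auto
  have "?L * (?M * ?R) = four_block_mat (a \<cdot>\<^sub>m 1\<^sub>m 1) (- adj r) r (1\<^sub>m n + z \<cdot>\<^sub>m (r * adj r))"
    unfolding MR using r
    by (intro trans[OF mult_four_block_mat[of _ 1 1 _ n _ n _ _ 1 _ n]])
      (simp_all only: 2 3 4, auto)
  then have "rot a r z = ?L * (?M * ?R)" using r by (simp add: rot_def)
  moreover have "det (?L * (?M * ?R)) = det ?L * (det ?M * det ?R)"
  proof -
    have "?L \<in> carrier_mat (1 + n) (1 + n)" "?M \<in> carrier_mat (1 + n) (1 + n)" "?R \<in> carrier_mat (1 + n) (1 + n)"
      by (rule four_block_carrier_mat; simp)+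
    then show ?thesis by (metis det_mult mult_carrier_mat)
  qed
  moreover have "det ?L = 1" "det ?R = 1"
    using r by (subst det_four_block_mat_upper_right_zero[of _ 1 _ n]; simp)+
  moreover have "det ?M = 1"
    using r by (subst det_four_block_mat_lower_left_zero[of _ 1 _ n]) auto
  ultimately show ?thesis by simp
qed

subsection \<open>Splitting the sums by the first column\<close>

definition weight :: "'a mat \<Rightarrow> complex" where "weight g = \<chi> (det g) * \<psi> (mat_trace g)"

definition usum :: "nat \<Rightarrow> complex" where "usum n = (\<Sum>g\<in>U n. weight g)"

lemma weight_conj:
  assumes P: "P \<in> carrier_mat n n" and Q: "Q \<in> carrier_mat n n" and g: "g \<in> carrier_mat n n"
    and QP: "Q * P = 1\<^sub>m n"
  shows "weight (Q * g * P) = weight g"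
proof -
  have PQ: "P * Q = 1\<^sub>m n" by (rule mat_mult_left_right_inverse[OF Q P QP])
  have "det (Q * g * P) = det Q * det g * det P"
    using P Q g by (simp add: det_mult[of _ n])
  also have "\<dots> = det g * det (Q * P)" using P Q by (simp add: det_mult[of _ n] mult_ac)
  finally have d: "det (Q * g * P) = det g" by (simp add: QP)
  have "mat_trace (Q * g * P) = mat_trace (P * (Q * g))"
    by (rule mat_trace_mult_comm[of _ n n]) (use P Q g in auto)
  also have "P * (Q * g) = g" using P Q g by (simp add: assoc_mult_mat[symmetric, of _ n n _ n _ n] PQ)
  finally show ?thesis using d by (simp add: weight_def)
qed

text \<open>The first equation dictates \<open>z\<close>. After multiplication by \<open>k\<close>
  the second becomes \<open>a * cj a - 1 = - k\<close>, the norm condition.\<close>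

lemma rot_exists_param:
  assumes "a * cj a + k = 1" "k \<noteq> 0" "cj k = k"
  defines "z \<equiv> (cj a - 1) / k"
  shows "1 + z * k = cj a" "z + cj z + z * cj z * k = -1"
proof -
  show "1 + z * k = cj a" using assms by (simp add: z_def)
  have zk: "z * k = cj a - 1" using \<open>k \<noteq> 0\<close> by (simp add: z_def)
  have "cj z * k = cj (z * k)" using \<open>cj k = k\<close> by simp
  then have czk: "cj z * k = a - 1" by (simp add: zk)
  have "(z + cj z + z * cj z * k) * k = z * k + cj z * k + z * k * (cj z * k)"
    by (simp add: algebra_simps)
  also have "\<dots> = (cj a - 1) + (a - 1) + (cj a - 1) * (a - 1)" by (simp only: zk czk)
  also have "\<dots> = - 1 * k" using assms(1) by (simp add: algebra_simps)
  finally show "z + cj z + z * cj z * k = -1" using \<open>k \<noteq> 0\<close> by (simp only: mult_cancel_right) simp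
qed

text \<open>If the lower part is isotropic, \<open>a\<close> has norm 1, and dividing the column by
  \<open>a\<close> gives corner entry 1, where any \<open>z\<close> of trace -1 serves. Multiplying
  the resulting unitary matrix by \<open>a\<close> restores the column; its determinant does not
  matter here.\<close>

lemma U_first_column:
  assumes v: "v \<in> sphere (Suc n) 1"
  obtains h where "h \<in> U (Suc n)" "h * e0 n = v"
proof -
  define a where "a = v $$ (0, 0)"
  define r where "r = vtl v"
  have vc: "v \<in> carrier_mat (Suc n) 1" using v by (simp add: sphere_def)
  have r: "r \<in> carrier_mat n 1" unfolding r_def by (rule vtl_carrier[OF vc])
  have va: "v = vcons a r" unfolding a_def r_def by (rule vcons_vtl[OF vc, symmetric])
  have norm: "a * cj a + ip r r = 1"
    using v unfolding sphere_def va by (simp add: ip_vcons[OF r r] mult.commute)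
  show ?thesis
  proof (cases "ip r r = 0")
    case False
    note z = rot_exists_param[OF norm False cj_ip[OF r r]]
    show ?thesis by (rule that[OF rot_unitary[OF r norm z] rot_e0[OF r, where a = a, folded va]])
  next
    case True
    then have a: "a * cj a = 1" using norm by simp
    obtain z where z: "z + cj z = -1" using ex_trace[of "-1"] by auto
    let ?r = "(1 / a) \<cdot>\<^sub>m r"
    have r': "?r \<in> carrier_mat n 1" using r by simp
    have 0: "ip ?r ?r = 0" using True r by (simp add: ip_smult_left[of _ n] ip_smult_right[of _ n])
    have "rot 1 ?r z \<in> U (Suc n)" by (rule rot_unitary[OF r']) (simp_all add: 0 z)
    then have "a \<cdot>\<^sub>m rot 1 ?r z \<in> U (Suc n)" using a by (rule U_smult)
    moreover have "a \<cdot>\<^sub>m rot 1 ?r z * e0 n = a \<cdot>\<^sub>m (rot 1 ?r z * e0 n)"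
      by (rule mult_smult_assoc_mat[OF rot_carrier[OF r'] e0_carrier])
    moreover have "\<dots> = v" unfolding rot_e0[OF r'] va
      using a r by (intro eq_matI) (auto simp: vcons_def)
    ultimately show ?thesis using that by metis
  qed
qed

lemma mult_e0_in_sphere: "g \<in> U (Suc n) \<Longrightarrow> g * e0 n \<in> sphere (Suc n) 1"
  using U_carrier[of g "Suc n"] by (auto simp: sphere_def ip_U ip_e0) (simp add: e0_def)

lemma sum_U_Suc:
  "(\<Sum>g\<in>U (Suc n). F g) = (\<Sum>v\<in>sphere (Suc n) 1. \<Sum>g\<in>{g\<in>U (Suc n). g * e0 n = v}. F g)"
  for F :: "'a mat \<Rightarrow> 'b::comm_monoid_add"
  by (rule sum.group[symmetric]) (auto intro: mult_e0_in_sphere)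

lemma card_U_Suc: "card (U (Suc n)) = card (sphere (Suc n) 1) * card (U n)"
proof -
  have "card {g\<in>U (Suc n). g * e0 n = v} = card (U n)" if v: "v \<in> sphere (Suc n) 1" for v
  proof -
    obtain h where h: "h \<in> U (Suc n)" "h * e0 n = v" using U_first_column[OF v] .
    show ?thesis using bij_betw_same_card[OF bij_betw_column_fiber[OF h(1)]] h(2) by simp
  qed
  then show ?thesis using sum_U_Suc[of "\<lambda>_. 1::nat" n] by simp
qed

lemma card_U_pos: "card (U n) > 0"
  using one_in_U[of n] by (metis card_gt_0_iff empty_iff finite_U)

text \<open>\<open>rot\<close> has determinant 1, so \<open>\<chi>\<close> sees only
  \<open>g\<close>. Cyclicity of the trace turns its rank-one part into
  \<open>ip r (g * r)\<close>.\<close>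

lemma sum_column:
  assumes r: "r \<in> carrier_mat n 1" and norm: "a * cj a + ip r r = 1"
    and z1: "1 + z * ip r r = cj a" and z2: "z + cj z + z * cj z * ip r r = - 1"
  shows "(\<Sum>g\<in>{g\<in>U (Suc n). g * e0 n = vcons a r}. weight g) =
    \<psi> a * (\<Sum>g\<in>U n. weight g * \<psi> (z * ip r (g * r)))"
proof -
  have u: "rot a r z \<in> U (Suc n)" by (rule rot_unitary[OF assms])
  have "(\<Sum>g\<in>{g\<in>U (Suc n). g * e0 n = vcons a r}. weight g) = (\<Sum>g\<in>U n. weight (rot a r z * emb g))"
    by (rule sum.reindex_bij_betw[OF bij_betw_column_fiber[OF u], unfolded rot_e0[OF r], symmetric])
  also have "\<dots> = (\<Sum>g\<in>U n. \<psi> a * (weight g * \<psi> (z * ip r (g * r))))"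
  proof (rule sum.cong[OF refl])
    fix g assume "g \<in> U n"
    then have g: "g \<in> carrier_mat n n" by (rule U_carrier)
    have ac: "adj r \<in> carrier_mat 1 n" and P: "r * adj r \<in> carrier_mat n n" using r by auto
    have d: "det (rot a r z * emb g) = det g"
      using det_mult[OF rot_carrier[OF r] emb_carrier[OF g]] det_rot[OF r norm z1] det_emb[OF g] by simp
    have "mat_trace (r * adj r * g) = mat_trace (r * (adj r * g))"
      using r ac g by (simp add: assoc_mult_mat[of _ n 1 _ n _ n])
    also have "\<dots> = mat_trace ((adj r * g) * r)"
      by (rule mat_trace_mult_comm[of _ n 1]) (use r ac g in auto)
    also have "(adj r * g) * r = adj r * (g * r)"
      by (rule assoc_mult_mat[OF ac g r])
    also have "mat_trace (adj r * (g * r)) = ip r (g * r)"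
      using r g by (simp add: mat_trace_def ip_def)
    finally have tP: "mat_trace (r * adj r * g) = ip r (g * r)" .
    have "rot a r z * emb g = four_block_mat ((a \<cdot>\<^sub>m 1\<^sub>m 1) * 1\<^sub>m 1 + (- adj r) * 0\<^sub>m n 1)
        ((a \<cdot>\<^sub>m 1\<^sub>m 1) * 0\<^sub>m 1 n + (- adj r) * g) (r * 1\<^sub>m 1 + (1\<^sub>m n + z \<cdot>\<^sub>m (r * adj r)) * 0\<^sub>m n 1)
        (r * 0\<^sub>m 1 n + (1\<^sub>m n + z \<cdot>\<^sub>m (r * adj r)) * g)"
      using r g P unfolding rot_def emb_def
      by (subst mult_four_block_mat[of _ 1 1 _ n _ n _ _ 1 _ n]) auto
    then have "mat_trace (rot a r z * emb g) =
        mat_trace ((a \<cdot>\<^sub>m 1\<^sub>m 1) * 1\<^sub>m 1 + (- adj r) * 0\<^sub>m n 1) +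
        mat_trace (r * 0\<^sub>m 1 n + (1\<^sub>m n + z \<cdot>\<^sub>m (r * adj r)) * g)"
      using r g P by (simp only:) (rule mat_trace_four_block[of _ 1 _ n], auto)
    also have "mat_trace ((a \<cdot>\<^sub>m 1\<^sub>m 1) * 1\<^sub>m 1 + (- adj r) * 0\<^sub>m n 1) = a"
      using r by (simp add: mat_trace_def)
    also have "r * 0\<^sub>m 1 n + (1\<^sub>m n + z \<cdot>\<^sub>m (r * adj r)) * g = g + z \<cdot>\<^sub>m (r * adj r * g)"
      using r g P by (simp add: add_mult_distrib_mat[of _ n n _ _ n] mult_smult_assoc_mat[of _ n n _ n])
    also have "mat_trace (g + z \<cdot>\<^sub>m (r * adj r * g)) = mat_trace g + z * ip r (g * r)"
      using g P tP by (simp add: mat_trace_add[of _ n] mat_trace_smult[of _ n])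
    finally show "weight (rot a r z * emb g) = \<psi> a * (weight g * \<psi> (z * ip r (g * r)))"
      unfolding weight_def d by (simp add: psi_add)
  qed
  finally show ?thesis by (simp add: sum_distrib_left)
qed

text \<open>Write \<open>k = c * cj c\<close> and \<open>r\<close> as \<open>c\<close> times the
  first column of a unitary \<open>u\<close>. Conjugation by \<open>u\<close> preserves the weight
  and changes \<open>ip r (g * r)\<close> into \<open>k\<close> times the corner entry.\<close>

lemma sum_weight_ip_nonzero:
  assumes r: "r \<in> sphere (Suc n) k" and k: "k \<noteq> 0"
  shows "(\<Sum>g\<in>U (Suc n). weight g * \<psi> (z * ip r (g * r))) = (\<Sum>g\<in>U (Suc n). weight g * \<psi> (z * k * g $$ (0, 0)))"
proof -
  have rc: "r \<in> carrier_mat (Suc n) 1" "ip r r = k" using r by (auto simp: sphere_def)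
  then have "cj k = k" using cj_ip[OF rc(1) rc(1)] by simp
  then obtain c where c: "c * cj c = k" using ex_norm by blast
  then have c0: "c \<noteq> 0" using k by auto
  have "(1 / c) \<cdot>\<^sub>m r \<in> sphere (Suc n) 1"
    using rc c c0 k by (auto simp: sphere_def ip_smult_left[of _ "Suc n"] ip_smult_right[of _ "Suc n"])
  then obtain u where u: "u \<in> U (Suc n)" "u * e0 n = (1 / c) \<cdot>\<^sub>m r" using U_first_column by blast
  note uc = U_carrier[OF u(1)]
  have ruc: "r = c \<cdot>\<^sub>m (u * e0 n)" unfolding u(2) using rc c0 by (intro eq_matI) auto
  have ec: "u * e0 n \<in> carrier_mat (Suc n) 1" using uc by simp
  have ip: "ip r (g * r) = k * (adj u * g * u) $$ (0, 0)" if "g \<in> U (Suc n)" for g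
  proof -
    note gc = U_carrier[OF that]
    have "ip r (g * r) = k * ip (u * e0 n) (g * (u * e0 n))"
      unfolding ruc mult_smult_distrib[OF gc ec] c[symmetric]
      using gc ec by (simp add: ip_smult_left[of _ "Suc n"] ip_smult_right[of _ "Suc n"])
    also have "ip (u * e0 n) (g * (u * e0 n)) = ip (e0 n) (adj u * (g * (u * e0 n)))"
      using uc gc by (intro ip_adj[of _ "Suc n" "Suc n"]) auto
    also have "adj u * (g * (u * e0 n)) = adj u * g * u * e0 n"
      using uc gc by (simp add: assoc_mult_mat[of _ "Suc n" "Suc n" _ "Suc n" _ "Suc n"]
        assoc_mult_mat[of _ "Suc n" "Suc n" _ "Suc n" _ 1])
    also have "ip (e0 n) \<dots> = (adj u * g * u) $$ (0, 0)"
      using uc gc by (subst ip_e0) (auto simp: index_mult_e0[of _ "Suc n"] simp del: index_mult_mat(1))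
    finally show ?thesis .
  qed
  have conj: "u * (adj u * g * u) * adj u = g" "adj u * (u * g * adj u) * u = g" if "g \<in> U (Suc n)" for g
  proof -
    note gc = U_carrier[OF that]
    have "u * (adj u * g * u) * adj u = u * (adj u * g) * (u * adj u)"
      using uc gc by (simp add: assoc_mult_mat[of _ "Suc n" "Suc n" _ "Suc n" _ "Suc n"])
    then show "u * (adj u * g * u) * adj u = g"
      using gc by (simp add: U_cancel[OF u(1) gc] U_mult_adj[OF u(1)])
    have "adj u * (u * g * adj u) * u = adj u * (u * g) * (adj u * u)"
      using uc gc by (simp add: assoc_mult_mat[of _ "Suc n" "Suc n" _ "Suc n" _ "Suc n"])
    then show "adj u * (u * g * adj u) * u = g"
      using gc by (simp add: U_cancel[OF u(1) gc] U_adj_mult[OF u(1)])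
  qed
  show ?thesis
  proof (rule sum.reindex_bij_witness[of _ "\<lambda>g. u * g * adj u" "\<lambda>g. adj u * g * u"])
    fix g assume g: "g \<in> U (Suc n)"
    show "weight (adj u * g * u) * \<psi> (z * k * (adj u * g * u) $$ (0, 0)) = weight g * \<psi> (z * ip r (g * r))"
      unfolding ip[OF g] using weight_conj[OF uc _ U_carrier[OF g] U_adj_mult[OF u(1)]] uc
      by (simp add: mult.assoc)
  qed (use u U_mult U_adj conj in auto)
qed

section \<open>Scaling the first row, and sums sorted by the corner entry\<close>

definition diag_first :: "nat \<Rightarrow> 'a \<Rightarrow> 'a mat" where
  "diag_first n c = mat (Suc n) (Suc n) (\<lambda>(i, j). if i = j then if i = 0 then c else 1 else 0)"

lemma diag_first_carrier [simp]: "diag_first n c \<in> carrier_mat (Suc n) (Suc n)" by (simp add: diag_first_def)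

lemma dim_diag_first [simp]: "dim_row (diag_first n c) = Suc n" "dim_col (diag_first n c) = Suc n" by (simp_all add: diag_first_def)

lemma index_diag_first_mult:
  assumes "A \<in> carrier_mat (Suc n) m" "i < Suc n" "j < m"
  shows "(diag_first n c * A) $$ (i, j) = (if i = 0 then c else 1) * A $$ (i, j)"
proof -
  have "(diag_first n c * A) $$ (i, j) = (\<Sum>l<Suc n. diag_first n c $$ (i, l) * A $$ (l, j))"
    by (rule index_mult_mat_sum[OF diag_first_carrier assms])
  also have "\<dots> = (\<Sum>l<Suc n. if i = l then (if i = 0 then c else 1) * A $$ (i, j) else 0)"
    by (intro sum.cong refl) (use assms in \<open>auto simp: diag_first_def\<close>)
  finally show ?thesis using assms(2) by simp
qed

lemma diag_first_mult_diag_first: "diag_first n c * (diag_first n d * A) = diag_first n (c * d) * A" if "A \<in> carrier_mat (Suc n) m"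
  by (rule eq_matI) (use that in \<open>auto simp: index_diag_first_mult[of _ n m] mult_carrier_mat[OF diag_first_carrier] simp del: index_mult_mat(1)\<close>)

lemma diag_first_one_mult: "diag_first n 1 * A = A" if "A \<in> carrier_mat (Suc n) m"
  by (rule eq_matI) (use that in \<open>auto simp: index_diag_first_mult[of _ n m] mult_carrier_mat[OF diag_first_carrier] simp del: index_mult_mat(1)\<close>)

lemma diag_first_in_U: "c * cj c = 1 \<Longrightarrow> diag_first n c \<in> U (Suc n)"
proof -
  assume c: "c * cj c = 1"
  have "adj (diag_first n c) = diag_first n (cj c)" by (rule eq_matI) (auto simp: diag_first_def)
  moreover have "diag_first n (cj c) * diag_first n c = 1\<^sub>m (Suc n)"
    by (rule eq_matI) (use c in \<open>auto simp: index_diag_first_mult[OF diag_first_carrier] simp del: index_mult_mat(1)\<close>, simp_all add: diag_first_def mult.commute)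
  ultimately show ?thesis by (simp add: U_iff)
qed

lemma det_diag_first: "det (diag_first n c) = c"
proof -
  have "diag_first n c = four_block_mat (c \<cdot>\<^sub>m 1\<^sub>m 1) (0\<^sub>m 1 n) (0\<^sub>m n 1) (1\<^sub>m n)"
    by (rule eq_matI) (auto simp: diag_first_def)
  then show ?thesis by (simp add: det_four_block_mat_upper_right_zero[of _ 1 _ n])
qed

lemma weight_dg_mult:
  assumes g: "g \<in> carrier_mat (Suc n) (Suc n)"
  shows "weight (diag_first n c * g) = \<chi> c * \<psi> ((c - 1) * g $$ (0, 0)) * weight g"
proof -
  have "mat_trace (diag_first n c * g) = (\<Sum>i<Suc n. (if i = 0 then c else 1) * g $$ (i, i))"
    unfolding mat_trace_def using g index_diag_first_mult[OF g] by (intro sum.cong) auto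
  also have "\<dots> = (c - 1) * g $$ (0, 0) + mat_trace g"
    using g by (simp add: mat_trace_def sum.lessThan_Suc_shift algebra_simps del: sum.lessThan_Suc)
  finally show ?thesis using det_mult[OF diag_first_carrier g]
    by (simp add: weight_def det_diag_first chi_mult psi_add mult_ac)
qed

lemma sum_U_diag_first:
  assumes c: "c * cj c = 1"
  shows "(\<Sum>g\<in>U (Suc n). F g) = (\<Sum>g\<in>U (Suc n). F (diag_first n c * g))"
proof -
  have d: "cj c * c = 1" "cj c * cj (cj c) = 1" using c by (simp_all add: mult.commute)
  show ?thesis
    by (rule sum.reindex_bij_witness[of _ "\<lambda>g. diag_first n c * g" "\<lambda>g. diag_first n (cj c) * g"])
      (use c d in \<open>auto intro!: U_mult diag_first_in_U simp: diag_first_mult_diag_first[OF U_carrier] diag_first_one_mult[OF U_carrier]\<close>)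
qed

text \<open>Index shift: \<open>entry_sum n\<close>, \<open>corner_sum n\<close> and \<open>twisted_sum n\<close> belong to dimension \<open>n + 1\<close>.\<close>

definition entry_sum :: "nat \<Rightarrow> 'a \<Rightarrow> complex" where
  "entry_sum n a = (\<Sum>g\<in>{g\<in>U (Suc n). g $$ (0, 0) = a}. weight g)"

text \<open>The factor \<open>\<psi> (- 1)\<close> cancels the \<open>\<psi> a\<close> of
  \<open>sum_column\<close> at \<open>a = 1\<close>.\<close>

definition corner_sum :: "nat \<Rightarrow> complex" where "corner_sum n = \<psi> (- 1) * entry_sum n 1"

lemma entry_sum_alt: "entry_sum n a = (\<Sum>g\<in>U (Suc n). if g $$ (0, 0) = a then weight g else 0)"
  unfolding entry_sum_def by (rule sum.inter_filter) simp

lemma usum_Suc: "usum (Suc n) = (\<Sum>a\<in>UNIV. entry_sum n a)"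
  unfolding usum_def entry_sum_def by (rule sum.group[symmetric]) auto

text \<open>Multiplying the first row by \<open>c\<close> maps the matrices with corner entry 1
  bijectively to those with corner entry \<open>c\<close>. The determinant gains the factor
  \<open>c\<close> and the trace the summand \<open>c - 1\<close>.\<close>

lemma entry_sum_unit:
  assumes c: "c * cj c = 1"
  shows "entry_sum n c = \<chi> c * \<psi> c * corner_sum n"
proof -
  have c0: "c \<noteq> 0" using c by auto
  have "entry_sum n c = (\<Sum>g\<in>U (Suc n). if (diag_first n c * g) $$ (0, 0) = c then weight (diag_first n c * g) else 0)"
    unfolding entry_sum_alt by (rule sum_U_diag_first[OF c])
  also have "\<dots> = (\<Sum>g\<in>U (Suc n). \<chi> c * \<psi> (c - 1) * (if g $$ (0, 0) = 1 then weight g else 0))"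
    by (rule sum.cong[OF refl], drule U_carrier)
      (use c0 in \<open>auto simp: index_diag_first_mult weight_dg_mult simp del: index_mult_mat(1)\<close>)
  also have "\<dots> = \<chi> c * \<psi> (c - 1) * entry_sum n 1" by (simp add: sum_distrib_left entry_sum_alt)
  also have "\<psi> (c - 1) = \<psi> c * \<psi> (- 1)" using psi_add[of c "-1"] by simp
  finally show ?thesis by (simp add: corner_sum_def)
qed

lemma entry_sum_sum: "entry_sum n a = (\<Sum>r\<in>sphere n (1 - a * cj a). \<Sum>g\<in>{g\<in>U (Suc n). g * e0 n = vcons a r}. weight g)"
proof -
  let ?f = "\<lambda>g. vtl (g * e0 n)"
  have c: "(g * e0 n) $$ (0, 0) = g $$ (0, 0)" "g * e0 n \<in> carrier_mat (Suc n) 1" if "g \<in> U (Suc n)" for g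
    using U_carrier[OF that] by (auto simp: index_mult_e0[of _ "Suc n"] simp del: index_mult_mat(1))
  have im: "?f g \<in> sphere n (1 - a * cj a)" if g: "g \<in> U (Suc n)" and a: "g $$ (0, 0) = a" for g
  proof -
    have v: "vtl (g * e0 n) \<in> carrier_mat n 1" by (rule vtl_carrier[OF c(2)[OF g]])
    have "g * e0 n = vcons a (?f g)" using vcons_vtl[OF c(2)[OF g]] c(1)[OF g] a by simp
    then have "ip (vcons a (?f g)) (vcons a (?f g)) = 1" using mult_e0_in_sphere[OF g] by (simp add: sphere_def)
    then have "ip (?f g) (?f g) = 1 - a * cj a" unfolding ip_vcons[OF v v] by (simp add: algebra_simps)
    then show ?thesis using v by (simp add: sphere_def)
  qed
  have "entry_sum n a = (\<Sum>r\<in>sphere n (1 - a * cj a). \<Sum>g\<in>{g\<in>{g\<in>U (Suc n). g $$ (0, 0) = a}. ?f g = r}. weight g)"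
    unfolding entry_sum_def by (rule sum.group[symmetric]) (use im in auto)
  moreover have "{g\<in>{g\<in>U (Suc n). g $$ (0, 0) = a}. ?f g = r} = {g\<in>U (Suc n). g * e0 n = vcons a r}"
    if "r \<in> sphere n (1 - a * cj a)" for r
  proof -
    have r: "r \<in> carrier_mat n 1" using that by (simp add: sphere_def)
    have "g $$ (0, 0) = a \<and> ?f g = r \<longleftrightarrow> g * e0 n = vcons a r" if "g \<in> U (Suc n)" for g
      using vcons_vtl[OF c(2)[OF that]] c(1)[OF that] vtl_vcons[OF r] index_vcons(1)[of a r] by metis
    then show ?thesis by auto
  qed
  ultimately show ?thesis by simp
qed

text \<open>What remains of \<open>sum_column\<close> for non-isotropic \<open>r\<close>: there
  \<open>z * ip r r = cj a - 1\<close>, so the inner sum depends on \<open>a\<close> alone and not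
  on \<open>r\<close>. It is defined for every \<open>a\<close>, as Fourier inversion
  requires.\<close>

definition twisted_sum :: "nat \<Rightarrow> 'a \<Rightarrow> complex" where
  "twisted_sum n a = (\<Sum>g\<in>U (Suc n). weight g * \<psi> ((cj a - 1) * g $$ (0, 0)))"

lemma entry_sum_0_nonunit: "a * cj a \<noteq> 1 \<Longrightarrow> entry_sum 0 a = 0"
proof -
  assume a: "a * cj a \<noteq> 1"
  have "ip r r = 0" if "r \<in> carrier_mat 0 1" for r using that by (simp add: ip_sum[of _ 0])
  then have "sphere 0 (1 - a * cj a) = {}" using a by (auto simp: sphere_def)
  then show ?thesis by (simp add: entry_sum_sum)
qed

lemma entry_sum_Suc_nonunit:
  assumes a: "a * cj a \<noteq> 1"
  shows "entry_sum (Suc n) a = of_nat (card (sphere (Suc n) (1 - a * cj a))) * (\<psi> a * twisted_sum n a)"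
proof -
  have "(\<Sum>g\<in>{g\<in>U (Suc (Suc n)). g * e0 (Suc n) = vcons a r}. weight g) = \<psi> a * twisted_sum n a"
    if r: "r \<in> sphere (Suc n) (1 - a * cj a)" for r
  proof -
    have rc: "r \<in> carrier_mat (Suc n) 1" and k: "ip r r = 1 - a * cj a" using r by (auto simp: sphere_def)
    have norm: "a * cj a + ip r r = 1" and k0: "ip r r \<noteq> 0" using k a by auto
    note z = rot_exists_param[OF norm k0 cj_ip[OF rc rc]]
    have "(\<Sum>g\<in>{g\<in>U (Suc (Suc n)). g * e0 (Suc n) = vcons a r}. weight g) =
        \<psi> a * (\<Sum>g\<in>U (Suc n). weight g * \<psi> ((cj a - 1) / ip r r * ip r (g * r)))"
      by (rule sum_column[OF rc norm z])
    also have "(\<Sum>g\<in>U (Suc n). weight g * \<psi> ((cj a - 1) / ip r r * ip r (g * r))) = twisted_sum n a"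
      using sum_weight_ip_nonzero[of r n "ip r r" "(cj a - 1) / ip r r"] rc k0
      by (simp add: twisted_sum_def sphere_def)
    finally show ?thesis .
  qed
  then show ?thesis by (simp add: entry_sum_sum)
qed

text \<open>Scaling the first row by \<open>c\<close> changes the trace by
  \<open>(c - 1) * g $$ (0, 0)\<close> and the twist to \<open>(1 - c) * g $$ (0, 0)\<close>; the
  two cancel.\<close>

lemma twisted_sum_unit:
  assumes c: "c * cj c = 1"
  shows "twisted_sum n c = \<chi> c * usum (Suc n)"
proof -
  have "twisted_sum n c = (\<Sum>g\<in>U (Suc n). weight (diag_first n c * g) * \<psi> ((cj c - 1) * (diag_first n c * g) $$ (0, 0)))"
    unfolding twisted_sum_def by (rule sum_U_diag_first[OF c])
  also have "\<dots> = (\<Sum>g\<in>U (Suc n). \<chi> c * weight g)"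
  proof (rule sum.cong[OF refl])
    fix g assume "g \<in> U (Suc n)"
    then have g: "g \<in> carrier_mat (Suc n) (Suc n)" by (rule U_carrier)
    have "(c - 1) * g $$ (0, 0) + (cj c - 1) * (c * g $$ (0, 0)) = (c * cj c - 1) * g $$ (0, 0)"
      by (simp add: algebra_simps)
    then have "\<psi> ((c - 1) * g $$ (0, 0)) * \<psi> ((cj c - 1) * (c * g $$ (0, 0))) = 1"
      unfolding psi_add[symmetric] by (simp add: c)
    moreover have "(diag_first n c * g) $$ (0, 0) = c * g $$ (0, 0)" using index_diag_first_mult[OF g, of 0 0] by simp
    ultimately show "weight (diag_first n c * g) * \<psi> ((cj c - 1) * (diag_first n c * g) $$ (0, 0)) = \<chi> c * weight g"
      unfolding weight_dg_mult[OF g] by (simp add: mult_ac)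
  qed
  also have "\<dots> = \<chi> c * usum (Suc n)" by (simp add: usum_def sum_distrib_left)
  finally show ?thesis .
qed

text \<open>Summing over \<open>a\<close> first, \<open>sum_psi_twist\<close> selects the matrices
  with corner entry \<open>\<alpha>\<close>, and row scaling moves this entry to 1.\<close>

lemma sum_psi_twisted_sum: "(\<Sum>a\<in>UNIV. \<psi> a * twisted_sum n a) = of_nat q ^ 2 * \<chi> \<alpha> * corner_sum n"
proof -
  have "(\<Sum>a\<in>UNIV. \<psi> a * twisted_sum n a) = (\<Sum>a\<in>UNIV. \<Sum>g\<in>U (Suc n). weight g * \<psi> (a + (cj a - 1) * g $$ (0, 0)))"
    by (simp add: twisted_sum_def sum_distrib_left psi_add mult_ac)
  also have "\<dots> = (\<Sum>g\<in>U (Suc n). weight g * (\<Sum>a\<in>UNIV. \<psi> (a + (cj a - 1) * g $$ (0, 0))))"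
    by (subst sum.swap) (simp add: sum_distrib_left)
  also have "\<dots> = (\<Sum>g\<in>U (Suc n). of_nat q ^ 2 * \<psi> (- \<alpha>) * (if g $$ (0, 0) = \<alpha> then weight g else 0))"
    unfolding sum_psi_twist by (intro sum.cong refl) auto
  also have "\<dots> = of_nat q ^ 2 * \<psi> (- \<alpha>) * entry_sum n \<alpha>"
    by (simp add: sum_distrib_left entry_sum_alt)
  also have "\<dots> = of_nat q ^ 2 * \<chi> \<alpha> * corner_sum n * (\<psi> \<alpha> * \<psi> (- \<alpha>))" by (simp add: entry_sum_unit[OF alpha_norm])
  finally show ?thesis by (simp add: psi_minus)
qed

lemma sum_entry_sum_unit: "(\<Sum>a\<in>{a. a * cj a = 1}. entry_sum n a) = G1 q \<chi> \<psi> * corner_sum n"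
  unfolding G1_eq sum_distrib_right by (intro sum.cong refl) (simp add: entry_sum_unit)

text \<open>Below the corner the column is empty, so the corner entry must have norm 1.\<close>

lemma usum_1: "usum 1 = G1 q \<chi> \<psi> * corner_sum 0"
proof -
  have "usum 1 = (\<Sum>a\<in>UNIV. entry_sum 0 a)" using usum_Suc[of 0] by simp
  also have "\<dots> = (\<Sum>a\<in>{a. a * cj a = 1}. entry_sum 0 a)"
    by (rule sum.mono_neutral_right) (auto simp: entry_sum_0_nonunit)
  finally show ?thesis by (simp add: sum_entry_sum_unit)
qed

text \<open>The number of vectors of any fixed nonzero norm in dimension \<open>n + 1\<close>.\<close>

definition generic_count :: "nat \<Rightarrow> complex" where
  "generic_count n = (of_nat q ^ (2 * Suc n) - (- of_nat q) ^ Suc n) / of_nat q"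

text \<open>Corner entries of norm 1 give \<open>G1\<close> times a corner sum. For the others
  \<open>1 - a * cj a\<close> is nonzero, so the number of columns is constant; their twisted sums
  are the Fourier sum over all \<open>a\<close> minus the norm-1 part.\<close>

lemma usum_Suc_Suc:
  "usum (Suc (Suc n)) = generic_count n * of_nat q ^ 2 * \<chi> \<alpha> * corner_sum n + G1 q \<chi> \<psi> * (corner_sum (Suc n) - generic_count n * usum (Suc n))"
proof -
  let ?N = "{a. a * cj a = 1}"
  have card: "of_nat (card (sphere (Suc n) (1 - a * cj a))) = generic_count n" if "a * cj a \<noteq> 1" for a
  proof -
    have "cj (1 - a * cj a) = 1 - a * cj a" by simp
    note card_sphere[OF this, of "Suc n"]
    then show ?thesis using that q_pos by (simp add: generic_count_def field_simps del: power_Suc)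
  qed
  have "usum (Suc (Suc n)) = (\<Sum>a\<in>?N. entry_sum (Suc n) a) + (\<Sum>a\<in>- ?N. entry_sum (Suc n) a)"
    unfolding usum_Suc by (subst sum.union_disjoint[symmetric]) auto
  also have "(\<Sum>a\<in>- ?N. entry_sum (Suc n) a) = (\<Sum>a\<in>- ?N. generic_count n * (\<psi> a * twisted_sum n a))"
    by (intro sum.cong refl) (simp add: entry_sum_Suc_nonunit card)
  also have "\<dots> = generic_count n * ((\<Sum>a\<in>UNIV. \<psi> a * twisted_sum n a) - (\<Sum>a\<in>?N. \<psi> a * twisted_sum n a))"
    unfolding sum_distrib_left[symmetric] by (simp add: Compl_eq_Diff_UNIV sum_diff)
  also have "(\<Sum>a\<in>?N. \<psi> a * twisted_sum n a) = G1 q \<chi> \<psi> * usum (Suc n)"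
    unfolding G1_eq sum_distrib_right by (intro sum.cong refl) (simp add: twisted_sum_unit)
  finally show ?thesis by (simp add: sum_entry_sum_unit sum_psi_twisted_sum algebra_simps)
qed

text \<open>Corner entry 1 forces the rest \<open>r\<close> of the column to be isotropic, where
  \<open>rot\<close> accepts any \<open>z\<close> of trace -1. The vector \<open>r = 0\<close>
  contributes \<open>usum n\<close>, the nonzero ones a common value \<open>Z\<close>.\<close>

lemma corner_sum_eq:
  assumes z: "z + cj z = -1"
    and Z: "\<And>r. r \<in> sphere n 0 \<Longrightarrow> r \<noteq> 0\<^sub>m n 1 \<Longrightarrow> (\<Sum>g\<in>U n. weight g * \<psi> (z * ip r (g * r))) = Z"
  shows "corner_sum n = usum n + (of_nat (card (sphere n 0)) - 1) * Z"
proof -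
  have 0: "0\<^sub>m n 1 \<in> sphere n 0" by (simp add: sphere_def ip_sum[of _ n])
  have "corner_sum n = (\<Sum>r\<in>sphere n 0. \<psi> (- 1) * (\<Sum>g\<in>{g\<in>U (Suc n). g * e0 n = vcons 1 r}. weight g))"
    by (simp add: corner_sum_def entry_sum_sum sum_distrib_left)
  also have "\<dots> = (\<Sum>r\<in>sphere n 0. \<Sum>g\<in>U n. weight g * \<psi> (z * ip r (g * r)))"
  proof (rule sum.cong[OF refl])
    fix r assume "r \<in> sphere n 0"
    then have "r \<in> carrier_mat n 1" "ip r r = 0" by (auto simp: sphere_def)
    then have "(\<Sum>g\<in>{g\<in>U (Suc n). g * e0 n = vcons 1 r}. weight g) =
        \<psi> 1 * (\<Sum>g\<in>U n. weight g * \<psi> (z * ip r (g * r)))"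
      using z by (intro sum_column) auto
    then show "\<psi> (- 1) * (\<Sum>g\<in>{g\<in>U (Suc n). g * e0 n = vcons 1 r}. weight g) =
        (\<Sum>g\<in>U n. weight g * \<psi> (z * ip r (g * r)))"
      using psi_minus[of 1] by (simp add: mult.assoc[symmetric] mult.commute)
  qed
  also have "\<dots> = (\<Sum>g\<in>U n. weight g * \<psi> (z * ip (0\<^sub>m n 1) (g * 0\<^sub>m n 1))) +
      (\<Sum>r\<in>sphere n 0 - {0\<^sub>m n 1}. \<Sum>g\<in>U n. weight g * \<psi> (z * ip r (g * r)))"
    by (rule sum.remove[OF finite_sphere 0])
  also have "(\<Sum>g\<in>U n. weight g * \<psi> (z * ip (0\<^sub>m n 1) (g * 0\<^sub>m n 1))) = usum n"
    unfolding usum_def by (intro sum.cong refl, drule U_carrier) (simp add: ip_sum[of _ n])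
  also have "(\<Sum>r\<in>sphere n 0 - {0\<^sub>m n 1}. \<Sum>g\<in>U n. weight g * \<psi> (z * ip r (g * r))) =
      of_nat (card (sphere n 0 - {0\<^sub>m n 1})) * Z"
    by (simp add: Z)
  also have "of_nat (card (sphere n 0 - {0\<^sub>m n 1})) = (of_nat (card (sphere n 0)) - 1 :: complex)"
    using 0 finite_sphere by (metis card_Suc_Diff1 add_diff_cancel_left' of_nat_Suc)
  finally show ?thesis .
qed

subsection \<open>Hyperbolic frames\<close>

text \<open>The Gram matrix of a hyperbolic pair followed by an orthonormal basis of its complement;
  it is also the permutation matrix swapping the first two coordinates.\<close>

definition J :: "nat \<Rightarrow> 'a mat" where
  "J m = mat (Suc (Suc m)) (Suc (Suc m)) (\<lambda>(i, j).
     if i = 0 then if j = 1 then 1 else 0 else if i = 1 then if j = 0 then 1 else 0 else if i = j then 1 else 0)"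

lemma J_carrier [simp]: "J m \<in> carrier_mat (Suc (Suc m)) (Suc (Suc m))" by (simp add: J_def)

lemma dim_J [simp]: "dim_row (J m) = Suc (Suc m)" "dim_col (J m) = Suc (Suc m)" by (simp_all add: J_def)

lemma index_J:
  "i < Suc (Suc m) \<Longrightarrow> j < Suc (Suc m) \<Longrightarrow> J m $$ (i, j) =
     (if i = 0 then if j = 1 then 1 else 0 else if i = 1 then if j = 0 then 1 else 0 else if i = j then 1 else 0)"
  by (simp add: J_def)

lemma index_J_mult:
  assumes B: "B \<in> carrier_mat (Suc (Suc m)) n" and j: "j < n"
  shows "(J m * B) $$ (0, j) = B $$ (Suc 0, j)" "(J m * B) $$ (Suc 0, j) = B $$ (0, j)"
    "l < m \<Longrightarrow> (J m * B) $$ (Suc (Suc l), j) = B $$ (Suc (Suc l), j)"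
proof -
  have *: "(J m * B) $$ (i, j) = J m $$ (i, 0) * B $$ (0, j) + (J m $$ (i, Suc 0) * B $$ (Suc 0, j) +
      (\<Sum>l<m. J m $$ (i, Suc (Suc l)) * B $$ (Suc (Suc l), j)))" if "i < Suc (Suc m)" for i
    by (subst index_mult_mat_sum[OF J_carrier B that j]) (rule sum_lessThan_Suc_Suc)
  show "(J m * B) $$ (0, j) = B $$ (Suc 0, j)" "(J m * B) $$ (Suc 0, j) = B $$ (0, j)"
    using *[of 0] *[of "Suc 0"] by (simp_all add: index_J del: index_mult_mat(1))
  show "(J m * B) $$ (Suc (Suc l), j) = B $$ (Suc (Suc l), j)" if l: "l < m"
  proof -
    have "(\<Sum>k<m. J m $$ (Suc (Suc l), Suc (Suc k)) * B $$ (Suc (Suc k), j)) =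
        (\<Sum>k<m. if l = k then B $$ (Suc (Suc k), j) else 0)"
      by (intro sum.cong refl) (use l in \<open>auto simp: index_J\<close>)
    then show ?thesis using l by (subst *) (auto simp: index_J)
  qed
qed

lemma J_J: "J m * J m = 1\<^sub>m (Suc (Suc m))"
proof (rule eq_matI)
  fix i j assume "i < dim_row (1\<^sub>m (Suc (Suc m)) :: 'a mat)" "j < dim_col (1\<^sub>m (Suc (Suc m)) :: 'a mat)"
  then have ij: "i < Suc (Suc m)" "j < Suc (Suc m)" by auto
  show "(J m * J m) $$ (i, j) = 1\<^sub>m (Suc (Suc m)) $$ (i, j)"
    by (rule less_Suc_Suc_cases[OF ij(1)])
      (use ij in \<open>auto simp: index_J_mult[OF J_carrier] index_J simp del: index_mult_mat(1)\<close>)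
qed simp_all

lemma adj_J: "adj (J m) = J m"
  by (rule eq_matI) (auto simp: J_def)

text \<open>The pairing of columns \<open>i\<close> and \<open>j\<close> of \<open>g\<close> under
  the form \<open>J\<close>, written out so that membership in \<open>UJ\<close> can be checked
  entry by entry.\<close>

definition hform :: "nat \<Rightarrow> 'a mat \<Rightarrow> nat \<Rightarrow> nat \<Rightarrow> 'a" where
  "hform m g i j = cj (g $$ (0, i)) * g $$ (Suc 0, j) + cj (g $$ (Suc 0, i)) * g $$ (0, j) +
     (\<Sum>l<m. cj (g $$ (Suc (Suc l), i)) * g $$ (Suc (Suc l), j))"

lemma index_adj_J_mult:
  assumes g: "g \<in> carrier_mat (Suc (Suc m)) n" and "i < n" "j < n"
  shows "(adj g * (J m * g)) $$ (i, j) = hform m g i j"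
proof -
  have Jg: "J m * g \<in> carrier_mat (Suc (Suc m)) n" by (rule mult_carrier_mat[OF J_carrier g])
  have "(adj g * (J m * g)) $$ (i, j) = (\<Sum>l<Suc (Suc m). adj g $$ (i, l) * (J m * g) $$ (l, j))"
    by (rule index_mult_mat_sum[OF _ Jg]) (use assms in auto)
  then show ?thesis using assms
    by (simp add: sum_lessThan_Suc_Suc index_J_mult[OF g] hform_def add.assoc del: index_mult_mat(1) sum.lessThan_Suc)
qed

definition UJ :: "nat \<Rightarrow> 'a mat set" where
  "UJ m = {g \<in> carrier_mat (Suc (Suc m)) (Suc (Suc m)). adj g * (J m * g) = J m}"

lemma UJ_iff:
  assumes g: "g \<in> carrier_mat (Suc (Suc m)) (Suc (Suc m))"
  shows "g \<in> UJ m \<longleftrightarrow> (\<forall>i<Suc (Suc m). \<forall>j<Suc (Suc m). hform m g i j = J m $$ (i, j))"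
proof -
  have "adj g * (J m * g) = J m \<longleftrightarrow>
      (\<forall>i<Suc (Suc m). \<forall>j<Suc (Suc m). (adj g * (J m * g)) $$ (i, j) = J m $$ (i, j))"
    using g by (auto simp: J_def simp del: index_mult_mat(1) intro!: eq_matI)
  then show ?thesis using g by (simp add: UJ_def index_adj_J_mult del: index_mult_mat(1))
qed

definition e1 :: "nat \<Rightarrow> 'a mat" where "e1 m = vcons 0 (e0 m)"

lemma e1_carrier [simp]: "e1 m \<in> carrier_mat (Suc (Suc m)) 1"
  unfolding e1_def by (rule vcons_carrier[OF e0_carrier])

lemmas [simp] = e1_carrier[unfolded One_nat_def]

text \<open>Expresses a hyperbolic pair through an orthonormal one: with \<open>s + s\<^sup>q = 1\<close> and \<open>d d\<^sup>q = - 1\<close>, the vectors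
  \<open>f + s r\<close> and \<open>d (f - s\<^sup>q r)\<close> are orthonormal whenever \<open>r\<close>, \<open>f\<close> is a hyperbolic pair.\<close>

definition hyp_base :: "nat \<Rightarrow> 'a \<Rightarrow> 'a \<Rightarrow> 'a mat" where
  "hyp_base m s d = mat (Suc (Suc m)) (Suc (Suc m)) (\<lambda>(i, j).
     if i = 0 then if j = 0 then 1 else if j = 1 then cj s else 0
     else if i = 1 then if j = 0 then - 1 / d else if j = 1 then s / d else 0
     else if i = j then 1 else 0)"

lemma hyp_base_carrier [simp]: "hyp_base m s d \<in> carrier_mat (Suc (Suc m)) (Suc (Suc m))"
  by (simp add: hyp_base_def)

lemma index_hyp_base:
  "i < Suc (Suc m) \<Longrightarrow> j < Suc (Suc m) \<Longrightarrow> hyp_base m s d $$ (i, j) =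
     (if i = 0 then if j = 0 then 1 else if j = 1 then cj s else 0
     else if i = 1 then if j = 0 then - 1 / d else if j = 1 then s / d else 0
     else if i = j then 1 else 0)"
  by (simp add: hyp_base_def)

lemma dim_hyp_base [simp]: "dim_row (hyp_base m s d) = Suc (Suc m)" "dim_col (hyp_base m s d) = Suc (Suc m)"
  by (simp_all add: hyp_base_def)

lemma index_mult_e1:
  assumes B: "B \<in> carrier_mat n (Suc (Suc m))" and i: "i < n"
  shows "(B * e1 m) $$ (i, 0) = B $$ (i, Suc 0)"
  by (subst index_mult_mat_sum[OF B e1_carrier i])
    (simp_all add: sum_lessThan_Suc_Suc e1_def e0_def del: sum.lessThan_Suc)

lemma adj_hyp_base_mult:
  assumes s: "s + cj s = 1" and d: "d * cj d = -1"
  shows "adj (hyp_base m s d) * hyp_base m s d = J m"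
proof (rule eq_matI)
  have d0: "d \<noteq> 0" using d by auto
  have d1: "x / (cj d * d) = - x" "x / (d * cj d) = - x" for x using d by (simp_all add: mult.commute)
  fix i j assume "i < dim_row (J m)" "j < dim_col (J m)"
  then have ij: "i < Suc (Suc m)" "j < Suc (Suc m)" by (auto simp: J_def)
  have "(adj (hyp_base m s d) * hyp_base m s d) $$ (i, j) =
      (\<Sum>l<Suc (Suc m). adj (hyp_base m s d) $$ (i, l) * hyp_base m s d $$ (l, j))"
    by (rule index_mult_mat_sum[OF _ hyp_base_carrier]) (use ij in auto)
  also have "\<dots> = J m $$ (i, j)"
  proof -
    have *: "(\<Sum>l<m. cj (if l = k then 1 else 0) * (if l = k' then 1 else 0)) = (if k = k' then 1 else 0)"
      if "k < m" for k k'
    proof -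
      have "(\<Sum>l<m. cj (if l = k then 1 else 0) * (if l = k' then 1 else 0)) =
          (\<Sum>l<m. if l = k then if k = k' then 1 else 0 else 0)"
        by (intro sum.cong) auto
      then show ?thesis using that by simp
    qed
    show ?thesis
      by (rule less_Suc_Suc_cases[OF ij(1)]; rule less_Suc_Suc_cases[OF ij(2)])
        (use s in \<open>simp_all add: sum_lessThan_Suc_Suc index_hyp_base index_J d1 * add.commute mult.commute[of d]
          del: sum.lessThan_Suc\<close>)
  qed
  finally show "(adj (hyp_base m s d) * hyp_base m s d) $$ (i, j) = J m $$ (i, j)" .
qed (simp_all add: J_def hyp_base_def)

lemma hyp_base_e:
  "hyp_base m s d * e0 (Suc m) = e0 (Suc m) + (- 1 / d) \<cdot>\<^sub>m e1 m"
  "hyp_base m s d * e1 m = cj s \<cdot>\<^sub>m e0 (Suc m) + (s / d) \<cdot>\<^sub>m e1 m"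
proof -
  have e: "e0 (Suc m) = mat (Suc (Suc m)) 1 (\<lambda>(i, _). if i = 0 then 1 else 0)"
    "e1 m = mat (Suc (Suc m)) 1 (\<lambda>(i, _). if i = 1 then 1 else 0)"
    by (rule eq_matI; auto simp: e0_def e1_def vcons_def)+
  show "hyp_base m s d * e0 (Suc m) = e0 (Suc m) + (- 1 / d) \<cdot>\<^sub>m e1 m"
  proof (rule eq_matI)
    fix i j assume "i < dim_row (e0 (Suc m) + (- 1 / d) \<cdot>\<^sub>m e1 m)" "j < dim_col (e0 (Suc m) + (- 1 / d) \<cdot>\<^sub>m e1 m)"
    then have "i < Suc (Suc m)" "j = 0" by (auto simp: e)
    then show "(hyp_base m s d * e0 (Suc m)) $$ (i, j) = (e0 (Suc m) + (- 1 / d) \<cdot>\<^sub>m e1 m) $$ (i, j)"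
      by (simp add: index_mult_e0[OF hyp_base_carrier] index_hyp_base del: index_mult_mat(1)) (simp add: e)
  qed (simp_all add: e)
  show "hyp_base m s d * e1 m = cj s \<cdot>\<^sub>m e0 (Suc m) + (s / d) \<cdot>\<^sub>m e1 m"
  proof (rule eq_matI)
    fix i j assume "i < dim_row (cj s \<cdot>\<^sub>m e0 (Suc m) + (s / d) \<cdot>\<^sub>m e1 m)" "j < dim_col (cj s \<cdot>\<^sub>m e0 (Suc m) + (s / d) \<cdot>\<^sub>m e1 m)"
    then have "i < Suc (Suc m)" "j = 0" by (auto simp: e)
    then show "(hyp_base m s d * e1 m) $$ (i, j) = (cj s \<cdot>\<^sub>m e0 (Suc m) + (s / d) \<cdot>\<^sub>m e1 m) $$ (i, j)"
      by (simp add: index_mult_e1[OF hyp_base_carrier] index_hyp_base del: index_mult_mat(1)) (simp add: e)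
  qed (simp_all add: e)
qed

text \<open>Pulled back by a unitary matrix with first column \<open>u\<close>, the vector
  \<open>v\<close> has first entry 0. Its tail is a unit vector, so the first-column lemma applies
  once more in one dimension less.\<close>

lemma orthonormal_pair:
  assumes u: "u \<in> sphere (Suc (Suc m)) 1" and v: "v \<in> sphere (Suc (Suc m)) 1" and uv: "ip u v = 0"
  obtains Q where "Q \<in> U (Suc (Suc m))" "Q * e0 (Suc m) = u" "Q * e1 m = v"
proof -
  obtain h where h: "h \<in> U (Suc (Suc m))" "h * e0 (Suc m) = u" using U_first_column[OF u] .
  note hc = U_carrier[OF h(1)]
  have vc: "v \<in> carrier_mat (Suc (Suc m)) 1" "ip v v = 1" using v by (auto simp: sphere_def)
  define y where "y = adj h * v"
  have yc: "y \<in> carrier_mat (Suc (Suc m)) 1" using hc vc by (simp add: y_def)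
  have t: "vtl y \<in> carrier_mat (Suc m) 1" by (rule vtl_carrier[OF yc])
  have "ip (h * e0 (Suc m)) v = ip (e0 (Suc m)) y"
    unfolding y_def by (rule ip_adj[OF hc e0_carrier vc(1)])
  then have y0: "y $$ (0, 0) = 0" using uv h(2) ip_e0[OF yc] by simp
  have y: "y = vcons 0 (vtl y)" using vcons_vtl[OF yc] y0 by simp
  have "ip y y = 1" unfolding y_def using ip_U[OF U_adj[OF h(1)] vc(1) vc(1)] vc by simp
  then have "vtl y \<in> sphere (Suc m) 1"
    using t ip_vcons[OF t t, of 0 0] y by (simp add: sphere_def)
  then obtain h' where h': "h' \<in> U (Suc m)" "h' * e0 m = vtl y" using U_first_column by blast
  note hc' = U_carrier[OF h'(1)]
  let ?Q = "h * emb h'"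
  have "?Q \<in> U (Suc (Suc m))" using U_mult[OF h(1)] emb_in_U_iff[OF hc'] h'(1) by simp
  moreover have "?Q * e0 (Suc m) = h * (emb h' * e0 (Suc m))"
    by (rule assoc_mult_mat[OF hc emb_carrier[OF hc'] e0_carrier])
  moreover have "emb h' * e0 (Suc m) = e0 (Suc m)"
    using emb_mult_vcons[OF hc', of "0\<^sub>m (Suc m) 1" 1] hc' by (simp add: e0_def)
  moreover have "?Q * e1 m = h * (emb h' * e1 m)"
    by (rule assoc_mult_mat[OF hc emb_carrier[OF hc'] e1_carrier])
  moreover have "emb h' * e1 m = y"
    unfolding e1_def emb_mult_vcons[OF hc' e0_carrier] h'(2) using y by simp
  moreover have "h * y = v" unfolding y_def by (rule U_cancel(2)[OF h(1) vc(1)])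
  ultimately show ?thesis using that h(2) by simp
qed

text \<open>A case of Witt extension, reduced to orthonormal pairs: extend the orthonormal pair
  \<open>?u\<close>, \<open>?v\<close> to a unitary \<open>Q\<close> and multiply by
  \<open>hyp_base\<close>, whose first two columns are the coordinates of \<open>r\<close> and
  \<open>f\<close> in terms of \<open>?u\<close> and \<open>?v\<close>.\<close>

lemma hyperbolic_frame:
  assumes r: "r \<in> sphere (Suc (Suc m)) 0" and f: "f \<in> sphere (Suc (Suc m)) 0" and rf: "ip r f = 1"
  obtains P where "P \<in> carrier_mat (Suc (Suc m)) (Suc (Suc m))" "adj P * P = J m"
    "P * e0 (Suc m) = r" "P * e1 m = f"
proof -
  let ?M = "Suc (Suc m)"
  have rc: "r \<in> carrier_mat ?M 1" "ip r r = 0" and fc: "f \<in> carrier_mat ?M 1" "ip f f = 0"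
    using r f by (auto simp: sphere_def)
  have fr: "ip f r = 1" using cj_ip[OF rc(1) fc(1)] rf by simp
  obtain s where s: "s + cj s = 1" using ex_trace[of 1] by auto
  obtain d where d: "d * cj d = -1" using ex_norm[of "-1"] by auto
  have d0: "d \<noteq> 0" using d by auto
  let ?u = "f + s \<cdot>\<^sub>m r" and ?v = "d \<cdot>\<^sub>m (f + (- cj s) \<cdot>\<^sub>m r)"
  note ips = ip_add_left[of _ ?M] ip_add_right[of _ ?M] ip_smult_left[of _ ?M] ip_smult_right[of _ ?M]
  have u: "?u \<in> sphere ?M 1" using rc fc rf fr s by (simp add: sphere_def ips add.commute)
  have v: "?v \<in> sphere ?M 1"
  proof -
    have "ip ?v ?v = - (d * cj d * (s + cj s))"
      using rc fc rf fr by (simp add: ips algebra_simps)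
    then show ?thesis using rc fc s d by (simp add: sphere_def)
  qed
  have "ip ?u ?v = 0" using rc fc rf fr by (simp add: ips)
  then obtain Q where Q: "Q \<in> U ?M" "Q * e0 (Suc m) = ?u" "Q * e1 m = ?v"
    using orthonormal_pair[OF u v] by blast
  note Qc = U_carrier[OF Q(1)]
  let ?H = "hyp_base m s d"
  have "adj (Q * ?H) * (Q * ?H) = adj ?H * adj Q * (Q * ?H)" by (simp only: adj_mult[OF Qc hyp_base_carrier])
  also have "\<dots> = adj ?H * (adj Q * Q) * ?H"
    by (rule mult_assoc_mat4[of _ ?M ?M _ ?M _ ?M _ ?M]) (use Qc in auto)
  also have "\<dots> = J m" by (simp add: U_adj_mult[OF Q(1)] right_mult_one_mat[of _ ?M ?M] adj_hyp_base_mult[OF s d])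
  finally have PP: "adj (Q * ?H) * (Q * ?H) = J m" .
  have lin: "Q * (a \<cdot>\<^sub>m e0 (Suc m) + b \<cdot>\<^sub>m e1 m) = a \<cdot>\<^sub>m ?u + b \<cdot>\<^sub>m ?v" for a b
  proof -
    have "Q * (a \<cdot>\<^sub>m e0 (Suc m) + b \<cdot>\<^sub>m e1 m) = Q * (a \<cdot>\<^sub>m e0 (Suc m)) + Q * (b \<cdot>\<^sub>m e1 m)"
      by (rule mult_add_distrib_mat[OF Qc]) auto
    then show ?thesis
      by (simp only: mult_smult_distrib[OF Qc e0_carrier] mult_smult_distrib[OF Qc e1_carrier] Q)
  qed
  have "Q * ?H * e0 (Suc m) = Q * (?H * e0 (Suc m))"
    by (rule assoc_mult_mat[OF Qc hyp_base_carrier e0_carrier])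
  also have "\<dots> = Q * (1 \<cdot>\<^sub>m e0 (Suc m) + (- 1 / d) \<cdot>\<^sub>m e1 m)"
  proof -
    have "1 \<cdot>\<^sub>m e0 (Suc m) = e0 (Suc m)" by (rule eq_matI) auto
    then show ?thesis unfolding hyp_base_e by simp
  qed
  also have "\<dots> = r" unfolding lin using rc fc d0 s
    by (intro eq_matI) (auto simp: algebra_simps distrib_right[symmetric])
  finally have P0: "Q * ?H * e0 (Suc m) = r" .
  have "Q * ?H * e1 m = f"
  proof -
    have "Q * ?H * e1 m = Q * (?H * e1 m)"
      by (rule assoc_mult_mat[OF Qc hyp_base_carrier e1_carrier])
    also have "\<dots> = f" unfolding hyp_base_e lin
    proof (rule eq_matI)
      fix i j assume "i < dim_row f" "j < dim_col f"
      then have ij: "i < ?M" "j = 0" using fc by auto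
      let ?x = "f $$ (i, j)" and ?y = "r $$ (i, j)"
      have "cj s * (?x + s * ?y) + s / d * (d * (?x + (- cj s) * ?y)) = (s + cj s) * ?x"
        using d0 by (simp add: algebra_simps)
      then have "cj s * (?x + s * ?y) + s / d * (d * (?x + (- cj s) * ?y)) = ?x" by (simp only: s mult_1_left)
      then show "(cj s \<cdot>\<^sub>m ?u + (s / d) \<cdot>\<^sub>m ?v) $$ (i, j) = f $$ (i, j)"
        using rc fc ij by simp
    qed (use rc fc in auto)
    finally show ?thesis .
  qed
  with PP P0 show ?thesis using that[OF mult_carrier_mat[OF Qc hyp_base_carrier]] by blast
qed

text \<open>A vector \<open>x\<close> supported at one nonzero coordinate of \<open>r\<close> pairs
  to 1 with \<open>r\<close>. Adding \<open>s \<cdot>\<^sub>m r\<close> does not affect this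
  pairing, and changes \<open>ip x x\<close> by the trace of \<open>s\<close>, which can be any
  fixed element.\<close>

lemma hyperbolic_partner:
  assumes r: "r \<in> sphere n 0" and r0: "r \<noteq> 0\<^sub>m n 1"
  obtains f where "f \<in> sphere n 0" "ip r f = 1"
proof -
  have rc: "r \<in> carrier_mat n 1" "ip r r = 0" using r by (auto simp: sphere_def)
  have "\<exists>i<n. r $$ (i, 0) \<noteq> 0"
  proof (rule ccontr)
    assume "\<not> ?thesis"
    then have "r = 0\<^sub>m n 1" using rc by (intro eq_matI) auto
    then show False using r0 by simp
  qed
  then obtain i where i: "i < n" "r $$ (i, 0) \<noteq> 0" by blast
  define x where "x = mat n 1 (\<lambda>(l, _). if l = i then 1 / cj (r $$ (i, 0)) else 0)"
  have xc: "x \<in> carrier_mat n 1" by (simp add: x_def)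
  have "ip r x = (\<Sum>l<n. if l = i then 1 else 0)"
    unfolding ip_sum[OF rc(1) xc] by (intro sum.cong refl) (use i in \<open>auto simp: x_def\<close>)
  then have rx: "ip r x = 1" using i by simp
  then have xr: "ip x r = 1" using cj_ip[OF rc(1) xc] by simp
  obtain s where s: "s + cj s = - ip x x" using ex_trace[of "- ip x x"] cj_ip[OF xc xc] by auto
  let ?f = "x + s \<cdot>\<^sub>m r"
  note ips = ip_add_left[of _ n] ip_add_right[of _ n] ip_smult_left[of _ n] ip_smult_right[of _ n]
  have "ip ?f ?f = ip x x + (s + cj s)" using rc xc rx xr by (simp add: ips)
  then have "?f \<in> sphere n 0" using s rc xc by (simp add: sphere_def)
  moreover have "ip r ?f = 1" using rc xc rx by (simp add: ips)
  ultimately show ?thesis using that by blast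
qed

subsection \<open>The big cell of an isotropic vector\<close>

text \<open>Isometries of the Hermitian form \<open>J\<close> mapping the first basis vector to \<open>k\<close> times the second: the first row and
  the remaining entries of the second row are forced by the free parameters \<open>z\<close>, \<open>w\<close>, \<open>C\<close>.\<close>

definition cell :: "nat \<Rightarrow> 'a \<Rightarrow> 'a \<Rightarrow> 'a mat \<Rightarrow> 'a mat \<Rightarrow> 'a mat" where
  "cell m k z w C = mat (Suc (Suc m)) (Suc (Suc m)) (\<lambda>(i, j).
     if i = 0 then if j = 1 then 1 / cj k else 0
     else if i = 1 then if j = 0 then k else if j = 1 then k * z
       else - k * (\<Sum>l<m. cj (w $$ (l, 0)) * C $$ (l, j - 2))
     else if j = 0 then 0 else if j = 1 then w $$ (i - 2, 0) else C $$ (i - 2, j - 2))"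

lemma cell_carrier [simp]: "cell m k z w C \<in> carrier_mat (Suc (Suc m)) (Suc (Suc m))"
  by (simp add: cell_def)

lemma dim_cell [simp]: "dim_row (cell m k z w C) = Suc (Suc m)" "dim_col (cell m k z w C) = Suc (Suc m)"
  by (simp_all add: cell_def)

lemma index_cell [simp]:
  "cell m k z w C $$ (0, 0) = 0" "cell m k z w C $$ (0, Suc 0) = 1 / cj k"
  "j < m \<Longrightarrow> cell m k z w C $$ (0, Suc (Suc j)) = 0"
  "cell m k z w C $$ (Suc 0, 0) = k" "cell m k z w C $$ (Suc 0, Suc 0) = k * z"
  "j < m \<Longrightarrow> cell m k z w C $$ (Suc 0, Suc (Suc j)) = - k * (\<Sum>l<m. cj (w $$ (l, 0)) * C $$ (l, j))"
  "i < m \<Longrightarrow> cell m k z w C $$ (Suc (Suc i), 0) = 0"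
  "i < m \<Longrightarrow> cell m k z w C $$ (Suc (Suc i), Suc 0) = w $$ (i, 0)"
  "i < m \<Longrightarrow> j < m \<Longrightarrow> cell m k z w C $$ (Suc (Suc i), Suc (Suc j)) = C $$ (i, j)"
  by (simp_all add: cell_def)

lemma U_columns:
  assumes C: "C \<in> carrier_mat m m"
  shows "C \<in> U m \<longleftrightarrow> (\<forall>i<m. \<forall>j<m. (\<Sum>l<m. cj (C $$ (l, i)) * C $$ (l, j)) = (if i = j then 1 else 0))"
proof -
  have e: "(adj C * C) $$ (i, j) = (\<Sum>l<m. cj (C $$ (l, i)) * C $$ (l, j))" if "i < m" "j < m" for i j
    by (subst index_mult_mat_sum[of _ m m _ m]) (use C that in \<open>auto intro!: sum.cong\<close>)
  have "adj C * C = 1\<^sub>m m \<longleftrightarrow> (\<forall>i<m. \<forall>j<m. (adj C * C) $$ (i, j) = (if i = j then 1 else 0))"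
    using C by (auto simp del: index_mult_mat(1) intro!: eq_matI)
  then show ?thesis using C e by (simp add: U_iff del: index_mult_mat(1))
qed

text \<open>The condition on \<open>z\<close> says that the second column is isotropic. The sums in
  the second row make that column orthogonal to the columns through \<open>C\<close>.\<close>

lemma cell_in_UJ:
  assumes k: "k \<noteq> 0" and w: "w \<in> carrier_mat m 1" and C: "C \<in> U m"
    and z: "z + cj z + ip w w = 0"
  shows "cell m k z w C \<in> UJ m"
proof -
  note Cc = U_carrier[OF C]
  have orth: "(\<Sum>l<m. cj (C $$ (l, i)) * C $$ (l, j)) = (if i = j then 1 else 0)" if "i < m" "j < m" for i j
    using C that unfolding U_columns[OF Cc] by blast
  have ww: "z + (cj z + (\<Sum>l<m. cj (w $$ (l, 0)) * w $$ (l, 0))) = 0"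
    using z unfolding ip_sum[OF w w] by (simp add: add.assoc)
  show ?thesis
    unfolding UJ_iff[OF cell_carrier]
  proof (intro allI impI)
    fix i j assume i: "i < Suc (Suc m)" and j: "j < Suc (Suc m)"
    show "hform m (cell m k z w C) i j = J m $$ (i, j)"
    proof (rule less_Suc_Suc_cases[OF i]; rule less_Suc_Suc_cases[OF j])
      fix l assume "l < m" "i = Suc (Suc l)" "j = Suc 0"
      then show ?thesis using k by (simp add: hform_def index_J mult.commute)
    next
      assume "i = Suc 0" "j = Suc 0"
      then show ?thesis using k ww by (simp add: hform_def index_J add.assoc)
    qed (use k orth in \<open>simp_all add: hform_def index_J\<close>)
  qed
qed

text \<open>Since the first column is \<open>k\<close> times the second basis vector, pairing it
  with the columns determines the first row. The remaining Gram equations give unitarity of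
  \<open>C\<close>, the condition on \<open>z\<close> and the second row.\<close>

lemma UJ_obtain_cell:
  assumes g: "g \<in> UJ m" and k: "k \<noteq> 0" and e: "g * e0 (Suc m) = k \<cdot>\<^sub>m e1 m"
  obtains z w C where "w \<in> carrier_mat m 1" "C \<in> U m" "z + cj z + ip w w = 0" "g = cell m k z w C"
proof -
  have gc: "g \<in> carrier_mat (Suc (Suc m)) (Suc (Suc m))" using g by (simp add: UJ_def)
  have f: "hform m g i j = J m $$ (i, j)" if "i < Suc (Suc m)" "j < Suc (Suc m)" for i j
    using g that unfolding UJ_iff[OF gc] by blast
  have col: "g $$ (i, 0) = k * e1 m $$ (i, 0)" if "i < Suc (Suc m)" for i
    using index_mult_e0[OF gc that] e that by (simp add: e1_def)
  have c2: "g $$ (Suc (Suc l), 0) = 0" if "l < m" for l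
    using col[of "Suc (Suc l)"] that by (simp add: e1_def e0_def)
  have c0: "g $$ (0, 0) = 0" and c1: "g $$ (Suc 0, 0) = k"
    using col[of 0] col[of "Suc 0"] by (simp_all add: e1_def e0_def)
  have row: "cj k * g $$ (0, j) = J m $$ (0, j)" if "j < Suc (Suc m)" for j
    using f[of 0 j] that c0 c1 c2 by (simp add: hform_def)
  have r1: "g $$ (0, Suc 0) = 1 / cj k" using row[of "Suc 0"] k by (simp add: index_J field_simps)
  have r2: "g $$ (0, Suc (Suc l)) = 0" if "l < m" for l
    using row[of "Suc (Suc l)"] that k by (simp add: index_J)
  define w where "w = mat m 1 (\<lambda>(i, _). g $$ (Suc (Suc i), Suc 0))"
  define C where "C = mat m m (\<lambda>(i, j). g $$ (Suc (Suc i), Suc (Suc j)))"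
  define z where "z = g $$ (Suc 0, Suc 0) / k"
  have wc: "w \<in> carrier_mat m 1" and Cc: "C \<in> carrier_mat m m" by (simp_all add: w_def C_def)
  have "(\<Sum>l<m. cj (C $$ (l, i)) * C $$ (l, j)) = (if i = j then 1 else 0)" if "i < m" "j < m" for i j
    using f[of "Suc (Suc i)" "Suc (Suc j)"] that r2 by (simp add: hform_def index_J C_def)
  then have C: "C \<in> U m" unfolding U_columns[OF Cc] by blast
  have ipw: "ip w w = (\<Sum>l<m. cj (g $$ (Suc (Suc l), Suc 0)) * g $$ (Suc (Suc l), Suc 0))"
    by (subst ip_sum[OF wc wc]) (simp add: w_def)
  have "cj (1 / cj k) * (k * z) + cj (k * z) * (1 / cj k) + ip w w = 0"
    using f[of "Suc 0" "Suc 0"] k by (simp add: hform_def index_J r1 z_def ipw)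
  then have z: "z + cj z + ip w w = 0" using k by simp
  have g1: "g $$ (Suc 0, Suc (Suc j)) = - k * (\<Sum>l<m. cj (w $$ (l, 0)) * C $$ (l, j))" if j: "j < m" for j
  proof -
    have "cj (1 / cj k) * g $$ (Suc 0, Suc (Suc j)) + (\<Sum>l<m. cj (w $$ (l, 0)) * C $$ (l, j)) = 0"
      using f[of "Suc 0" "Suc (Suc j)"] j r2 by (simp add: hform_def index_J r1 w_def C_def)
    then show ?thesis using k by (simp add: field_simps add_eq_0_iff)
  qed
  have "g = cell m k z w C"
  proof (rule eq_matI)
    fix i j assume "i < dim_row (cell m k z w C)" "j < dim_col (cell m k z w C)"
    then have i: "i < Suc (Suc m)" and j: "j < Suc (Suc m)" by simp_all
    show "g $$ (i, j) = cell m k z w C $$ (i, j)"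
      by (rule less_Suc_Suc_cases[OF i]; rule less_Suc_Suc_cases[OF j])
        (simp_all add: c0 c1 c2 r1 r2 g1 k z_def w_def C_def)
  qed (use gc in simp_all)
  then show ?thesis using that wc C z by blast
qed

lemma cell_inject:
  assumes "w \<in> carrier_mat m 1" "w' \<in> carrier_mat m 1" "C \<in> carrier_mat m m" "C' \<in> carrier_mat m m"
    and k: "k \<noteq> 0" and eq: "cell m k z w C = cell m k z' w' C'"
  shows "z = z' \<and> w = w' \<and> C = C'"
proof (intro conjI)
  have e: "cell m k z w C $$ (i, j) = cell m k z' w' C' $$ (i, j)" for i j by (simp only: eq)
  show "z = z'" using e[of "Suc 0" "Suc 0"] k by simp
  show "w = w'"
  proof (rule eq_matI)
    fix i j assume "i < dim_row w'" "j < dim_col w'"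
    then show "w $$ (i, j) = w' $$ (i, j)" using assms(1,2) e[of "Suc (Suc i)" "Suc 0"] by simp
  qed (use assms in auto)
  show "C = C'"
  proof (rule eq_matI)
    fix i j assume "i < dim_row C'" "j < dim_col C'"
    then show "C $$ (i, j) = C' $$ (i, j)" using assms(3,4) e[of "Suc (Suc i)" "Suc (Suc j)"] by simp
  qed (use assms in auto)
qed

lemma cell_e0: "k \<noteq> 0 \<Longrightarrow> cell m k z w C * e0 (Suc m) = k \<cdot>\<^sub>m e1 m"
proof (rule eq_matI)
  fix i j assume "i < dim_row (k \<cdot>\<^sub>m e1 m)" "j < dim_col (k \<cdot>\<^sub>m e1 m)"
  then have i: "i < Suc (Suc m)" and j: "j = 0" by (simp_all add: e1_def)
  have "cell m k z w C $$ (i, 0) = (k \<cdot>\<^sub>m e1 m) $$ (i, 0)"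
    by (rule less_Suc_Suc_cases[OF i]) (simp_all add: e1_def e0_def)
  then show "(cell m k z w C * e0 (Suc m)) $$ (i, j) = (k \<cdot>\<^sub>m e1 m) $$ (i, j)"
    unfolding j by (simp only: index_mult_e0[OF cell_carrier i])
qed (simp_all add: e1_def)

text \<open>The first row has the single nonzero entry \<open>1 / cj k\<close>, in the second
  column, which accounts for the sign. The complementary minor is block upper triangular.\<close>

lemma det_cell:
  assumes C: "C \<in> carrier_mat m m"
  shows "det (cell m k z w C) = (- k / cj k) * det C"
proof -
  let ?g = "cell m k z w C" and ?r = "mat 1 m (\<lambda>(_, j). - k * (\<Sum>l<m. cj (w $$ (l, 0)) * C $$ (l, j)))"
  have del: "mat_delete ?g 0 (Suc 0) = four_block_mat (k \<cdot>\<^sub>m 1\<^sub>m 1) ?r (0\<^sub>m m 1) C"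
  proof (rule eq_matI)
    fix i j assume "i < dim_row (four_block_mat (k \<cdot>\<^sub>m 1\<^sub>m 1) ?r (0\<^sub>m m 1) C)"
      "j < dim_col (four_block_mat (k \<cdot>\<^sub>m 1\<^sub>m 1) ?r (0\<^sub>m m 1) C)"
    then have "i < Suc m" "j < Suc m" using C by auto
    then show "mat_delete ?g 0 (Suc 0) $$ (i, j) = four_block_mat (k \<cdot>\<^sub>m 1\<^sub>m 1) ?r (0\<^sub>m m 1) C $$ (i, j)"
      using C by (cases i; cases j) (simp_all add: mat_delete_def)
  qed (use C in \<open>simp_all add: mat_delete_def\<close>)
  have "det ?g = (\<Sum>j<Suc (Suc m). ?g $$ (0, j) * cofactor ?g 0 j)"
    by (rule laplace_expansion_row[OF cell_carrier]) simp
  also have "\<dots> = 1 / cj k * cofactor ?g 0 (Suc 0)"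
    by (simp add: sum_lessThan_Suc_Suc del: sum.lessThan_Suc)
  also have "cofactor ?g 0 (Suc 0) = - det (four_block_mat (k \<cdot>\<^sub>m 1\<^sub>m 1) ?r (0\<^sub>m m 1) C)"
    unfolding cofactor_def del by simp
  also have "det (four_block_mat (k \<cdot>\<^sub>m 1\<^sub>m 1) ?r (0\<^sub>m m 1) C) = k * det C"
    using C by (subst det_four_block_mat_lower_left_zero[of _ 1 _ m]) auto
  finally show ?thesis by simp
qed

lemma weight_cell:
  assumes C: "C \<in> carrier_mat m m"
  shows "weight (cell m k z w C) = \<chi> (- k / cj k) * \<psi> (k * z) * weight C"
proof -
  have "mat_trace (cell m k z w C) = k * z + mat_trace C"
    using C by (simp add: mat_trace_def sum_lessThan_Suc_Suc del: sum.lessThan_Suc)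
  then show ?thesis by (simp only: weight_def det_cell[OF C] chi_mult psi_add mult_ac)
qed

section \<open>The Gaussian sum over the cell\<close>

text \<open>After interchanging the sums, the admissible \<open>w\<close> for a given
  \<open>z\<close> form a sphere whose size is known.\<close>

lemma sum_isotropic:
  "(\<Sum>w\<in>carrier_mat m 1. \<Sum>z\<in>{z. z + cj z + ip w w = 0}. F z) =
     (\<Sum>z\<in>UNIV. F z * of_nat (card (sphere m (- (z + cj z)))))" for F :: "'a \<Rightarrow> complex"
proof -
  have "(\<Sum>w\<in>carrier_mat m 1. \<Sum>z\<in>{z. z + cj z + ip w w = 0}. F z) =
      (\<Sum>w\<in>carrier_mat m 1. \<Sum>z\<in>UNIV. if z + cj z + ip w w = 0 then F z else 0)"
    by (rule sum.cong[OF refl]) (simp add: sum.If_cases)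
  also have "\<dots> = (\<Sum>z\<in>UNIV. \<Sum>w\<in>carrier_mat m 1. if z + cj z + ip w w = 0 then F z else 0)"
    by (rule sum.swap)
  also have "\<dots> = (\<Sum>z\<in>UNIV. F z * of_nat (card (sphere m (- (z + cj z)))))"
  proof (rule sum.cong[OF refl])
    fix z
    have "(\<Sum>w\<in>carrier_mat m 1. if z + cj z + ip w w = 0 then F z else 0) =
        (\<Sum>w\<in>{w\<in>carrier_mat m 1. z + cj z + ip w w = 0}. F z)"
      by (rule sum.inter_filter[symmetric]) simp
    also have "{w\<in>carrier_mat m 1. z + cj z + ip w w = 0} = sphere m (- (z + cj z))"
      unfolding sphere_def by (simp only: add_eq_0_iff)
    finally show "(\<Sum>w\<in>carrier_mat m 1. if z + cj z + ip w w = 0 then F z else 0) =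
        F z * of_nat (card (sphere m (- (z + cj z))))" by (simp add: mult.commute)
  qed
  finally show ?thesis .
qed

lemma card_sphere_trace:
  "(of_nat q * of_nat (card (sphere m (- (z + cj z)))) :: complex) =
    (of_nat q ^ (2 * m) - (- of_nat q) ^ m) + (if z + cj z = 0 then (- of_nat q) ^ m * of_nat q else 0)"
proof -
  have "cj (- (z + cj z)) = - (z + cj z)" by simp
  moreover have "- (z + cj z) = 0 \<longleftrightarrow> z + cj z = 0" by (rule neg_equal_0_iff_equal)
  ultimately show ?thesis by (simp only: card_sphere) (simp add: algebra_simps)
qed

text \<open>The sphere sizes take one value for trace zero and another otherwise. The constant part
  is killed by the full character sum because \<open>k\<close> is nonzero, and the excess at trace
  zero is evaluated by \<open>sum_psi_trace_zero\<close>.\<close>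

lemma sum_psi_isotropic:
  assumes k: "k \<noteq> 0"
  shows "(\<Sum>w\<in>carrier_mat m 1. \<Sum>z\<in>{z. z + cj z + ip w w = 0}. \<psi> (k * z)) =
    (- of_nat q) ^ m * (if - k / cj k = \<alpha> then of_nat q else 0)"
proof -
  have q0: "(of_nat q :: complex) \<noteq> 0" using q_pos by simp
  have "of_nat q * (\<Sum>z\<in>UNIV. \<psi> (k * z) * of_nat (card (sphere m (- (z + cj z))))) =
      (\<Sum>z\<in>UNIV. \<psi> (k * z) * (of_nat q * of_nat (card (sphere m (- (z + cj z))))))"
    by (simp add: sum_distrib_left mult_ac)
  also have "\<dots> = (\<Sum>z\<in>UNIV. (of_nat q ^ (2 * m) - (- of_nat q) ^ m) * \<psi> (k * z) +
      (- of_nat q) ^ m * of_nat q * (if z + cj z = 0 then \<psi> (k * z) else 0))"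
    unfolding card_sphere_trace by (intro sum.cong refl) (simp add: algebra_simps)
  also have "\<dots> = (of_nat q ^ (2 * m) - (- of_nat q) ^ m) * (\<Sum>z\<in>UNIV. \<psi> (k * z)) +
      (- of_nat q) ^ m * of_nat q * (\<Sum>z\<in>UNIV. if z + cj z = 0 then \<psi> (k * z) else 0)"
    by (simp only: sum.distrib sum_distrib_left)
  also have "(\<Sum>z\<in>UNIV. if z + cj z = 0 then \<psi> (k * z) else 0) = (\<Sum>z\<in>{z. z + cj z = 0}. \<psi> (k * z))"
    by (simp add: sum.inter_filter[symmetric])
  also have "(\<Sum>z\<in>UNIV. \<psi> (k * z)) = 0" using k by (simp add: sum_psi)
  finally have "of_nat q * (\<Sum>z\<in>UNIV. \<psi> (k * z) * of_nat (card (sphere m (- (z + cj z))))) =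
      of_nat q * ((- of_nat q) ^ m * (if - k / cj k = \<alpha> then of_nat q else 0))"
    unfolding sum_psi_trace_zero[OF k] by (simp add: mult_ac)
  then show ?thesis unfolding sum_isotropic using q0 by (simp only: mult_cancel_left) blast
qed

text \<open>The same count without the character: the two contributions of (-q)^m cancel, as q
  elements have trace zero.\<close>

lemma card_isotropic_pairs:
  "of_nat (card (SIGMA w:carrier_mat m 1. {z. z + cj z + ip w w = 0})) = (of_nat q ^ Suc (2 * m) :: complex)"
proof -
  have q0: "(of_nat q :: complex) \<noteq> 0" using q_pos by simp
  have "of_nat (card (SIGMA w:carrier_mat m 1. {z. z + cj z + ip w w = 0})) =
      (\<Sum>w\<in>carrier_mat m 1. \<Sum>z\<in>{z. z + cj z + ip w w = 0}. 1 :: complex)"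
    by (simp add: card_SigmaI)
  also have "\<dots> = (\<Sum>z\<in>UNIV. of_nat (card (sphere m (- (z + cj z)))))"
    unfolding sum_isotropic by simp
  finally have "of_nat q * of_nat (card (SIGMA w:carrier_mat m 1. {z. z + cj z + ip w w = 0})) =
      (\<Sum>z\<in>UNIV. (of_nat q * of_nat (card (sphere m (- (z + cj z)))) :: complex))"
    by (simp add: sum_distrib_left)
  also have "\<dots> = of_nat q ^ 2 * (of_nat q ^ (2 * m) - (- of_nat q) ^ m) +
      (\<Sum>z\<in>{z. z + cj z = 0}. (- of_nat q) ^ m * of_nat q)"
    unfolding card_sphere_trace by (simp add: sum.distrib card_field sum.inter_filter[symmetric])
  also have "(\<Sum>z\<in>{z. z + cj z = 0}. (- of_nat q) ^ m * of_nat q) = of_nat q * ((- of_nat q) ^ m * of_nat q)"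
    using card_trace_fiber[of 0] by simp
  finally have "of_nat q * of_nat (card (SIGMA w:carrier_mat m 1. {z. z + cj z + ip w w = 0})) =
      (of_nat q * of_nat q ^ Suc (2 * m) :: complex)"
    by (simp add: algebra_simps power2_eq_square)
  then show ?thesis using q0 by simp
qed

definition cell_sum :: "nat \<Rightarrow> 'a \<Rightarrow> complex" where
  "cell_sum m k = (\<Sum>g\<in>{g\<in>UJ m. g * e0 (Suc m) = k \<cdot>\<^sub>m e1 m}. weight g)"

text \<open>On the cell the weight factors: \<open>C\<close> contributes \<open>usum m\<close>, the
  pair \<open>(w, z)\<close> the Gaussian sum. All \<open>k\<close> that survive give the same
  value, since \<open>\<chi>\<close> is evaluated at \<open>- k / cj k = \<alpha>\<close>.\<close>

lemma cell_sum_eq: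
  assumes k: "k \<noteq> 0"
  shows "cell_sum m k = (if - k / cj k = \<alpha> then \<chi> \<alpha> * usum m * (- of_nat q) ^ m * of_nat q else 0)"
proof -
  let ?D = "SIGMA w:carrier_mat m 1. {z. z + cj z + ip w w = 0} \<times> U m"
  have "bij_betw (\<lambda>(w, z, C). cell m k z w C) ?D {g\<in>UJ m. g * e0 (Suc m) = k \<cdot>\<^sub>m e1 m}"
    unfolding bij_betw_def
  proof
    show "inj_on (\<lambda>(w, z, C). cell m k z w C) ?D"
    proof (rule inj_onI, clarsimp)
      fix w z C w' z' C'
      assume "w \<in> carrier_mat m (Suc 0)" "w' \<in> carrier_mat m (Suc 0)" "C \<in> U m" "C' \<in> U m"
        "cell m k z w C = cell m k z' w' C'"
      then show "w = w' \<and> z = z' \<and> C = C'"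
        using cell_inject[of w m w' C C' k z z'] k U_carrier by auto
    qed
    show "(\<lambda>(w, z, C). cell m k z w C) ` ?D = {g\<in>UJ m. g * e0 (Suc m) = k \<cdot>\<^sub>m e1 m}"
    proof (intro equalityI subsetI)
      fix g assume "g \<in> {g\<in>UJ m. g * e0 (Suc m) = k \<cdot>\<^sub>m e1 m}"
      then obtain z w C where "w \<in> carrier_mat m 1" "C \<in> U m" "z + cj z + ip w w = 0" "g = cell m k z w C"
        using UJ_obtain_cell[of g m k] k by blast
      then show "g \<in> (\<lambda>(w, z, C). cell m k z w C) ` ?D"
        by (intro image_eqI[of _ _ "(w, z, C)"]) auto
    qed (use k cell_in_UJ cell_e0 in auto)
  qed
  then have "cell_sum m k = (\<Sum>(w, z, C)\<in>?D. weight (cell m k z w C))"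
    unfolding cell_sum_def by (subst sum.reindex_bij_betw[symmetric]) (auto simp: case_prod_unfold)
  also have "\<dots> = (\<Sum>w\<in>carrier_mat m 1. \<Sum>z\<in>{z. z + cj z + ip w w = 0}. \<Sum>C\<in>U m. weight (cell m k z w C))"
    by (subst sum.Sigma[symmetric]) (auto simp: sum.cartesian_product[symmetric])
  also have "\<dots> = (\<Sum>w\<in>carrier_mat m 1. \<Sum>z\<in>{z. z + cj z + ip w w = 0}. \<chi> (- k / cj k) * usum m * \<psi> (k * z))"
    by (intro sum.cong refl) (simp add: weight_cell[OF U_carrier] usum_def sum_distrib_right[symmetric] mult_ac)
  also have "\<dots> = \<chi> (- k / cj k) * usum m *
      (\<Sum>w\<in>carrier_mat m 1. \<Sum>z\<in>{z. z + cj z + ip w w = 0}. \<psi> (k * z))"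
    by (simp add: sum_distrib_left)
  finally show ?thesis unfolding sum_psi_isotropic[OF k] by auto
qed

subsection \<open>Sums at an isotropic vector\<close>

lemma frame_inverse:
  assumes P: "P \<in> carrier_mat (Suc (Suc m)) (Suc (Suc m))" and PP: "adj P * P = J m"
  defines "R \<equiv> J m * adj P"
  shows "R \<in> carrier_mat (Suc (Suc m)) (Suc (Suc m))" "R * P = 1\<^sub>m (Suc (Suc m))" "P * R = 1\<^sub>m (Suc (Suc m))"
    "adj R = P * J m"
proof -
  have aP: "adj P \<in> carrier_mat (Suc (Suc m)) (Suc (Suc m))" using P by simp
  show R: "R \<in> carrier_mat (Suc (Suc m)) (Suc (Suc m))" unfolding R_def by (rule mult_carrier_mat[OF J_carrier aP])
  show RP: "R * P = 1\<^sub>m (Suc (Suc m))"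
    unfolding R_def assoc_mult_mat[OF J_carrier aP P] PP by (rule J_J)
  show "P * R = 1\<^sub>m (Suc (Suc m))" by (rule mat_mult_left_right_inverse[OF R P RP])
  show "adj R = P * J m" unfolding R_def adj_mult[OF J_carrier aP] by (simp add: adj_J)
qed

text \<open>In a frame whose hyperbolic pair is \<open>r\<close> and \<open>y / k\<close>, the
  condition \<open>g * r = y\<close> says that the first basis vector goes to \<open>k\<close> times
  the second. The change of frame is a conjugation, so the weight is preserved although the frame
  itself is not unitary.\<close>

lemma sum_weight_isotropic_column:
  assumes r: "r \<in> sphere (Suc (Suc m)) 0" and y: "y \<in> sphere (Suc (Suc m)) 0"
    and ry: "ip r y = k" and k: "k \<noteq> 0"
  shows "(\<Sum>g\<in>{g\<in>U (Suc (Suc m)). g * r = y}. weight g) = cell_sum m k"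
proof -
  let ?M = "Suc (Suc m)"
  have rc: "r \<in> carrier_mat ?M 1" and yc: "y \<in> carrier_mat ?M 1" "ip y y = 0"
    using r y by (auto simp: sphere_def)
  have "(1 / k) \<cdot>\<^sub>m y \<in> sphere ?M 0" "ip r ((1 / k) \<cdot>\<^sub>m y) = 1"
    using rc yc ry k by (auto simp: sphere_def ip_smult_left[of _ ?M] ip_smult_right[of _ ?M])
  then obtain P where P: "P \<in> carrier_mat ?M ?M" "adj P * P = J m" "P * e0 (Suc m) = r"
      "P * e1 m = (1 / k) \<cdot>\<^sub>m y"
    using hyperbolic_frame[OF r] by metis
  define R where "R = J m * adj P"
  note R = frame_inverse[OF P(1,2), folded R_def]
  have Pk: "P * (k \<cdot>\<^sub>m e1 m) = y"
    unfolding mult_smult_distrib[OF P(1) e1_carrier] P(4) using yc k by (intro eq_matI) auto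
  note assoc = assoc_mult_mat[of _ ?M ?M _ ?M _ ?M] assoc_mult_mat[of _ ?M ?M _ ?M _ 1]
  have cancel: "R * (P * B) = B" "P * (R * B) = B" "J m * (J m * B) = B" "adj P * (P * B) = J m * B"
    "adj R * (J m * (R * B)) = B"
    if B: "B \<in> carrier_mat ?M n" for B n
  proof -
    show RPB: "R * (P * B) = B" and PRB: "P * (R * B) = B" and JJB: "J m * (J m * B) = B"
        and "adj P * (P * B) = J m * B"
      using B P(1) R by (simp_all add: assoc_mult_mat[symmetric, of _ ?M ?M _ ?M _ n] J_J P(2))
    have JRB: "J m * (R * B) \<in> carrier_mat ?M n" and RB: "R * B \<in> carrier_mat ?M n"
      using B R(1) J_carrier by (auto intro: mult_carrier_mat)
    show "adj R * (J m * (R * B)) = B"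
      unfolding R(4) assoc_mult_mat[OF P(1) J_carrier JRB]
      using B R(1) PRB by (metis assoc_mult_mat J_carrier J_J RB left_mult_one_mat)
  qed
  show ?thesis unfolding cell_sum_def
  proof (rule sum.reindex_bij_witness[of _ "\<lambda>g. P * g * R" "\<lambda>g. R * g * P"])
    fix g assume "g \<in> {g\<in>U ?M. g * r = y}"
    then have g: "g \<in> U ?M" "g * r = y" by auto
    note gc = U_carrier[OF g(1)]
    show "P * (R * g * P) * R = g" using gc P(1) R by (simp add: assoc cancel[of _ ?M])
    have "R * g * P \<in> UJ m"
    proof -
      have "adj (R * g * P) * (J m * (R * g * P)) = adj P * (adj g * (adj R * (J m * (R * (g * P)))))"
        using gc P(1) R(1) J_carrier[of m] by (simp add: assoc adj_mult[of _ ?M ?M _ ?M] del: J_carrier)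
      also have "\<dots> = adj P * (adj g * (g * P))" using cancel(5)[of "g * P" ?M] gc P(1) by simp
      also have "\<dots> = J m" using U_cancel(1)[OF g(1) P(1)] P(2) by simp
      finally show ?thesis using gc P(1) R(1) by (simp add: UJ_def)
    qed
    moreover have "R * g * P * e0 (Suc m) = R * (g * (P * e0 (Suc m)))"
      using gc P(1) R(1) by (simp add: assoc)
    then have "R * g * P * e0 (Suc m) = k \<cdot>\<^sub>m e1 m"
      unfolding P(3) g(2) Pk[symmetric] by (simp only: cancel(1)[OF smult_carrier_mat[OF e1_carrier]])
    ultimately show "R * g * P \<in> {g\<in>UJ m. g * e0 (Suc m) = k \<cdot>\<^sub>m e1 m}" by simp
    show "weight (R * g * P) = weight g" by (rule weight_conj[OF P(1) R(1) gc R(2)])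
  next
    fix g assume "g \<in> {g\<in>UJ m. g * e0 (Suc m) = k \<cdot>\<^sub>m e1 m}"
    then have g: "adj g * (J m * g) = J m" "g * e0 (Suc m) = k \<cdot>\<^sub>m e1 m" and gc: "g \<in> carrier_mat ?M ?M"
      by (auto simp: UJ_def)
    show "R * (P * g * R) * P = g" using gc P(1) R by (simp add: assoc cancel[of _ ?M])
    have "P * g * R \<in> U ?M"
    proof -
      have "adj (P * g * R) * (P * g * R) = adj R * (adj g * (adj P * (P * (g * R))))"
        using gc P(1) R(1) J_carrier[of m] by (simp add: assoc adj_mult[of _ ?M ?M _ ?M] del: J_carrier)
      also have "\<dots> = adj R * (adj g * (J m * g) * R)"
        using cancel(4)[of "g * R" ?M] gc R(1) J_carrier[of m] by (simp add: assoc del: J_carrier)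
      also have "\<dots> = 1\<^sub>m ?M" unfolding g(1) using cancel(5)[of "1\<^sub>m ?M" ?M] R(1) by simp
      finally show ?thesis using gc P(1) R(1) by (simp add: U_iff)
    qed
    moreover have "P * g * R * r = P * (g * (R * (P * e0 (Suc m))))"
      unfolding P(3)[symmetric] using gc P(1) R(1) by (simp add: assoc)
    then have "P * g * R * r = y" using cancel(1)[OF e0_carrier] g(2) Pk by simp
    ultimately show "P * g * R \<in> {g\<in>U ?M. g * r = y}" by simp
  qed
qed

lemma J_mult_vcons:
  assumes w: "w \<in> carrier_mat m 1"
  shows "J m * vcons a (vcons b w) = vcons b (vcons a w)"
proof (rule eq_matI)
  have vc: "vcons a (vcons b w) \<in> carrier_mat (Suc (Suc m)) 1" using w by (intro vcons_carrier)
  fix i j assume "i < dim_row (vcons b (vcons a w))" "j < dim_col (vcons b (vcons a w))"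
  then have i: "i < Suc (Suc m)" and j: "j = 0" using w by auto
  show "(J m * vcons a (vcons b w)) $$ (i, j) = vcons b (vcons a w) $$ (i, j)"
    unfolding j
    by (rule less_Suc_Suc_cases[OF i])
      (use w in \<open>simp_all add: index_J_mult[OF vc] del: index_mult_mat(1)\<close>)
qed (use w in simp_all)

text \<open>In a frame starting with \<open>r\<close>, a vector with coordinates
  \<open>(a, b, w)\<close> pairs with \<open>r\<close> to \<open>b\<close> and has norm
  \<open>cj a * b + cj b * a + ip w w\<close>. For \<open>b = k\<close> and
  \<open>z = cj k * a\<close> isotropy becomes the equation counted in
  \<open>card_isotropic_pairs\<close>.\<close>

lemma card_isotropic_ip:
  assumes r: "r \<in> sphere (Suc (Suc m)) 0" and r0: "r \<noteq> 0\<^sub>m (Suc (Suc m)) 1" and k: "k \<noteq> 0"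
  shows "of_nat (card {y\<in>sphere (Suc (Suc m)) 0. ip r y = k}) = (of_nat q ^ Suc (2 * m) :: complex)"
proof -
  let ?M = "Suc (Suc m)"
  obtain f where "f \<in> sphere ?M 0" "ip r f = 1" using hyperbolic_partner[OF r r0] by blast
  then obtain P where P: "P \<in> carrier_mat ?M ?M" "adj P * P = J m" "P * e0 (Suc m) = r"
    using hyperbolic_frame[OF r] by metis
  define R where "R = J m * adj P"
  note R = frame_inverse[OF P(1,2), folded R_def]
  have form: "ip (P * x) (P * x') = ip x (J m * x')" if "x \<in> carrier_mat ?M 1" "x' \<in> carrier_mat ?M 1" for x x'
  proof -
    have "ip (P * x) (P * x') = ip x (adj P * (P * x'))"
      using that P(1) by (intro ip_adj[of _ ?M ?M]) auto
    also have "adj P * (P * x') = J m * x'"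
      using that P(1) by (simp add: assoc_mult_mat[symmetric, of _ ?M ?M _ ?M _ 1] P(2))
    finally show ?thesis .
  qed
  let ?x = "\<lambda>z w. vcons (z / cj k) (vcons k w)"
  have xc: "vcons a (vcons b w) \<in> carrier_mat ?M 1" if "w \<in> carrier_mat m 1" for a b w
    using that by (intro vcons_carrier)
  have val: "ip (P * vcons a (vcons b w)) (P * vcons a (vcons b w)) = cj a * b + (cj b * a + ip w w)"
    "ip r (P * vcons a (vcons b w)) = b" if w: "w \<in> carrier_mat m 1" for a b w
  proof -
    have c: "vcons b w \<in> carrier_mat (Suc m) 1" for b using w by (rule vcons_carrier)
    show "ip (P * vcons a (vcons b w)) (P * vcons a (vcons b w)) = cj a * b + (cj b * a + ip w w)"
      unfolding form[OF xc[OF w] xc[OF w]] J_mult_vcons[OF w] ip_vcons[OF c c] ip_vcons[OF w w] ..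
    show "ip r (P * vcons a (vcons b w)) = b"
      unfolding P(3)[symmetric] form[OF e0_carrier xc[OF w]] J_mult_vcons[OF w] ip_e0[OF xc[OF w]] by simp
  qed
  have can: "R * (P * x) = x" "P * (R * x) = x" if "x \<in> carrier_mat ?M 1" for x
    using that P(1) R by (simp_all add: assoc_mult_mat[symmetric, of _ ?M ?M _ ?M _ 1])
  let ?D = "SIGMA w:carrier_mat m 1. {z. z + cj z + ip w w = 0}"
  have "bij_betw (\<lambda>(w, z). P * ?x z w) ?D {y\<in>sphere ?M 0. ip r y = k}"
    unfolding bij_betw_def
  proof
    show "inj_on (\<lambda>(w, z). P * ?x z w) ?D"
    proof (rule inj_onI, clarsimp)
      fix w z w' z'
      assume "w \<in> carrier_mat m (Suc 0)" "w' \<in> carrier_mat m (Suc 0)" and eq: "P * ?x z w = P * ?x z' w'"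
      then have w: "w \<in> carrier_mat m 1" "w' \<in> carrier_mat m 1" by simp_all
      have "?x z w = ?x z' w'" using can(1)[OF xc[OF w(1)]] can(1)[OF xc[OF w(2)]] eq by metis
      then show "w = w' \<and> z = z'"
        using k vcons_eq_iff[OF vcons_carrier[OF w(1)] vcons_carrier[OF w(2)]] vcons_eq_iff[OF w] by simp
    qed
    show "(\<lambda>(w, z). P * ?x z w) ` ?D = {y\<in>sphere ?M 0. ip r y = k}"
    proof (intro equalityI subsetI)
      fix y assume "y \<in> (\<lambda>(w, z). P * ?x z w) ` ?D"
      then obtain w z where w: "w \<in> carrier_mat m 1" and z: "z + cj z + ip w w = 0" and y: "y = P * ?x z w"
        by auto
      have "ip y y = 0" unfolding y val(1)[OF w] using k z by (simp add: add_ac)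
      moreover have "y \<in> carrier_mat ?M 1" unfolding y by (rule mult_carrier_mat[OF P(1) xc[OF w]])
      ultimately show "y \<in> {y\<in>sphere ?M 0. ip r y = k}" using val(2)[OF w] by (simp add: sphere_def y)
    next
      fix y assume "y \<in> {y\<in>sphere ?M 0. ip r y = k}"
      then have y: "y \<in> carrier_mat ?M 1" "ip y y = 0" "ip r y = k" by (auto simp: sphere_def)
      define x where "x = R * y"
      have x: "x \<in> carrier_mat (Suc (Suc m)) 1" unfolding x_def by (rule mult_carrier_mat[OF R(1) y(1)])
      define a where "a = x $$ (0, 0)"
      define b where "b = vtl x $$ (0, 0)"
      define w where "w = vtl (vtl x)"
      have v: "vtl x \<in> carrier_mat (Suc m) 1" by (rule vtl_carrier[OF x])
      have w: "w \<in> carrier_mat m 1" unfolding w_def by (rule vtl_carrier[OF v])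
      have "x = vcons a (vcons b w)"
        unfolding a_def b_def w_def vcons_vtl[OF v] by (rule vcons_vtl[OF x, symmetric])
      then have yx: "y = P * vcons a (vcons b w)" using can(2)[OF y(1)] by (simp add: x_def)
      have b: "b = k" using y(3) unfolding yx val(2)[OF w] .
      have "cj a * k + (cj k * a + ip w w) = 0" using y(2) unfolding yx val(1)[OF w] b .
      then have "(cj k * a) + cj (cj k * a) + ip w w = 0" by (simp add: algebra_simps)
      moreover have "a = (cj k * a) / cj k" using k by simp
      ultimately show "y \<in> (\<lambda>(w, z). P * ?x z w) ` ?D"
        using yx b w by (intro image_eqI[of _ _ "(w, cj k * a)"]) auto
    qed
  qed
  then have "card ?D = card {y\<in>sphere ?M 0. ip r y = k}" by (rule bij_betw_same_card)
  then show ?thesis using card_isotropic_pairs[of m] by (simp only:)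
qed

text \<open>The difference from \<open>usum\<close> has the factor \<open>1 - \<psi> (s * k)\<close>
  on the matrices with \<open>ip r (g * r) = k\<close>, so \<open>k = 0\<close> drops out and every
  other fiber consists of cells. Each relevant \<open>k\<close> offers q^(2m+1) vectors
  \<open>g * r\<close> with equal cell sums, and \<open>sum_psi_dual_line\<close> adds the factors
  to q. The value does not depend on \<open>r\<close>, as \<open>corner_sum_eq\<close>
  demands.\<close>

lemma sum_weight_isotropic:
  assumes r: "r \<in> sphere (Suc (Suc m)) 0" and r0: "r \<noteq> 0\<^sub>m (Suc (Suc m)) 1" and s: "s + cj s = -1"
  shows "(\<Sum>g\<in>U (Suc (Suc m)). weight g * \<psi> (s * ip r (g * r))) =
    usum (Suc (Suc m)) - of_nat q ^ (2 * m + 3) * (- of_nat q) ^ m * \<chi> \<alpha> * usum m"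
proof -
  let ?M = "Suc (Suc m)"
  let ?c = "of_nat q ^ Suc (2 * m) * (\<chi> \<alpha> * usum m * (- of_nat q) ^ m * of_nat q)"
  have rc: "r \<in> carrier_mat ?M 1" "ip r r = 0" using r by (auto simp: sphere_def)
  have fiber: "(\<Sum>g\<in>{g\<in>U ?M. ip r (g * r) = k}. weight g) = (if - k / cj k = \<alpha> then ?c else 0)" if k: "k \<noteq> 0" for k
  proof -
    have "(\<Sum>g\<in>{g\<in>U ?M. ip r (g * r) = k}. weight g) =
        (\<Sum>y\<in>{y\<in>sphere ?M 0. ip r y = k}. \<Sum>g\<in>{g\<in>{g\<in>U ?M. ip r (g * r) = k}. g * r = y}. weight g)"
    proof (rule sum.group[symmetric])
      show "(\<lambda>g. g * r) ` {g\<in>U ?M. ip r (g * r) = k} \<subseteq> {y\<in>sphere ?M 0. ip r y = k}"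
        using rc U_carrier by (auto simp: sphere_def ip_U intro!: mult_carrier_mat[of _ _ ?M])
    qed auto
    also have "\<dots> = (\<Sum>y\<in>{y\<in>sphere ?M 0. ip r y = k}. cell_sum m k)"
    proof (rule sum.cong[OF refl])
      fix y assume y: "y \<in> {y\<in>sphere ?M 0. ip r y = k}"
      then have "{g\<in>{g\<in>U ?M. ip r (g * r) = k}. g * r = y} = {g\<in>U ?M. g * r = y}" by auto
      then show "(\<Sum>g\<in>{g\<in>{g\<in>U ?M. ip r (g * r) = k}. g * r = y}. weight g) = cell_sum m k"
        using sum_weight_isotropic_column[OF r, of y k] y k by simp
    qed
    also have "\<dots> = of_nat q ^ Suc (2 * m) * cell_sum m k" by (simp add: card_isotropic_ip[OF r r0 k] del: power_Suc)
    finally show ?thesis unfolding cell_sum_eq[OF k] by (simp del: power_Suc)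
  qed
  have "usum ?M - (\<Sum>g\<in>U ?M. weight g * \<psi> (s * ip r (g * r))) = (\<Sum>g\<in>U ?M. (1 - \<psi> (s * ip r (g * r))) * weight g)"
    unfolding usum_def sum_subtractf[symmetric] by (intro sum.cong refl) (simp add: algebra_simps)
  also have "\<dots> = (\<Sum>k\<in>UNIV. \<Sum>g\<in>{g\<in>U ?M. ip r (g * r) = k}. (1 - \<psi> (s * ip r (g * r))) * weight g)"
    by (rule sum.group[symmetric]) auto
  also have "\<dots> = (\<Sum>k\<in>UNIV. if k \<noteq> 0 \<and> - k / cj k = \<alpha> then (1 - \<psi> (s * k)) * ?c else 0)"
  proof (rule sum.cong[OF refl])
    fix k :: 'a
    have "(\<Sum>g\<in>{g\<in>U ?M. ip r (g * r) = k}. (1 - \<psi> (s * ip r (g * r))) * weight g) =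
        (1 - \<psi> (s * k)) * (\<Sum>g\<in>{g\<in>U ?M. ip r (g * r) = k}. weight g)"
      by (simp add: sum_distrib_left)
    then show "(\<Sum>g\<in>{g\<in>U ?M. ip r (g * r) = k}. (1 - \<psi> (s * ip r (g * r))) * weight g) =
        (if k \<noteq> 0 \<and> - k / cj k = \<alpha> then (1 - \<psi> (s * k)) * ?c else 0)"
      using fiber[of k] by (cases "k = 0") simp_all
  qed
  also have "\<dots> = (\<Sum>k\<in>{k. k \<noteq> 0 \<and> - k / cj k = \<alpha>}. 1 - \<psi> (s * k)) * ?c"
    unfolding sum_distrib_right by (simp add: sum.If_cases)
  also have "\<dots> = of_nat q ^ (2 * m + 3) * (- of_nat q) ^ m * \<chi> \<alpha> * usum m"
    unfolding sum_psi_dual_line[OF s] by (simp add: power_add power3_eq_cube)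
  finally show ?thesis by (simp add: algebra_simps)
qed

subsection \<open>The recurrence for the normalized sums\<close>

abbreviation Q :: complex where "Q \<equiv> of_nat q"
abbreviation G :: complex where "G \<equiv> G1 q \<chi> \<psi>"

lemma Q_nonzero: "Q \<noteq> 0" using q_pos by simp

lemma card_sphere_0: "of_nat (card (sphere n 0)) = (Q ^ (2 * n) + (- Q) ^ n * (Q - 1)) / Q"
  using card_sphere[of 0 n] Q_nonzero by (simp add: field_simps)

lemma U_0: "U 0 = {1\<^sub>m 0}"
proof -
  have "g = 1\<^sub>m 0" if "g \<in> carrier_mat 0 0" for g :: "'a mat" by (rule eq_matI) (use that in auto)
  then show ?thesis using U_carrier[of _ 0] one_in_U[of 0] by blast
qed

lemma usum_0: "usum 0 = 1"
  by (simp add: usum_def weight_def mat_trace_def U_0)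

text \<open>In dimensions 0 and 1 the only isotropic vector is 0.\<close>

lemma corner_sum_less_2:
  assumes "n < 2" shows "corner_sum n = usum n"
proof -
  have "of_nat (card (sphere n 0)) = (1 :: complex)"
    using assms Q_nonzero by (cases n) (auto simp: card_sphere_0 power2_eq_square less_Suc_eq numeral_2_eq_2 field_simps)
  then have c: "card (sphere n 0) = 1" by simp
  moreover have "0\<^sub>m n 1 \<in> sphere n 0" by (simp add: sphere_def ip_sum[of _ n])
  ultimately have "sphere n 0 = {0\<^sub>m n 1}" by (metis card_1_singletonE singletonD)
  moreover obtain z where "z + cj z = -1" using ex_trace[of "-1"] by auto
  ultimately show ?thesis using corner_sum_eq[of z n 0] c by simp
qed

lemma corner_sum_Suc_Suc:
  "corner_sum (Suc (Suc m)) = usum (Suc (Suc m)) + (of_nat (card (sphere (Suc (Suc m)) 0)) - 1) *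
     (usum (Suc (Suc m)) - Q ^ (2 * m + 3) * (- Q) ^ m * \<chi> \<alpha> * usum m)"
proof -
  obtain z where "z + cj z = -1" using ex_trace[of "-1"] by auto
  then show ?thesis using sum_weight_isotropic by (intro corner_sum_eq) auto
qed

lemma Q_power_double: "Q ^ (2 * n) = ((- Q) ^ n) ^ 2"
proof -
  have "((- Q) ^ n) ^ 2 = ((- Q) ^ 2) ^ n" by (simp only: power_mult[symmetric] mult.commute[of n])
  then show ?thesis by (simp only: power2_minus power_mult)
qed

text \<open>Expanding both corner sums in \<open>usum_Suc_Suc\<close> brings in the sums in
  dimensions \<open>n - 2\<close> and \<open>n - 1\<close>. The recurrence for \<open>usum n\<close>
  itself, available by induction, makes \<open>recurrence_identity\<close> applicable.\<close>

lemma usum_recurrence: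
  "usum (Suc (Suc n)) = - Q * (- Q) ^ n * G * usum (Suc n) + Q ^ 2 * ((- Q) ^ n) ^ 2 * (1 + Q * (- Q) ^ n) * \<chi> \<alpha> * usum n"
proof (induction n rule: less_induct)
  case (less n)
  have generic_count: "generic_count n = Q * ((- Q) ^ n) ^ 2 + (- Q) ^ n" for n
    unfolding generic_count_def Q_power_double using Q_nonzero by (simp add: power2_eq_square field_simps)
  have sp: "of_nat (card (sphere (Suc (Suc m)) 0)) = Q ^ 3 * ((- Q) ^ m) ^ 2 + Q * (- Q) ^ m * (Q - 1)" for m
    unfolding card_sphere_0 Q_power_double using Q_nonzero
    by (simp add: power2_eq_square power3_eq_cube field_simps)
  consider "n = 0" | "n = 1" | m where "n = Suc (Suc m)"
    by (metis One_nat_def not0_implies_Suc)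
  then show ?case
  proof cases
    case 1
    then show ?thesis using usum_1
      by (simp add: usum_Suc_Suc generic_count corner_sum_less_2 usum_0 algebra_simps power2_eq_square)
  next
    \<comment> \<open>A mixed case: the corner sum with argument 2 already has isotropic terms, that
      with argument 1 does not.\<close>
    case 2
    have "corner_sum (Suc (Suc 0)) = usum (Suc (Suc 0)) + (Q ^ 3 + Q * (Q - 1) - 1) * (usum (Suc (Suc 0)) - Q ^ 3 * \<chi> \<alpha>)"
      unfolding corner_sum_Suc_Suc sp by (simp add: usum_0)
    moreover have "usum (Suc 0) = G" using usum_1 by (simp add: corner_sum_less_2 usum_0)
    ultimately show ?thesis using 2
      unfolding 2 One_nat_def usum_Suc_Suc[of "Suc 0"] generic_count
      by (simp add: corner_sum_less_2) (simp add: eval_nat_numeral algebra_simps)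
  next
    case (3 m)
    define u where "u = (- Q) ^ m"
    have IH: "usum n = - Q * u * G * usum (Suc m) + Q ^ 2 * u ^ 2 * (1 + Q * u) * \<chi> \<alpha> * usum m"
      using less[of m] 3 by (simp add: u_def)
    have t: "(- Q) ^ n = Q ^ 2 * u" using 3 by (simp add: u_def power2_eq_square)
    have p: "Q ^ (2 * k + 3) * (- Q) ^ k = Q ^ 3 * ((- Q) ^ k) ^ 3" for k
      by (simp add: power_add Q_power_double) (simp add: power2_eq_square power3_eq_cube)
    have X0: "corner_sum n = usum n + (Q ^ 3 * u ^ 2 + Q * u * (Q - 1) - 1) * (usum n - Q ^ 3 * u ^ 3 * \<chi> \<alpha> * usum m)"
      unfolding 3 corner_sum_Suc_Suc sp p by (simp add: u_def)
    have X1: "corner_sum (Suc n) = usum (Suc n) + (Q ^ 5 * u ^ 2 - Q ^ 2 * u * (Q - 1) - 1) *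
        (usum (Suc n) + Q ^ 6 * u ^ 3 * \<chi> \<alpha> * usum (Suc m))"
    proof -
      have "(- Q) ^ Suc m = - Q * u" by (simp add: u_def)
      then show ?thesis unfolding 3 corner_sum_Suc_Suc[of "Suc m"] sp p
        by (simp only:) (simp add: eval_nat_numeral algebra_simps)
    qed
    show ?thesis
      unfolding usum_Suc_Suc generic_count t X0 X1 using recurrence_identity[OF IH, of "usum (Suc n)"] by simp
  qed
qed

text \<open>The order is multiplied by the size of the unit sphere. Written in powers of -q it
  exhibits the factor by which the normalized recurrence is multiplied.\<close>

lemma card_U_recurrence: "Q * of_nat (card (U (Suc n))) = (- Q) ^ Suc n * ((- Q) ^ Suc n - 1) * of_nat (card (U n))"
proof -
  have "Q * of_nat (card (U (Suc n))) = (Q * of_nat (card (sphere (Suc n) 1))) * of_nat (card (U n))"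
    by (simp add: card_U_Suc)
  also have "Q * of_nat (card (sphere (Suc n) 1)) = Q ^ (2 * Suc n) - (- Q) ^ Suc n"
    using card_sphere[of 1 "Suc n"] by (simp del: power_Suc)
  finally show ?thesis unfolding Q_power_double by (simp add: power2_eq_square algebra_simps)
qed

definition nsum :: "nat \<Rightarrow> complex" where "nsum n = usum n / of_nat (card (U n))"

lemma card_U_nonzero: "of_nat (card (U n)) \<noteq> (0 :: complex)"
  using card_U_pos[of n] by (metis of_nat_eq_0_iff less_irrefl)

lemma card_U_0: "card (U 0) = 1"
  by (simp add: U_0)

lemma nsum_0: "nsum 0 = 1" by (simp add: nsum_def usum_0 card_U_0)

lemma nsum_1: "nsum 1 * (- Q - 1) = - G"
proof -
  have "Q * of_nat (card (U 1)) = Q * (Q + 1)"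
    using card_U_recurrence[of 0] card_U_0 by (simp add: algebra_simps)
  then have c: "of_nat (card (U 1)) = Q + 1" using Q_nonzero by (simp only: mult_cancel_left) simp
  have s: "usum 1 = G" using usum_1 by (simp add: corner_sum_less_2 usum_0)
  have "Q + 1 \<noteq> 0" using c card_U_nonzero[of 1] by simp
  then show ?thesis unfolding nsum_def c s by (simp add: field_simps)
qed

text \<open>The ratios of consecutive group orders are t (1 + q t) and q t (q^2 t - 1) with t =
  (-q)^n. They cancel the coefficients of \<open>usum_recurrence\<close>, leaving \<open>G1\<close>
  and q times \<open>\<chi> \<alpha>\<close>, which is \<open>G2\<close>.\<close>

lemma nsum_recurrence: "nsum (Suc (Suc n)) * ((- Q) ^ Suc (Suc n) - 1) = G2 q \<chi> \<psi> * nsum n - G * nsum (Suc n)"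
proof -
  define t where "t = (- Q) ^ n"
  have t0: "t \<noteq> 0" using Q_nonzero by (simp add: t_def)
  let ?a = "of_nat (card (U n)) :: complex" and ?b = "of_nat (card (U (Suc n))) :: complex"
    and ?c = "of_nat (card (U (Suc (Suc n)))) :: complex"
  note nz = card_U_nonzero[of n] card_U_nonzero[of "Suc n"] card_U_nonzero[of "Suc (Suc n)"]
  have "Q * ?b = Q * (t * (1 + Q * t) * ?a)"
    using card_U_recurrence[of n] by (simp add: t_def algebra_simps)
  then have b: "?b = t * (1 + Q * t) * ?a" using Q_nonzero by (simp only: mult_cancel_left) blast
  have "Q * ?c = Q * (Q * t * (Q ^ 2 * t - 1) * ?b)"
    using card_U_recurrence[of "Suc n"] by (simp add: t_def power2_eq_square algebra_simps)
  then have c: "?c = Q * t * (Q ^ 2 * t - 1) * ?b" using Q_nonzero by (simp only: mult_cancel_left) blast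
  \<comment> \<open>These factors divide group orders, which are not zero.\<close>
  have e: "Q ^ 2 * t - 1 \<noteq> 0" "1 + Q * t \<noteq> 0" using nz b c by auto
  have s: "usum (Suc (Suc n)) = - Q * t * G * usum (Suc n) + Q ^ 2 * t ^ 2 * (1 + Q * t) * \<chi> \<alpha> * usum n"
    using usum_recurrence[of n] by (simp add: t_def)
  have "nsum (Suc (Suc n)) * ((- Q) ^ Suc (Suc n) - 1) = usum (Suc (Suc n)) / (Q * t * ?b)"
  proof -
    have "(- Q) ^ Suc (Suc n) = Q ^ 2 * t" by (simp add: t_def power2_eq_square)
    then show ?thesis using e unfolding nsum_def c by simp
  qed
  also have "\<dots> = - G * usum (Suc n) / ?b + Q * (t * (1 + Q * t)) * \<chi> \<alpha> * usum n / ?b"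
    unfolding s using Q_nonzero t0 nz(2) by (simp add: field_simps power2_eq_square)
  also have "Q * (t * (1 + Q * t)) * \<chi> \<alpha> * usum n / ?b = Q * \<chi> \<alpha> * nsum n"
  proof -
    define y where "y = t * (1 + Q * t)"
    have "y \<noteq> 0" using e(2) t0 by (simp add: y_def)
    then show ?thesis unfolding nsum_def b y_def[symmetric] by simp
  qed
  finally show ?thesis by (simp add: G2_eq nsum_def)
qed

lemma unitary_gf_nth: "fps_nth (unitary_gf q \<chi> \<psi>) n = nsum n"
  by (cases "n = 0") (simp_all add: unitary_gf_def nsum_0, simp add: nsum_def usum_def weight_def)

end

text \<open>The infinite product is taken coefficientwise in the complex numbers. The factors tend
  to 1 only in this sense: their linear and quadratic coefficients tend to 0 but in general never
  vanish, so the product need not converge X-adically.\<close>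

theorem theorem3:
  fixes q :: nat and \<chi> \<psi> :: "'a::{finite, field} \<Rightarrow> complex"
  assumes "\<exists>p k. prime p \<and> k > 0 \<and> q = p ^ k"
    and "card (UNIV :: 'a set) = q ^ 2"
    and "mult_char \<chi>"
    and "add_char \<psi>" and "\<exists>x. \<psi> x \<noteq> 1"
  shows "\<forall>N. (\<lambda>M. fps_nth (\<Prod>i\<in>{1..M}. unitary_factor q (G1 q \<chi> \<psi>) (G2 q \<chi> \<psi>) i) N)
           \<longlonglongrightarrow> fps_nth (unitary_gf q \<chi> \<psi>) N"
proof
  fix N
  interpret unitary_gauss q \<chi> \<psi> by standard (fact assms)+
  show "(\<lambda>M. fps_nth (\<Prod>i\<in>{1..M}. unitary_factor q (G1 q \<chi> \<psi>) (G2 q \<chi> \<psi>) i) N)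
           \<longlonglongrightarrow> fps_nth (unitary_gf q \<chi> \<psi>) N"
    unfolding unitary_gf_nth by (rule unitary_product_limit[OF q_ge_2 nsum_0 nsum_1 nsum_recurrence])
qed

end
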